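(* Let $d\ge2$, $1<p<\infty$, $G(u)=\frac14(1-u^2)^2$, and for $\phi,L>0$ let $\Omega_{\phi,L}=[-\phi L/2,\phi L/2]^d$. Define on $-1+L^p(\mathbb R^d)$ $$\mathcal E_{\phi L}(u)=\begin{cases}\displaystyle\int_{\Omega_{\phi,L}}\frac\phi2|\nabla u|^2+\frac1\phi\big(G(u)-G(-1+\phi)\big)\,dx & \text{if } u\in(H^1\cap L^4)(\Omega_{\phi,L}),\ u=-1\text{ on }\mathbb R^d\setminus\Omega_{\phi,L},\ \frac{1}{|\Omega_{\phi,L}|}\int_{\Omega_{\phi,L}}u\,dx=-1+\phi,\\ +\infty&\text{otherwise.}\end{cases}$$ Let $0<\xi<\infty$ and define on $-1+L^p(\mathbb R^d)$ $$\mathcal E_0^\xi(u)=\begin{cases}c_0\,\mathrm{Per}(C)-4|C|+4\xi^{-(d+1)}|C|^2 &\text{if }u=\pm1\text{ a.e. and }\mathrm{Per}(C)<\infty,\text{ where }C=\{x:u(x)=1\},\\ +\infty&\text{otherwise.}\end{cases}$$ Then, for $\phi\downarrow0$ and $L\uparrow\infty$ with $\phi L^{d/(d+1)}\to\xi$, $\mathcal E_{\phi L}$ $\Gamma$-converges to $\mathcal E_0^\xi$ on $-1+L^p(\mathbb R^d)$ equipped with the topology of the $L^p(\mathbb R^d)$-distance.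
   Context: $c_0=\int_{-1}^1\sqrt{2G(s)}\,ds=\frac{2\sqrt2}{3}$. $\mathrm{Per}(C)$ is the perimeter of $C$ in $\mathbb R^d$ and $|C|$ its Lebesgue measure. $-1+L^p(\mathbb R^d)$ denotes functions $u$ with $u+1\in L^p(\mathbb R^d)$. $\Gamma$-convergence means: for every sequence $(\phi_n,L_n)$ with $\phi_n\to0$, $L_n\to\infty$, $\phi_nL_n^{d/(d+1)}\to\xi$, (i) whenever $u_n\to u_0$ in $L^p$, $\liminf_n\mathcal E_{\phi_nL_n}(u_n)\ge\mathcal E_0^\xi(u_0)$, and (ii) for every $u_0$ there is a sequence $u_n\to u_0$ in $L^p$ with $\limsup_n\mathcal E_{\phi_nL_n}(u_n)\le\mathcal E_0^\xi(u_0)$. *)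

theory Defs
  imports "HOL-Analysis.Analysis"
begin

definition G :: "real \<Rightarrow> real" where
  "G s = (1 - s\<^sup>2)\<^sup>2 / 4"

(* c_0 = int_{-1}^1 sqrt(2 G(s)) ds = 2 sqrt 2 / 3 *)
definition c0 :: real where
  "c0 = 2 * sqrt 2 / 3"

definition supp :: "('a::real_normed_vector \<Rightarrow> 'b::real_normed_vector) \<Rightarrow> 'a set" where
  "supp f = closure {x. f x \<noteq> 0}"

definition C1c :: "('a::euclidean_space \<Rightarrow> 'b::real_normed_vector) \<Rightarrow> bool" where
  "C1c f \<longleftrightarrow> (\<forall>x. f differentiable (at x)) \<and>
     (\<forall>i\<in>Basis. continuous_on UNIV (\<lambda>x. frechet_derivative f (at x) i)) \<and>
     compact (supp f)"

definition div_field :: "('a::euclidean_space \<Rightarrow> 'a) \<Rightarrow> 'a \<Rightarrow> real" where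
  "div_field f x = (\<Sum>i\<in>Basis. frechet_derivative f (at x) i \<bullet> i)"

definition Per :: "'a::euclidean_space set \<Rightarrow> ereal" where
  "Per C = (SUP f \<in> {f :: 'a \<Rightarrow> 'a. C1c f \<and> (\<forall>x. norm (f x) \<le> 1)}.
              ereal (LINT x:C|lebesgue. div_field f x))"

(* u \<in> H^1(U) (U open) with weak gradient g *)
definition H1_grad :: "'a::euclidean_space set \<Rightarrow> ('a \<Rightarrow> real) \<Rightarrow> ('a \<Rightarrow> 'a) \<Rightarrow> bool" where
  "H1_grad U u g \<longleftrightarrow>
     set_borel_measurable lebesgue U u \<and> set_borel_measurable lebesgue U g \<and>
     set_integrable lebesgue U (\<lambda>x. (u x)\<^sup>2) \<and>
     set_integrable lebesgue U (\<lambda>x. (norm (g x))\<^sup>2) \<and>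
     (\<forall>i\<in>Basis. \<forall>\<psi>::'a \<Rightarrow> real. C1c \<psi> \<and> supp \<psi> \<subseteq> U \<longrightarrow>
        (LINT x:U|lebesgue. u x * frechet_derivative \<psi> (at x) i)
          = - (LINT x:U|lebesgue. (g x \<bullet> i) * \<psi> x))"

definition Omega :: "real \<Rightarrow> real \<Rightarrow> 'a::euclidean_space set" where
  "Omega \<phi> L = cbox (- ((\<phi> * L / 2) *\<^sub>R One)) ((\<phi> * L / 2) *\<^sub>R One)"

definition minus1_Lp :: "real \<Rightarrow> ('a::euclidean_space \<Rightarrow> real) \<Rightarrow> bool" where
  "minus1_Lp p u \<longleftrightarrow> u \<in> borel_measurable lebesgue \<and>
     (\<integral>\<^sup>+ x. ennreal (\<bar>u x + 1\<bar> powr p) \<partial>lebesgue) < \<infinity>"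

definition Lp_conv :: "real \<Rightarrow> (nat \<Rightarrow> 'a::euclidean_space \<Rightarrow> real) \<Rightarrow> ('a \<Rightarrow> real) \<Rightarrow> bool" where
  "Lp_conv p un u \<longleftrightarrow>
     (\<lambda>n. \<integral>\<^sup>+ x. ennreal (\<bar>un n x - u x\<bar> powr p) \<partial>lebesgue) \<longlonglongrightarrow> 0"

definition admissible :: "real \<Rightarrow> real \<Rightarrow> ('a::euclidean_space \<Rightarrow> real) \<Rightarrow> bool" where
  "admissible \<phi> L u \<longleftrightarrow>
     (\<exists>g. H1_grad (interior (Omega \<phi> L)) u g) \<and>
     set_integrable lebesgue (Omega \<phi> L) (\<lambda>x. (u x) ^ 4) \<and>
     (AE x in lebesgue. x \<notin> Omega \<phi> L \<longrightarrow> u x = -1) \<and>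
     (LINT x:Omega \<phi> L|lebesgue. u x) / measure lebesgue (Omega \<phi> L :: 'a set) = -1 + \<phi>"

definition E_phiL :: "real \<Rightarrow> real \<Rightarrow> ('a::euclidean_space \<Rightarrow> real) \<Rightarrow> ereal" where
  "E_phiL \<phi> L u =
     (if admissible \<phi> L u then
        (let g = (SOME g. H1_grad (interior (Omega \<phi> L)) u g) in
          ereal (LINT x:Omega \<phi> L|lebesgue.
                   \<phi> / 2 * (norm (g x))\<^sup>2 + 1 / \<phi> * (G (u x) - G (-1 + \<phi>))))
      else \<infinity>)"

definition E0 :: "real \<Rightarrow> ('a::euclidean_space \<Rightarrow> real) \<Rightarrow> ereal" where
  "E0 \<xi> u =
     (let C = {x. u x = 1} in
      if (AE x in lebesgue. u x = 1 \<or> u x = -1) \<and> Per C < \<infinity> then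
        ereal (c0 * real_of_ereal (Per C) - 4 * measure lebesgue C
               + 4 * inverse (\<xi> ^ (DIM('a) + 1)) * (measure lebesgue C)\<^sup>2)
      else \<infinity>)"

end

theory Submission
  imports Defs
begin

text \<open>
  Let \<open>m\<close> be the limit of \<open>\<phi> |\<Omega>|\<close>, that is \<open>\<xi>\<close> to the power \<open>d + 1\<close>; up to the constant \<open>- m\<close> the
  limit energy is \<open>c0 Per C + (m - 2 |C|)\<^sup>2 / m\<close>.

  Lower bound: where \<open>|u| < b\<close> the energy density dominates the gradient of a truncated Modica-Mortola
  primitive of \<open>u\<close>, and where \<open>u \<le> - b\<close> it dominates \<open>(1 + u)\<^sup>2 / \<phi>\<close> up to a factor tending to 1 as
  \<open>b \<rightarrow> 1\<close>. The two regions are disjoint, so interface and background costs add up. The former passes to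
  the limit by duality with \<open>C1c\<close> fields; the latter is bounded by the Cauchy-Schwarz inequality and
  the mass constraint.

  Upper bound: neither the coarea formula nor regularity of level sets is needed. Mollification and
  cut-off yield a compactly supported \<open>C\<^sup>2\<close> function \<open>f\<close> close to the indicator of \<open>C\<close> whose total
  variation is almost at most \<open>Per C\<close>. With \<open>a = sqrt (|Df|\<^sup>2 + \<eta>\<^sup>2)\<close> and a one-dimensional profile \<open>q\<close>, the
  competitors \<open>q ((f - t) / (\<phi> a))\<close> have energies whose integral over the level \<open>t\<close> is, by the
  substitution \<open>t = f - \<phi> a s\<close>, the cost of \<open>q\<close> times the integral of \<open>a\<close>; hence some level is good.
  A constant of order \<open>\<phi>\<close> added on \<open>\<Omega>\<close> corrects the mass.
\<close>

subsection \<open>Continuously differentiable functions with compact support\<close>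

text \<open>The square comes from the quadratic well: \<open>G (-1 + s)\<close> behaves like
  \<open>s\<^sup>2\<close>. The constraint fixes the integral of \<open>1 + u\<close> over the cube
  at \<open>\<phi> |\<Omega>|\<close>, close to \<open>m\<close>; the phase absorbs
  \<open>2 |C|\<close> of it, and the remainder, spread evenly, costs
  \<open>(m - 2 |C|)\<^sup>2 / m\<close>. This is of the same order as the interface cost, so its
  coefficient has to be exact in both bounds. The perimeter is given only as a supremum over test
  fields. In the upper bound it is exploited by inserting the field \<open>- Df / a\<close>, which
  is why \<open>f\<close> has to be \<open>C\<^sup>2\<close>; the number \<open>\<eta>\<close> keeps
  \<open>a\<close> away from 0 at critical points of \<open>f\<close>. Two obstacles shape the
  details. \<open>E_phiL\<close> picks its weak gradient by \<open>SOME\<close>, so the explicit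
  gradient of a competitor must be identified with it by a uniqueness theorem. And
  \<open>L\<^sup>p\<close> convergence on a space of infinite measure gives no
  \<open>L\<^sup>1\<close> convergence: additive errors may be spent only on sets of finite measure
  or against integrable weights.\<close>

lemma C1c_has_derivative:
  assumes "C1c f"
  shows "(f has_derivative frechet_derivative f (at x)) (at x)"
  using assms frechet_derivative_works unfolding C1c_def by blast

lemma C1c_continuous_partial:
  assumes "C1c f" "i \<in> Basis"
  shows "continuous_on UNIV (\<lambda>x. frechet_derivative f (at x) i)"
  using assms unfolding C1c_def by blast

lemma C1c_continuous:
  assumes "C1c f"
  shows "continuous_on UNIV f"
  by (intro continuous_at_imp_continuous_on ballI has_derivative_continuous[OF C1c_has_derivative[OF assms]])

lemma frechet_derivativeI:
  assumes "(f has_derivative f') (at x)"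
  shows "frechet_derivative f (at x) = f'"
  using frechet_derivative_at[OF assms] by simp

lemma C1cI:
  fixes f :: "'a::euclidean_space \<Rightarrow> 'b::real_normed_vector"
  assumes "\<And>x. (f has_derivative f' x) (at x)"
    and "\<And>i. i \<in> Basis \<Longrightarrow> continuous_on UNIV (\<lambda>x. f' x i)"
    and "\<And>x. norm x > R \<Longrightarrow> f x = 0"
  shows "C1c f"
proof -
  have eq: "frechet_derivative f (at x) = f' x" for x
    using assms(1) by (rule frechet_derivativeI)
  have "{x. f x \<noteq> 0} \<subseteq> cball 0 R"
    using assms(3) by (force simp: not_le[symmetric])
  then have "bounded {x. f x \<noteq> 0}"
    using bounded_cball bounded_subset by blast
  then have "compact (supp f)"
    unfolding supp_def by simp
  then show ?thesis
    unfolding C1c_def eq using assms(1,2) differentiableI by blast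
qed

lemma not_in_supp:
  assumes "x \<notin> supp f"
  shows "f x = 0" and "frechet_derivative f (at x) = (\<lambda>_. 0)"
proof -
  have cl: "closed (supp f)" by (simp add: supp_def)
  have z: "f y = 0" if "y \<notin> supp f" for y
    using that closure_subset[of "{x. f x \<noteq> 0}"] by (auto simp: supp_def)
  show "f x = 0" using z assms .
  have "open (- supp f)" using cl by auto
  then have ev: "eventually (\<lambda>y. y \<in> - supp f) (nhds x)"
    using assms eventually_nhds by blast
  have "((\<lambda>_. 0) has_derivative (\<lambda>_. 0)) (at x)" by simp
  moreover have "eventually (\<lambda>y. (\<lambda>_. 0) y = f y) (at x)"
    using ev z unfolding eventually_at_filter by (auto elim: eventually_mono)
  ultimately have "(f has_derivative (\<lambda>_. 0)) (at x)"
    by (rule has_derivative_transform_eventually) (use z assms in auto)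
  then show "frechet_derivative f (at x) = (\<lambda>_. 0)"
    by (rule frechet_derivativeI)
qed

lemma C1c_vanishes:
  assumes "C1c f"
  obtains R where "R > 0" "supp f \<subseteq> ball 0 R"
    "\<And>x. norm x \<ge> R \<Longrightarrow> f x = 0"
    "\<And>x. norm x \<ge> R \<Longrightarrow> frechet_derivative f (at x) = (\<lambda>_. 0)"
proof -
  have "bounded (supp f)" using assms compact_imp_bounded by (auto simp: C1c_def)
  then obtain R where R: "R > 0" "supp f \<subseteq> ball 0 R"
    using bounded_subset_ballD by blast
  then have "x \<notin> supp f" if "norm x \<ge> R" for x
    using that by auto
  then show ?thesis using that R not_in_supp[of _ f] by blast
qed

lemma continuous_vanishing_bounded:
  fixes f :: "'a::euclidean_space \<Rightarrow> 'b::real_normed_vector"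
  assumes "continuous_on UNIV f" "\<And>x. norm x \<ge> R \<Longrightarrow> f x = 0"
  obtains M where "M > 0" "\<And>x. norm (f x) \<le> M"
proof -
  have "compact (f ` cball 0 R)"
    by (intro compact_continuous_image continuous_on_subset[OF assms(1)]) auto
  then obtain M where M: "M > 0" "\<And>y. y \<in> f ` cball 0 R \<Longrightarrow> norm y \<le> M"
    using compact_imp_bounded bounded_pos by metis
  have "norm (f x) \<le> M" for x
  proof (cases "norm x \<le> R")
    case True then show ?thesis using M(2) by auto
  next
    case False then show ?thesis using assms(2)[of x] M(1) by auto
  qed
  then show ?thesis using that M(1) by blast
qed

lemma continuous_vanishing_integrable:
  fixes f :: "'a::euclidean_space \<Rightarrow> 'b::{banach, second_countable_topology}"
  assumes "continuous_on UNIV f" "\<And>x. norm x \<ge> R \<Longrightarrow> f x = 0"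
  shows "integrable lborel f"
proof -
  have "integrable lborel (\<lambda>x. indicator (cball 0 R) x *\<^sub>R f x)"
    by (intro borel_integrable_compact continuous_on_subset[OF assms(1)]) auto
  moreover have "indicator (cball 0 R) x *\<^sub>R f x = f x" for x
    using assms(2)[of x] by (auto simp: indicator_def)
  ultimately show ?thesis by simp
qed

section \<open>Translation and reflection invariance of the Lebesgue integral\<close>

lemma lborel_integral_translate:
  fixes f :: "'a::euclidean_space \<Rightarrow> 'b::{banach, second_countable_topology}"
  shows "(\<integral>x. f (c + x) \<partial>lborel) = (\<integral>x. f x \<partial>lborel)"
    and "integrable lborel (\<lambda>x. f (c + x)) \<longleftrightarrow> integrable lborel f"
proof -
  have sub: "integrable lborel (\<lambda>x. g (c + x))" if g: "integrable lborel g"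
    for g :: "'a \<Rightarrow> 'b" and c
  proof -
    have "integrable (distr lborel borel ((+) c)) g" using g by (simp add: lborel_distr_plus)
    then show ?thesis by (rule integrable_distr[rotated]) simp
  qed
  show iff: "integrable lborel (\<lambda>x. f (c + x)) \<longleftrightarrow> integrable lborel f"
  proof
    assume "integrable lborel (\<lambda>x. f (c + x))"
    from sub[OF this, of "-c"] show "integrable lborel f" by simp
  qed (rule sub)
  show "(\<integral>x. f (c + x) \<partial>lborel) = (\<integral>x. f x \<partial>lborel)"
  proof (cases "integrable lborel f")
    case True
    have "(\<integral>x. f x \<partial>lborel) = (\<integral>x. f x \<partial>distr lborel borel ((+) c))"
      by (simp add: lborel_distr_plus)
    also have "\<dots> = (\<integral>x. f (c + x) \<partial>lborel)"
      using True by (subst integral_distr) (auto dest: borel_measurable_integrable)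
    finally show ?thesis by simp
  next
    \<comment> \<open>Neither function is integrable, so both integrals take the default value
      0.\<close>
    case False
    then show ?thesis using iff not_integrable_integral_eq by metis
  qed
qed

lemma lborel_nn_integral_translate:
  fixes f :: "'a::euclidean_space \<Rightarrow> ennreal"
  assumes "f \<in> borel_measurable borel"
  shows "(\<integral>\<^sup>+x. f (c + x) \<partial>lborel) = (\<integral>\<^sup>+x. f x \<partial>lborel)"
proof -
  have "(\<integral>\<^sup>+x. f x \<partial>lborel) = (\<integral>\<^sup>+x. f x \<partial>distr lborel borel ((+) c))"
    by (simp add: lborel_distr_plus)
  also have "\<dots> = (\<integral>\<^sup>+x. f (c + x) \<partial>lborel)"
    using assms by (subst nn_integral_distr) auto
  finally show ?thesis by simp
qed

lemma lborel_distr_reflect: "distr lborel borel (\<lambda>x. - x) = (lborel :: 'a::euclidean_space measure)"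
proof -
  show ?thesis
    by (subst (2) lborel_affine[of "-1::real" "0::'a"]) (auto simp: density_1)
qed

lemma lborel_integral_reflect:
  fixes f :: "'a::euclidean_space \<Rightarrow> 'b::{banach, second_countable_topology}"
  shows "(\<integral>x. f (c - x) \<partial>lborel) = (\<integral>x. f x \<partial>lborel)"
    and "integrable lborel (\<lambda>x. f (c - x)) \<longleftrightarrow> integrable lborel f"
proof -
  have sub: "integrable lborel (\<lambda>x. g (- x))" if g: "integrable lborel g"
    for g :: "'a \<Rightarrow> 'b"
  proof -
    have "integrable (distr lborel borel (\<lambda>x. - x)) g" using g by (simp add: lborel_distr_reflect)
    then show ?thesis by (rule integrable_distr[rotated]) simp
  qed
  have iff: "integrable lborel (\<lambda>x. g (- x)) \<longleftrightarrow> integrable lborel g" for g :: "'a \<Rightarrow> 'b"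
    using sub[of "\<lambda>x. g (- x)"] sub[of g] by auto
  have eq: "(\<integral>x. g (- x) \<partial>lborel) = (\<integral>x. g x \<partial>lborel)" for g :: "'a \<Rightarrow> 'b"
  proof (cases "integrable lborel g")
    case True
    have "(\<integral>x. g x \<partial>lborel) = (\<integral>x. g x \<partial>distr lborel borel (\<lambda>x. - x))"
      by (simp add: lborel_distr_reflect)
    also have "\<dots> = (\<integral>x. g (- x) \<partial>lborel)"
      using True by (subst integral_distr) (auto dest: borel_measurable_integrable)
    finally show ?thesis by simp
  next
    case False
    then show ?thesis using iff not_integrable_integral_eq by metis
  qed
  show "integrable lborel (\<lambda>x. f (c - x)) \<longleftrightarrow> integrable lborel f"
    using iff[of "\<lambda>x. f (c + x)"] lborel_integral_translate(2)[of f c] by simp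
  show "(\<integral>x. f (c - x) \<partial>lborel) = (\<integral>x. f x \<partial>lborel)"
    using eq[of "\<lambda>x. f (c + x)"] lborel_integral_translate(1)[of f c] by simp
qed

text \<open>Steps of length \<open>1 / Suc n\<close> make the directional derivative a limit along a
  sequence, the form in which dominated convergence can use it.\<close>

lemma has_derivative_difference_quotient:
  fixes f :: "'a::real_normed_vector \<Rightarrow> real"
  assumes "(f has_derivative f') (at x)"
  shows "(\<lambda>n. (f (x + (1 / real (Suc n)) *\<^sub>R i) - f x) / (1 / real (Suc n))) \<longlonglongrightarrow> f' i"
proof -
  have l: "((\<lambda>t. x + t *\<^sub>R i) has_derivative (\<lambda>t. t *\<^sub>R i)) (at 0)"
    by (auto intro!: derivative_eq_intros)
  have "((\<lambda>t. f (x + t *\<^sub>R i)) has_derivative (\<lambda>t. f' (t *\<^sub>R i))) (at 0)"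
    by (rule has_derivative_compose[OF l]) (use assms in simp)
  moreover have "(\<lambda>t. f' (t *\<^sub>R i)) = (*) (f' i)"
    using linear_cmul[OF has_derivative_linear[OF assms]] by (auto simp: mult.commute)
  ultimately have "((\<lambda>t. f (x + t *\<^sub>R i)) has_field_derivative f' i) (at 0)"
    unfolding has_field_derivative_def by simp
  then have "((\<lambda>t. (f (x + t *\<^sub>R i) - f x) / t) \<longlongrightarrow> f' i) (at 0)"
    by (simp add: DERIV_def)
  moreover have "filterlim (\<lambda>n. 1 / real (Suc n)) (at 0) sequentially"
    unfolding filterlim_at using LIMSEQ_Suc[OF lim_1_over_n[where 'a=real]] by simp
  ultimately show ?thesis
    by (rule filterlim_compose)
qed

lemma has_derivative_bound:
  fixes f :: "'a::real_normed_vector \<Rightarrow> 'b::real_normed_vector"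
  assumes "\<And>x. (f has_derivative f' x) (at x)" "\<And>x h. norm (f' x h) \<le> M * norm h" "M \<ge> 0"
  shows "norm (f x - f y) \<le> M * norm (x - y)"
proof (rule differentiable_bound[OF convex_UNIV])
  show "onorm (f' x) \<le> M" for x
    by (rule onorm_bound[OF assms(3,2)])
qed (use assms(1) has_derivative_at_withinI in auto)

lemma integrable_indicator_bounded:
  fixes A :: "'a::euclidean_space set"
  assumes "bounded A" "A \<in> sets borel"
  shows "integrable lborel (indicator A :: 'a \<Rightarrow> real)"
  by (intro integrable_real_indicator emeasure_bounded_finite) (use assms in simp_all)

text \<open>Freezing \<open>P\<close> to the left of \<open>a\<close> creates no corner because
  \<open>P' a = 0\<close>. The bump function, the Modica-Mortola primitive and the profile all owe
  their \<open>C\<^sup>1\<close> regularity to this.\<close>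

lemma has_real_derivative_max:
  fixes P :: "real \<Rightarrow> real"
  assumes P: "\<And>x. (P has_real_derivative P' x) (at x)" and "P' a = 0"
  shows "((\<lambda>x. P (max a x)) has_real_derivative P' (max a x)) (at x)"
proof -
  consider "x < a" | "x > a" | "x = a" by linarith
  then show ?thesis
  proof cases
    case 1
    have "((\<lambda>_. P a) has_real_derivative 0) (at x)" by simp
    then have "((\<lambda>x. P (max a x)) has_real_derivative 0) (at x)"
      by (rule has_field_derivative_transform_within_open[where S = "{..<a}"]) (use 1 in \<open>auto simp: max_def\<close>)
    then show ?thesis using 1 assms(2) by (simp add: max_def)
  next
    case 2
    have "((\<lambda>x. P (max a x)) has_real_derivative P' x) (at x)"
      by (rule has_field_derivative_transform_within_open[where S = "{a<..}", OF P])
        (use 2 in \<open>auto simp: max_def\<close>)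
    then show ?thesis using 2 by (simp add: max_def)
  next
    case 3
    have "((\<lambda>y. (P y - P a) / (y - a)) \<longlongrightarrow> 0) (at a)"
      using P[of a] assms(2) by (simp add: has_field_derivative_iff)
    then have "((\<lambda>y. (P (max a y) - P a) / (y - a)) \<longlongrightarrow> 0) (at a)"
      by (rule Lim_null_comparison[rotated, OF tendsto_rabs_zero])
        (auto simp: max_def intro!: always_eventually)
    then show ?thesis using 3 assms(2) by (simp add: has_field_derivative_iff)
  qed
qed

text \<open>The reflection \<open>x \<mapsto> - x\<close> turns an upper truncation into a lower
  one.\<close>

lemma has_real_derivative_min:
  fixes P :: "real \<Rightarrow> real"
  assumes P: "\<And>x. (P has_real_derivative P' x) (at x)" and "P' b = 0"
  shows "((\<lambda>x. P (min b x)) has_real_derivative P' (min b x)) (at x)"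
proof -
  have "((\<lambda>x. P (- x)) has_real_derivative - P' (- x)) (at x)" for x
    using P[of "- x"] by (subst DERIV_mirror[symmetric])
  from has_real_derivative_max[OF this, of "- b" "- x"] assms(2)
  have "((\<lambda>x. P (- max (- b) x)) has_real_derivative - P' (- max (- b) (- x))) (at (- x))" by simp
  then have "((\<lambda>x. P (- max (- b) (- x))) has_real_derivative P' (- max (- b) (- x))) (at x)"
    by (subst (asm) DERIV_mirror) simp
  moreover have "- max (- b) (- y) = min b y" for y by (auto simp: max_def min_def)
  ultimately show ?thesis by simp
qed

lemma has_real_derivative_clamp:
  fixes P :: "real \<Rightarrow> real"
  assumes P: "\<And>x. (P has_real_derivative P' x) (at x)" and "P' a = 0" "P' b = 0" "a \<le> b"
  shows "((\<lambda>x. P (max a (min b x))) has_real_derivative P' (max a (min b x))) (at x)"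
  by (rule has_real_derivative_min[of "\<lambda>x. P (max a x)" "\<lambda>x. P' (max a x)"])
     (use assms has_real_derivative_max in \<open>auto simp: max_def\<close>)

section \<open>Bounds for test functions and integration by parts\<close>

lemma C1c_derivative_expand:
  fixes f :: "'a::euclidean_space \<Rightarrow> 'b::real_normed_vector"
  assumes "C1c f"
  shows "frechet_derivative f (at x) h = (\<Sum>i\<in>Basis. (h \<bullet> i) *\<^sub>R frechet_derivative f (at x) i)"
proof -
  have l: "linear (frechet_derivative f (at x))"
    using C1c_has_derivative[OF assms] has_derivative_linear by blast
  have "frechet_derivative f (at x) h = frechet_derivative f (at x) (\<Sum>i\<in>Basis. (h \<bullet> i) *\<^sub>R i)"
    by (simp add: euclidean_representation)
  then show ?thesis using l by (simp add: linear_sum linear_cmul o_def)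
qed

lemma C1c_continuous_derivative:
  assumes "C1c f"
  shows "continuous_on UNIV (\<lambda>x. frechet_derivative f (at x) h)"
  by (subst C1c_derivative_expand[OF assms])
     (intro continuous_intros C1c_continuous_partial[OF assms])

lemma C1c_derivative_bounded:
  fixes f :: "'a::euclidean_space \<Rightarrow> 'b::real_normed_vector"
  assumes "C1c f"
  obtains M where "M > 0" "\<And>x h. norm (frechet_derivative f (at x) h) \<le> M * norm h"
proof -
  obtain R where R: "\<And>x. norm x \<ge> R \<Longrightarrow> frechet_derivative f (at x) = (\<lambda>_. 0)"
    using C1c_vanishes[OF assms] by metis
  have "\<exists>M>0. \<forall>x. norm (frechet_derivative f (at x) i) \<le> M" if "i \<in> Basis" for i
    using continuous_vanishing_bounded[OF C1c_continuous_partial[OF assms that], of R] R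
    by (metis (no_types, lifting))
  then obtain M where M: "\<And>i x. i \<in> Basis \<Longrightarrow> norm (frechet_derivative f (at x) i) \<le> M i"
      "\<And>i. i \<in> Basis \<Longrightarrow> M i > 0" by metis
  have "norm (frechet_derivative f (at x) h) \<le> (\<Sum>i\<in>Basis. M i) * norm h" for x h
  proof -
    have "norm (frechet_derivative f (at x) h) \<le> (\<Sum>i\<in>Basis. norm ((h \<bullet> i) *\<^sub>R frechet_derivative f (at x) i))"
      by (subst C1c_derivative_expand[OF assms]) (rule norm_sum)
    also have "\<dots> \<le> (\<Sum>i\<in>Basis. M i * norm h)"
      using M Basis_le_norm[of _ h]
      by (intro sum_mono) (auto simp: mult.commute[of "M _"] intro!: mult_mono)
    finally show ?thesis by (simp add: sum_distrib_right)
  qed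
  moreover have "(\<Sum>i\<in>Basis. M i) > 0" using M(2) by (intro sum_pos) auto
  ultimately show ?thesis using that by blast
qed

lemma C1c_lipschitz:
  fixes f :: "'a::euclidean_space \<Rightarrow> 'b::real_normed_vector"
  assumes "C1c f" "M \<ge> 0" "\<And>x h. norm (frechet_derivative f (at x) h) \<le> M * norm h"
  shows "norm (f x - f y) \<le> M * norm (x - y)"
  by (rule has_derivative_bound[OF C1c_has_derivative[OF assms(1)] assms(3,2)])

text \<open>By translation invariance every difference quotient of \<open>\<zeta>\<close> has
  integral 0, and dominated convergence hands this on to the derivative.\<close>

lemma integral_partial_derivative_zero:
  fixes \<zeta> :: "'a::euclidean_space \<Rightarrow> real"
  assumes \<zeta>: "C1c \<zeta>" and i: "i \<in> Basis"
  shows "(\<integral>x. frechet_derivative \<zeta> (at x) i \<partial>lborel) = 0"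
proof -
  obtain R where R: "R > 0" "\<And>x. norm x \<ge> R \<Longrightarrow> \<zeta> x = 0"
    using C1c_vanishes[OF \<zeta>] by metis
  obtain M where M: "M > 0" "\<And>x h. norm (frechet_derivative \<zeta> (at x) h) \<le> M * norm h"
    using C1c_derivative_bounded[OF \<zeta>] by metis
  define h where "h n = 1 / real (Suc n)" for n
  define q where "q n x = (\<zeta> (x + h n *\<^sub>R i) - \<zeta> x) / h n" for n x
  have h: "0 < h n" "h n \<le> 1" for n by (auto simp: h_def)
  have int: "integrable lborel \<zeta>"
    using C1c_continuous[OF \<zeta>] R(2) by (rule continuous_vanishing_integrable)
  have int': "integrable lborel (\<lambda>x. \<zeta> (x + c))" for c
    using int lborel_integral_translate(2)[of \<zeta> c] by (simp add: add.commute)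
  have zero: "(\<integral>x. q n x \<partial>lborel) = 0" for n
    using int int'[of "h n *\<^sub>R i"] lborel_integral_translate(1)[of \<zeta> "h n *\<^sub>R i"]
    by (simp add: q_def add.commute[of _ "h n *\<^sub>R i"])
  have "(\<lambda>n. \<integral>x. q n x \<partial>lborel) \<longlonglongrightarrow> (\<integral>x. frechet_derivative \<zeta> (at x) i \<partial>lborel)"
  \<comment> \<open>The quotients are bounded by the Lipschitz constant \<open>M\<close>; as the
    step is at most 1, they vanish outside the ball of radius \<open>R + 1\<close>.\<close>
  proof (rule integral_dominated_convergence[where w = "\<lambda>x. M * indicator (cball 0 (R + 1)) x"])
    show "(\<lambda>x. frechet_derivative \<zeta> (at x) i) \<in> borel_measurable lborel"
      using borel_measurable_continuous_onI[OF C1c_continuous_partial[OF \<zeta> i]] by simp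
    show "q n \<in> borel_measurable lborel" for n
      unfolding q_def using borel_measurable_integrable[OF int] borel_measurable_integrable[OF int'] by simp
    show "integrable lborel (\<lambda>x. M * indicator (cball (0::'a) (R + 1)) x :: real)"
      by (intro integrable_mult_right integrable_indicator_bounded) auto
    show "AE x in lborel. (\<lambda>n. q n x) \<longlonglongrightarrow> frechet_derivative \<zeta> (at x) i"
      unfolding q_def h_def using has_derivative_difference_quotient[OF C1c_has_derivative[OF \<zeta>]] by auto
    show "AE x in lborel. norm (q n x) \<le> M * indicator (cball 0 (R + 1)) x" for n
    proof (rule AE_I2)
      fix x
      have "norm (\<zeta> (x + h n *\<^sub>R i) - \<zeta> x) \<le> M * norm (h n *\<^sub>R i)"
        using C1c_lipschitz[OF \<zeta> _ M(2), of "x + h n *\<^sub>R i" x] M(1) by simp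
      then have 1: "norm (q n x) \<le> M"
        using h[of n] i by (simp add: q_def field_simps)
      show "norm (q n x) \<le> M * indicator (cball 0 (R + 1)) x"
      proof (cases "norm x \<le> R + 1")
        case True then show ?thesis using 1 by simp
      next
        case False
        have "norm x \<le> norm (x + h n *\<^sub>R i) + norm (h n *\<^sub>R i)"
          using norm_triangle_ineq4[of "x + h n *\<^sub>R i" "h n *\<^sub>R i"] by simp
        then have "norm (x + h n *\<^sub>R i) \<ge> R" using False h[of n] i by simp
        then have "q n x = 0" using R False by (simp add: q_def)
        then show ?thesis using M by simp
      qed
    qed
  qed
  then have "(\<lambda>n::nat. 0) \<longlonglongrightarrow> (\<integral>x. frechet_derivative \<zeta> (at x) i \<partial>lborel)"
    by (simp only: zero)
  from LIMSEQ_unique[OF this tendsto_const] show ?thesis .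
qed

lemma C1c_mult:
  fixes p \<eta> :: "'a::euclidean_space \<Rightarrow> real"
  assumes p: "\<And>x. (p has_derivative p' x) (at x)"
    and c: "\<And>i. i \<in> Basis \<Longrightarrow> continuous_on UNIV (\<lambda>x. p' x i)" and \<eta>: "C1c \<eta>"
  shows "C1c (\<lambda>x. p x * \<eta> x)"
    and "frechet_derivative (\<lambda>x. p x * \<eta> x) (at x) h = p x * frechet_derivative \<eta> (at x) h + p' x h * \<eta> x"
proof -
  have d: "((\<lambda>x. p x * \<eta> x) has_derivative (\<lambda>h. p x * frechet_derivative \<eta> (at x) h + p' x h * \<eta> x)) (at x)" for x
    using has_derivative_mult[OF p C1c_has_derivative[OF \<eta>]] .
  then show "frechet_derivative (\<lambda>x. p x * \<eta> x) (at x) h = p x * frechet_derivative \<eta> (at x) h + p' x h * \<eta> x"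
    by (subst frechet_derivativeI) auto
  obtain R where R: "\<And>x. norm x \<ge> R \<Longrightarrow> \<eta> x = 0" using C1c_vanishes[OF \<eta>] by metis
  have "continuous_on UNIV p"
    by (intro continuous_at_imp_continuous_on ballI has_derivative_continuous[OF p])
  then show "C1c (\<lambda>x. p x * \<eta> x)"
    by (intro C1cI[OF d, of R] continuous_intros c C1c_continuous[OF \<eta>] C1c_continuous_partial[OF \<eta>])
       (use R in auto)
qed

text \<open>The product \<open>p \<eta>\<close> inherits compact support from \<open>\<eta>\<close>,
  so its partial derivative integrates to 0; \<open>p\<close> itself may be spread over the whole
  space.\<close>

lemma integration_by_parts_C1c:
  fixes p \<eta> :: "'a::euclidean_space \<Rightarrow> real"
  assumes p: "\<And>x. (p has_derivative p' x) (at x)"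
    and c: "\<And>i. i \<in> Basis \<Longrightarrow> continuous_on UNIV (\<lambda>x. p' x i)"
    and \<eta>: "C1c \<eta>" and i: "i \<in> Basis"
  shows "integrable lborel (\<lambda>x. p x * frechet_derivative \<eta> (at x) i)"
    and "integrable lborel (\<lambda>x. p' x i * \<eta> x)"
    and "(\<integral>x. p x * frechet_derivative \<eta> (at x) i \<partial>lborel) = - (\<integral>x. p' x i * \<eta> x \<partial>lborel)"
proof -
  obtain R where R: "\<And>x. norm x \<ge> R \<Longrightarrow> \<eta> x = 0"
    "\<And>x. norm x \<ge> R \<Longrightarrow> frechet_derivative \<eta> (at x) = (\<lambda>_. 0)" using C1c_vanishes[OF \<eta>] by metis
  have "continuous_on UNIV p"
    by (intro continuous_at_imp_continuous_on ballI has_derivative_continuous[OF p])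
  then show 1: "integrable lborel (\<lambda>x. p x * frechet_derivative \<eta> (at x) i)"
    by (intro continuous_vanishing_integrable[of _ R] continuous_intros C1c_continuous_partial[OF \<eta> i])
       (use R in auto)
  show 2: "integrable lborel (\<lambda>x. p' x i * \<eta> x)"
    by (intro continuous_vanishing_integrable[of _ R] continuous_intros C1c_continuous[OF \<eta>] c i)
       (use R in auto)
  show "(\<integral>x. p x * frechet_derivative \<eta> (at x) i \<partial>lborel) = - (\<integral>x. p' x i * \<eta> x \<partial>lborel)"
    using integral_partial_derivative_zero[OF C1c_mult(1)[OF p c \<eta>] i] 1 2
    by (simp add: C1c_mult(2)[OF p c \<eta>])
qed

subsection \<open>Convolution\<close>

definition conv :: "('a::euclidean_space \<Rightarrow> real) \<Rightarrow> ('a \<Rightarrow> real) \<Rightarrow> 'a \<Rightarrow> real" where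
  "conv w k x = (\<integral>y. w y * k (x - y) \<partial>lborel)"

lemma conv_integrable:
  fixes w k :: "'a::euclidean_space \<Rightarrow> real"
  assumes w: "integrable lborel w" and k: "continuous_on UNIV k" "\<And>x. \<bar>k x\<bar> \<le> M"
  shows "integrable lborel (\<lambda>y. w y * k (x - y))"
proof (rule Bochner_Integration.integrable_bound[of _ "\<lambda>y. M * w y"])
  have "continuous_on UNIV (\<lambda>y. k (x - y))"
    by (intro continuous_on_compose2[OF k(1)] continuous_intros) auto
  from borel_measurable_continuous_onI[OF this]
  show "(\<lambda>y. w y * k (x - y)) \<in> borel_measurable lborel"
    using borel_measurable_integrable[OF w] by simp
  show "AE y in lborel. norm (w y * k (x - y)) \<le> norm (M * w y)"
  proof (rule AE_I2)
    fix y
    have "\<bar>k (x - y)\<bar> \<le> \<bar>M\<bar>" using k(2)[of "x - y"] by linarith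
    then have "\<bar>w y\<bar> * \<bar>k (x - y)\<bar> \<le> \<bar>w y\<bar> * \<bar>M\<bar>" by (intro mult_left_mono) auto
    then show "norm (w y * k (x - y)) \<le> norm (M * w y)" by (simp add: abs_mult mult.commute)
  qed
qed (use w in simp)

lemma conv_continuous:
  fixes w k :: "'a::euclidean_space \<Rightarrow> real"
  assumes w: "integrable lborel w" and k: "continuous_on UNIV k" "\<And>x. \<bar>k x\<bar> \<le> M"
  shows "continuous_on UNIV (conv w k)"
proof (rule continuous_on_sequentiallyI)
  fix u a assume u: "u \<longlonglongrightarrow> (a::'a)"
  show "(\<lambda>n. conv w k (u n)) \<longlonglongrightarrow> conv w k a"
    unfolding conv_def
  proof (rule integral_dominated_convergence[where w = "\<lambda>y. M * \<bar>w y\<bar>"])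
    show "AE y in lborel. (\<lambda>n. w y * k (u n - y)) \<longlonglongrightarrow> w y * k (a - y)"
    proof (intro AE_I2 tendsto_mult_left)
      fix y
      have "isCont k (a - y)" using k(1) by (simp add: continuous_on_eq_continuous_at)
      then show "(\<lambda>n. k (u n - y)) \<longlonglongrightarrow> k (a - y)"
        by (rule isCont_tendsto_compose) (intro tendsto_intros u)
    qed
    show "AE y in lborel. norm (w y * k (u n - y)) \<le> M * \<bar>w y\<bar>" for n
      using k(2) by (intro AE_I2) (simp add: abs_mult mult.commute[of M] mult_left_mono)
  qed (use conv_integrable[OF w k] w borel_measurable_integrable in auto)
qed

text \<open>The kernel carries all the regularity: its first-order remainder divided by the
  increment tends to 0 pointwise and is bounded by \<open>2 * M\<close>, once \<open>M\<close> for
  the increment and once for the derivative. Dominated convergence against the merely integrable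
  \<open>w\<close> then applies.\<close>

lemma conv_has_derivative:
  fixes w k :: "'a::euclidean_space \<Rightarrow> real"
  assumes w: "integrable lborel w" and k: "C1c k"
  shows "(conv w k has_derivative (\<lambda>h. conv w (\<lambda>z. frechet_derivative k (at z) h) x)) (at x)"
proof -
  let ?D = "\<lambda>z. frechet_derivative k (at z)"
  obtain R where R: "\<And>x. norm x \<ge> R \<Longrightarrow> k x = 0" using C1c_vanishes[OF k] by metis
  obtain K where K: "\<And>x. \<bar>k x\<bar> \<le> K"
    using continuous_vanishing_bounded[OF C1c_continuous[OF k] R] by (metis real_norm_def)
  obtain M where M: "M > 0" "\<And>x h. \<bar>?D x h\<bar> \<le> M * norm h"
    using C1c_derivative_bounded[OF k] by (metis real_norm_def)
  have cD: "continuous_on UNIV (\<lambda>z. ?D z h)" for h by (rule C1c_continuous_derivative[OF k])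
  have int: "integrable lborel (\<lambda>y. w y * ?D (x - y) h)" for h
    by (rule conv_integrable[OF w cD M(2)])
  have intk: "integrable lborel (\<lambda>y. w y * k (x - y))" for x
    by (rule conv_integrable[OF w C1c_continuous[OF k] K])
  have lin: "linear (?D z)" for z using C1c_has_derivative[OF k] has_derivative_linear by blast
  define L where "L h = conv w (\<lambda>z. ?D z h) x" for h
  have Lint: "L h = (\<integral>y. w y * ?D (x - y) h \<partial>lborel)" for h by (simp add: L_def conv_def)
  have "bounded_linear L"
  proof (rule bounded_linear_intro[where K = "M * (\<integral>y. \<bar>w y\<bar> \<partial>lborel)"])
    show "L (a + b) = L a + L b" for a b
      using int by (simp add: Lint linear_add[OF lin] distrib_left)
    show "L (r *\<^sub>R a) = r *\<^sub>R L a" for r a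
      by (simp add: Lint linear_cmul[OF lin] mult.left_commute)
    show "norm (L a) \<le> norm a * (M * (\<integral>y. \<bar>w y\<bar> \<partial>lborel))" for a
    proof -
      have "norm (L a) \<le> (\<integral>y. norm (w y * ?D (x - y) a) \<partial>lborel)"
        unfolding Lint by (rule integral_norm_bound)
      also have "\<dots> \<le> (\<integral>y. \<bar>w y\<bar> * (M * norm a) \<partial>lborel)"
        using w integrable_norm[OF int[of a]] M(2) by (intro integral_mono) (auto simp: abs_mult intro!: mult_left_mono)
      finally show ?thesis by (simp add: mult_ac)
    qed
  qed
  moreover have "((\<lambda>h. norm (conv w k (x + h) - conv w k x - L h) / norm h) \<longlongrightarrow> 0) (at 0)"
    unfolding tendsto_at_iff_sequentially o_def
  proof (intro allI impI)
    fix X assume X: "\<forall>i. X i \<in> UNIV - {0::'a}" "X \<longlonglongrightarrow> 0"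
    define r where "r n y = w y * ((k (x - y + X n) - k (x - y) - ?D (x - y) (X n)) / norm (X n))" for n y
    have kint: "integrable lborel (\<lambda>y. w y * k (x - y + X n))" for n
      using intk[of "x + X n"] by (simp add: algebra_simps)
    have rint: "integrable lborel (r n)" for n
      unfolding r_def times_divide_eq_right right_diff_distrib
      using intk kint int by (intro integrable_divide Bochner_Integration.integrable_diff)
    have eq: "(conv w k (x + X n) - conv w k x - L (X n)) / norm (X n) = (\<integral>y. r n y \<partial>lborel)" for n
    proof -
      have "(\<integral>y. r n y \<partial>lborel) = (\<integral>y. w y * k (x - y + X n) - w y * k (x - y) - w y * ?D (x - y) (X n) \<partial>lborel) / norm (X n)"
        unfolding r_def times_divide_eq_right right_diff_distrib by simp
      also have "(\<integral>y. w y * k (x - y + X n) - w y * k (x - y) - w y * ?D (x - y) (X n) \<partial>lborel)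
        = conv w k (x + X n) - conv w k x - L (X n)"
        using intk kint int by (simp add: conv_def Lint algebra_simps)
      finally show ?thesis by simp
    qed
    have "(\<lambda>n. \<integral>y. r n y \<partial>lborel) \<longlonglongrightarrow> (\<integral>y. 0 \<partial>(lborel::'a measure))"
    proof (rule integral_dominated_convergence[where w = "\<lambda>y. (2 * M) * \<bar>w y\<bar>"])
      show "AE y in lborel. (\<lambda>n. r n y) \<longlonglongrightarrow> 0"
      proof (rule AE_I2)
        fix y
        have "((\<lambda>h. norm (k (x - y + h) - k (x - y) - ?D (x - y) h) / norm h) \<longlongrightarrow> 0) (at 0)"
          using C1c_has_derivative[OF k, of "x - y"] by (simp add: has_derivative_at)
        then have "((\<lambda>h. (k (x - y + h) - k (x - y) - ?D (x - y) h) / norm h) \<longlongrightarrow> 0) (at 0)"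
          by (rule Lim_null_comparison[rotated]) auto
        then have "(\<lambda>n. (k (x - y + X n) - k (x - y) - ?D (x - y) (X n)) / norm (X n)) \<longlonglongrightarrow> 0"
          using X unfolding tendsto_at_iff_sequentially o_def by blast
        then show "(\<lambda>n. r n y) \<longlonglongrightarrow> 0" unfolding r_def by (rule tendsto_mult_right_zero)
      qed
      show "AE y in lborel. norm (r n y) \<le> 2 * M * \<bar>w y\<bar>" for n
      proof (rule AE_I2)
        fix y
        have X0: "norm (X n) > 0" using X by auto
        have "\<bar>k (x - y + X n) - k (x - y)\<bar> \<le> M * norm (X n)"
          using C1c_lipschitz[OF k _ M(2)[folded real_norm_def], of "x - y + X n" "x - y"] M(1) by simp
        moreover have "\<bar>?D (x - y) (X n)\<bar> \<le> M * norm (X n)" by (rule M(2))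
        ultimately have "\<bar>k (x - y + X n) - k (x - y) - ?D (x - y) (X n)\<bar> \<le> 2 * M * norm (X n)" by linarith
        then have "\<bar>(k (x - y + X n) - k (x - y) - ?D (x - y) (X n)) / norm (X n)\<bar> \<le> 2 * M"
          using X0 by (simp add: field_simps)
        then have "\<bar>w y\<bar> * \<bar>(k (x - y + X n) - k (x - y) - ?D (x - y) (X n)) / norm (X n)\<bar> \<le> \<bar>w y\<bar> * (2 * M)"
          by (rule mult_left_mono) simp
        then show "norm (r n y) \<le> 2 * M * \<bar>w y\<bar>" by (simp add: r_def abs_mult mult.commute)
      qed
    qed (use w rint borel_measurable_integrable in auto)
    then have "(\<lambda>n. (conv w k (x + X n) - conv w k x - L (X n)) / norm (X n)) \<longlonglongrightarrow> 0"
      by (simp add: eq)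
    from tendsto_norm_zero[OF this]
    show "(\<lambda>n. norm (conv w k (x + X n) - conv w k x - L (X n)) / norm (X n)) \<longlonglongrightarrow> 0" by simp
  qed
  ultimately show ?thesis
    unfolding has_derivative_at L_def by blast
qed

subsection \<open>Mollification\<close>

text \<open>Phrased through the partial derivatives so that the calculus of \<open>C1c\<close> can
  simply be applied twice.\<close>

definition C2c :: "('a::euclidean_space \<Rightarrow> real) \<Rightarrow> bool" where
  "C2c f \<longleftrightarrow> C1c f \<and> (\<forall>i\<in>Basis. C1c (\<lambda>x. frechet_derivative f (at x) i))"

text \<open>The cube is the smallest integer power of the truncated paraboloid that is
  \<open>C\<^sup>2\<close> across the sphere of radius \<open>R\<close>. This one explicit function
  serves both as mollifier kernel and as cut-off.\<close>

definition bump :: "real \<Rightarrow> 'a::euclidean_space \<Rightarrow> real" where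
  "bump R x = (max 0 (1 - (x \<bullet> x) / R\<^sup>2)) ^ 3"

lemma max0_power_has_derivative:
  fixes g :: "'a::real_normed_vector \<Rightarrow> real"
  assumes "(g has_derivative g') (at x)"
  shows "((\<lambda>x. max 0 (g x) ^ 3) has_derivative (\<lambda>h. g' h * (3 * max 0 (g x) ^ 2))) (at x)"
    and "((\<lambda>x. max 0 (g x) ^ 2) has_derivative (\<lambda>h. g' h * (2 * max 0 (g x)))) (at x)"
proof -
  have 1: "((\<lambda>x. max 0 x ^ 3) has_real_derivative 3 * max 0 y ^ 2) (at y)" for y :: real
    by (rule has_real_derivative_max[of "\<lambda>x. x ^ 3" "\<lambda>x. 3 * x ^ 2"])
       (auto intro!: derivative_eq_intros)
  show "((\<lambda>x. max 0 (g x) ^ 3) has_derivative (\<lambda>h. g' h * (3 * max 0 (g x) ^ 2))) (at x)"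
    by (rule DERIV_compose_FDERIV[OF 1 assms])
  have 2: "((\<lambda>x. max 0 x ^ 2) has_real_derivative 2 * max 0 y) (at y)" for y :: real
    by (rule has_real_derivative_max[of "\<lambda>x. x ^ 2" "\<lambda>x. 2 * x"])
       (auto intro!: derivative_eq_intros)
  show "((\<lambda>x. max 0 (g x) ^ 2) has_derivative (\<lambda>h. g' h * (2 * max 0 (g x)))) (at x)"
    by (rule DERIV_compose_FDERIV[OF 2 assms])
qed

lemma bump_range: "0 \<le> bump R x" "bump R x \<le> 1"
  by (auto simp: bump_def intro!: power_le_one)

lemma bump_core_zero:
  fixes x :: "'a::euclidean_space"
  assumes "R > 0" "norm x \<ge> R"
  shows "max 0 (1 - (x \<bullet> x) / R\<^sup>2) = 0"
proof -
  have "R\<^sup>2 \<le> (norm x)\<^sup>2" using assms by (intro power_mono) auto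
  then show ?thesis using assms by (simp add: power2_norm_eq_inner field_simps)
qed

lemma bump_zero: "R > 0 \<Longrightarrow> norm x \<ge> R \<Longrightarrow> bump R x = 0"
  by (simp add: bump_def bump_core_zero)

lemma bump_has_derivative:
  fixes x :: "'a::euclidean_space"
  assumes "R > 0"
  shows "(bump R has_derivative (\<lambda>h. - (6 / R\<^sup>2) * (x \<bullet> h) * max 0 (1 - (x \<bullet> x) / R\<^sup>2) ^ 2)) (at x)"
proof -
  have "((\<lambda>x. x \<bullet> x) has_derivative (\<lambda>h. 2 * (x \<bullet> h))) (at x)" for x :: 'a
    by (auto intro!: derivative_eq_intros simp: inner_commute)
  from has_derivative_diff[OF has_derivative_const bounded_linear.has_derivative[OF bounded_linear_divide this]]
  have "((\<lambda>x. 1 - (x \<bullet> x) / R\<^sup>2) has_derivative (\<lambda>h. - (2 * (x \<bullet> h) / R\<^sup>2))) (at x)"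
    by simp
  from max0_power_has_derivative(1)[OF this] show ?thesis
    unfolding bump_def[abs_def] by (simp add: mult_ac)
qed

lemma bump_derivative: "R > 0 \<Longrightarrow> frechet_derivative (bump R) (at x)
    = (\<lambda>h. - (6 / R\<^sup>2) * (x \<bullet> h) * max 0 (1 - (x \<bullet> x) / R\<^sup>2) ^ 2)"
  by (rule frechet_derivativeI[OF bump_has_derivative])

lemma bump_C2c:
  assumes R: "R > 0"
  shows "C2c (bump R :: 'a::euclidean_space \<Rightarrow> real)"
  unfolding C2c_def
proof (intro conjI ballI)
  show "C1c (bump R :: 'a \<Rightarrow> real)"
    by (rule C1cI[OF bump_has_derivative[OF R], of R])
       (use R in \<open>auto intro!: continuous_intros simp: bump_zero\<close>)
  fix i :: 'a assume i: "i \<in> Basis"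
  let ?g = "\<lambda>x::'a. 1 - (x \<bullet> x) / R\<^sup>2"
  have "((\<lambda>x. x \<bullet> x) has_derivative (\<lambda>h. 2 * (x \<bullet> h))) (at x)" for x :: 'a
    by (auto intro!: derivative_eq_intros simp: inner_commute)
  from has_derivative_diff[OF has_derivative_const bounded_linear.has_derivative[OF bounded_linear_divide this]]
  have g: "(?g has_derivative (\<lambda>h. - (2 * (x \<bullet> h) / R\<^sup>2))) (at x)" for x
    by simp
  have "((\<lambda>x. - (6 / R\<^sup>2) * (x \<bullet> i) * max 0 (?g x) ^ 2) has_derivative
     (\<lambda>h. - (6 / R\<^sup>2) * (x \<bullet> i) * (- (2 * (x \<bullet> h) / R\<^sup>2) * (2 * max 0 (?g x))) + (- (6 / R\<^sup>2)) * (h \<bullet> i) * max 0 (?g x) ^ 2)) (at x)" for x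
    by (rule has_derivative_mult[OF has_derivative_mult_right[OF has_derivative_inner_left[OF has_derivative_ident]]
          max0_power_has_derivative(2)[OF g]])
  then show "C1c (\<lambda>x::'a. frechet_derivative (bump R) (at x) i)"
    unfolding bump_derivative[OF R]
    by (rule C1cI[where R = R]) (use R in \<open>auto intro!: continuous_intros simp: bump_core_zero\<close>)
qed

text \<open>The gradient decays like \<open>1 / R\<close>, so a cut-off on a large ball costs little
  total variation.\<close>

lemma bump_derivative_bound:
  assumes R: "R > 0"
  shows "\<bar>frechet_derivative (bump R) (at x) h\<bar> \<le> 6 / R * norm h"
proof (cases "norm x \<ge> R")
  case True
  then show ?thesis using R bump_core_zero[OF R True] by (simp add: bump_derivative)
next
  case False
  let ?m = "max 0 (1 - (x \<bullet> x) / R\<^sup>2)"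
  have m: "\<bar>?m ^ 2\<bar> \<le> 1" by (auto intro!: power_le_one)
  have "\<bar>x \<bullet> h\<bar> \<le> norm x * norm h" by (rule Cauchy_Schwarz_ineq2)
  also have "\<dots> \<le> R * norm h" using False by (intro mult_right_mono) auto
  finally have "\<bar>x \<bullet> h\<bar> * \<bar>?m ^ 2\<bar> \<le> (R * norm h) * 1" using m R by (intro mult_mono) auto
  then have "(6 / R\<^sup>2) * (\<bar>x \<bullet> h\<bar> * \<bar>?m ^ 2\<bar>) \<le> (6 / R\<^sup>2) * (R * norm h)"
    by (intro mult_left_mono) auto
  then show ?thesis using R by (simp add: bump_derivative abs_mult power2_eq_square)
qed

lemma bump_integrable: "R > 0 \<Longrightarrow> integrable lborel (bump R :: 'a::euclidean_space \<Rightarrow> real)"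
  by (rule continuous_vanishing_integrable[of _ R])
     (use bump_C2c C1c_continuous bump_zero in \<open>auto simp: C2c_def\<close>)

lemma bump_integral_pos:
  assumes R: "R > 0"
  shows "(\<integral>x. bump R x \<partial>(lborel::'a::euclidean_space measure)) > 0"
proof -
  \<comment> \<open>On the ball of radius \<open>R / 2\<close> the truncated factor is at least
    \<open>3 / 4\<close>.\<close>
  have "0 < (3/4)^3 * measure lborel (ball (0::'a) (R/2))"
    using content_ball_pos[of "R/2" "0::'a"] R by simp
  also have "\<dots> = (\<integral>x. (3/4)^3 * indicator (ball (0::'a) (R/2)) x \<partial>lborel)"
    by simp
  also have "\<dots> \<le> (\<integral>x. bump R x \<partial>(lborel::'a measure))"
  proof (rule integral_mono)
    show "integrable lborel (\<lambda>x. (3/4)^3 * indicator (ball (0::'a) (R/2)) x :: real)"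
      by (intro integrable_mult_right integrable_indicator_bounded) auto
    fix x :: 'a
    show "(3/4)^3 * indicator (ball 0 (R/2)) x \<le> bump R x"
    proof (cases "x \<in> ball 0 (R/2)")
      case True
      then have "(norm x)\<^sup>2 \<le> (R/2)\<^sup>2" by (intro power_mono) auto
      then have "x \<bullet> x \<le> (R/2)\<^sup>2" by (simp add: power2_norm_eq_inner)
      then have "(x \<bullet> x) / R\<^sup>2 \<le> 1/4"
        using R by (simp add: field_simps power2_eq_square)
      then have "3/4 \<le> max 0 (1 - (x \<bullet> x) / R\<^sup>2)" unfolding le_max_iff_disj by linarith
      then have "(3/4)^3 \<le> bump R x" unfolding bump_def by (rule power_mono) simp
      then show ?thesis using True by simp
    qed (use bump_range in auto)
  qed (use bump_integrable R in auto)
  finally show ?thesis .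
qed

definition moll :: "real \<Rightarrow> 'a::euclidean_space \<Rightarrow> real" where
  "moll d x = bump d x / (\<integral>y. bump d y \<partial>(lborel::'a measure))"

lemma C1c_cmult:
  fixes f :: "'a::euclidean_space \<Rightarrow> real"
  assumes "C1c f"
  shows "C1c (\<lambda>x. c * f x)" "frechet_derivative (\<lambda>x. c * f x) (at x) h = c * frechet_derivative f (at x) h"
  using C1c_mult[of "\<lambda>_. c" "\<lambda>_ _. 0", OF _ _ assms] by auto

lemma
  assumes d: "d > 0"
  shows moll_nonneg: "0 \<le> moll d (x::'a::euclidean_space)"
    and moll_zero: "norm x \<ge> d \<Longrightarrow> moll d x = 0"
    and moll_C2c: "C2c (moll d :: 'a \<Rightarrow> real)"
    and moll_C1c: "C1c (moll d :: 'a \<Rightarrow> real)"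
    and moll_integrable: "integrable lborel (moll d :: 'a \<Rightarrow> real)"
    and moll_integral: "(\<integral>x. moll d x \<partial>(lborel::'a measure)) = 1"
proof -
  let ?I = "\<integral>x. bump d x \<partial>(lborel::'a measure)"
  have I: "?I > 0" using bump_integral_pos[OF d] .
  have eq: "moll d = (\<lambda>x::'a. (1 / ?I) * bump d x)" by (auto simp: moll_def)
  show "0 \<le> moll d x" using I bump_range(1)[of d x] by (simp add: moll_def)
  show "norm x \<ge> d \<Longrightarrow> moll d x = 0" using bump_zero[OF d, of x] by (simp add: moll_def)
  have b: "C1c (bump d :: 'a \<Rightarrow> real)" using bump_C2c[OF d, where 'a='a] by (simp add: C2c_def)
  show "C2c (moll d :: 'a \<Rightarrow> real)"
    using bump_C2c[OF d, where 'a='a] unfolding C2c_def eq C1c_cmult(2)[OF b]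
    by (intro conjI ballI C1c_cmult(1)) auto
  then show "C1c (moll d :: 'a \<Rightarrow> real)" by (simp add: C2c_def)
  show "integrable lborel (moll d :: 'a \<Rightarrow> real)" unfolding eq by (intro integrable_mult_right bump_integrable d)
  show "(\<integral>x. moll d x \<partial>(lborel::'a measure)) = 1" unfolding eq using I by simp
qed

text \<open>For fixed \<open>y\<close> the inner integral of the shifted kernel is independent of
  the shift, so the double integral factors. The coefficient \<open>c\<close> lets the bound serve
  convolutions (\<open>c = -1\<close>) as well as plain products (\<open>c = 0\<close>).\<close>

lemma lborel_pair_integrable_bound:
  fixes w k :: "'a::euclidean_space \<Rightarrow> real" and F :: "'a \<Rightarrow> 'a \<Rightarrow> real"
  assumes w: "integrable lborel w" and k: "integrable lborel k"
    and F[measurable]: "case_prod F \<in> borel_measurable (lborel \<Otimes>\<^sub>M lborel)"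
    and b: "\<And>y x. \<bar>F y x\<bar> \<le> B * (\<bar>w y\<bar> * \<bar>k (x + c *\<^sub>R y)\<bar>)"
  shows "integrable (lborel \<Otimes>\<^sub>M lborel) (case_prod F)"
proof (rule Bochner_Integration.integrable_bound[where f = "\<lambda>(y, x). B * (\<bar>w y\<bar> * \<bar>k (x + c *\<^sub>R y)\<bar>)"])
  have [measurable]: "w \<in> borel_measurable borel" "k \<in> borel_measurable borel"
    using w k by (auto dest: borel_measurable_integrable)
  have "(\<integral>\<^sup>+p. ennreal (norm (case p of (y, x) \<Rightarrow> \<bar>w y\<bar> * \<bar>k (x + c *\<^sub>R y)\<bar>)) \<partial>(lborel \<Otimes>\<^sub>M lborel))
      = (\<integral>\<^sup>+y. \<integral>\<^sup>+x. ennreal \<bar>w y\<bar> * ennreal \<bar>k (x + c *\<^sub>R y)\<bar> \<partial>lborel \<partial>lborel)"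
    by (subst lborel.nn_integral_fst[symmetric]) (auto simp: ennreal_mult abs_mult)
  also have "\<dots> = (\<integral>\<^sup>+y. ennreal \<bar>w y\<bar> * (\<integral>\<^sup>+x. ennreal \<bar>k x\<bar> \<partial>lborel) \<partial>lborel)"
  proof (rule nn_integral_cong)
    fix y
    have "(\<integral>\<^sup>+x. ennreal \<bar>w y\<bar> * ennreal \<bar>k (x + c *\<^sub>R y)\<bar> \<partial>lborel) = ennreal \<bar>w y\<bar> * (\<integral>\<^sup>+x. ennreal \<bar>k (c *\<^sub>R y + x)\<bar> \<partial>lborel)"
      by (subst nn_integral_cmult[symmetric]) (auto simp: add.commute)
    then show "(\<integral>\<^sup>+x. ennreal \<bar>w y\<bar> * ennreal \<bar>k (x + c *\<^sub>R y)\<bar> \<partial>lborel) = ennreal \<bar>w y\<bar> * (\<integral>\<^sup>+x. ennreal \<bar>k x\<bar> \<partial>lborel)"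
      using lborel_nn_integral_translate[of "\<lambda>x. ennreal \<bar>k x\<bar>" "c *\<^sub>R y"] by simp
  qed
  also have "\<dots> = (\<integral>\<^sup>+y. ennreal \<bar>w y\<bar> \<partial>lborel) * (\<integral>\<^sup>+x. ennreal \<bar>k x\<bar> \<partial>lborel)"
    by (rule nn_integral_multc) simp
  also have "\<dots> < \<infinity>"
    using w k by (simp add: integrable_iff_bounded ennreal_mult_less_top)
  finally have "integrable (lborel \<Otimes>\<^sub>M lborel) (\<lambda>p. case p of (y, x) \<Rightarrow> \<bar>w y\<bar> * \<bar>k (x + c *\<^sub>R y)\<bar>)"
    by (intro integrableI_bounded) auto
  then have "integrable (lborel \<Otimes>\<^sub>M lborel) (\<lambda>p. B * (case p of (y, x) \<Rightarrow> \<bar>w y\<bar> * \<bar>k (x + c *\<^sub>R y)\<bar>))"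
    by (intro integrable_mult_right)
  then show "integrable (lborel \<Otimes>\<^sub>M lborel) (\<lambda>(y, x). B * (\<bar>w y\<bar> * \<bar>k (x + c *\<^sub>R y)\<bar>))"
    by (simp add: case_prod_unfold)
  show "AE p in lborel \<Otimes>\<^sub>M lborel. norm (case_prod F p) \<le> norm (case p of (y, x) \<Rightarrow> B * (\<bar>w y\<bar> * \<bar>k (x + c *\<^sub>R y)\<bar>))"
    using b by (intro AE_I2) (auto intro: order_trans[OF _ abs_ge_self])
qed measurable

text \<open>Fubini's theorem lets the kernel act on the test function \<open>g\<close> instead of on
  \<open>w\<close>.\<close>

lemma conv_pairing:
  fixes w k g :: "'a::euclidean_space \<Rightarrow> real"
  assumes w: "integrable lborel w" and k: "integrable lborel k"
    and g[measurable]: "g \<in> borel_measurable borel" and B: "\<And>x. \<bar>g x\<bar> \<le> B"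
  shows "integrable lborel (\<lambda>x. conv w k x * g x)"
    and "(\<integral>x. conv w k x * g x \<partial>lborel) = (\<integral>y. w y * (\<integral>x. k (x - y) * g x \<partial>lborel) \<partial>lborel)"
proof -
  have [measurable]: "w \<in> borel_measurable borel" "k \<in> borel_measurable borel"
    using w k by (auto dest: borel_measurable_integrable)
  have i: "integrable (lborel \<Otimes>\<^sub>M lborel) (\<lambda>(y, x). w y * k (x - y) * g x)"
  proof (rule lborel_pair_integrable_bound[OF w k, where B = B and c = "-1"])
    fix x y
    have "\<bar>w y * k (x - y)\<bar> * \<bar>g x\<bar> \<le> \<bar>w y * k (x - y)\<bar> * B"
      using B by (rule mult_left_mono) simp
    then show "\<bar>w y * k (x - y) * g x\<bar> \<le> B * (\<bar>w y\<bar> * \<bar>k (x + (-1) *\<^sub>R y)\<bar>)"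
      by (simp add: abs_mult mult_ac)
  qed measurable
  have c: "conv w k x * g x = (\<integral>y. w y * k (x - y) * g x \<partial>lborel)" for x
    by (simp add: conv_def)
  show "integrable lborel (\<lambda>x. conv w k x * g x)"
    unfolding c by (rule lborel_pair.integrable_snd[OF i])
  show "(\<integral>x. conv w k x * g x \<partial>lborel) = (\<integral>y. w y * (\<integral>x. k (x - y) * g x \<partial>lborel) \<partial>lborel)"
    unfolding c by (subst lborel_pair.Fubini_integral[OF i]) (simp add: mult.assoc)
qed

text \<open>All three rest on the pairing with the constant test function 1. The last is Young's
  inequality: for a nonnegative kernel, \<open>|conv w k|\<close> is at most the convolution of
  \<open>|w|\<close>, whose integral is known.\<close>

lemma
  fixes w k :: "'a::euclidean_space \<Rightarrow> real"
  assumes w: "integrable lborel w" and k: "integrable lborel k"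
  shows conv_integrable_lborel: "integrable lborel (conv w k)"
    and conv_integral: "(\<integral>x. conv w k x \<partial>lborel) = (\<integral>x. w x \<partial>lborel) * (\<integral>x. k x \<partial>lborel)"
    and conv_L1_bound: "(\<And>x. 0 \<le> k x) \<Longrightarrow> (\<integral>x. \<bar>conv w k x\<bar> \<partial>lborel) \<le> (\<integral>x. \<bar>w x\<bar> \<partial>lborel) * (\<integral>x. k x \<partial>lborel)"
proof -
  have i: "integrable lborel (conv w k)"
    and e: "(\<integral>x. conv w k x \<partial>lborel) = (\<integral>x. w x \<partial>lborel) * (\<integral>x. k x \<partial>lborel)"
    if w: "integrable lborel w" for w
  proof -
    have t: "(\<integral>x. k (x - y) \<partial>lborel) = (\<integral>x. k x \<partial>lborel)" for y
      using lborel_integral_translate(1)[of k "- y"] by simp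
    show "integrable lborel (conv w k)"
      using conv_pairing(1)[OF w k, of "\<lambda>_. 1" 1] by simp
    show "(\<integral>x. conv w k x \<partial>lborel) = (\<integral>x. w x \<partial>lborel) * (\<integral>x. k x \<partial>lborel)"
      using conv_pairing(2)[OF w k, of "\<lambda>_. 1" 1] by (simp add: t)
  qed
  show "integrable lborel (conv w k)" "(\<integral>x. conv w k x \<partial>lborel) = (\<integral>x. w x \<partial>lborel) * (\<integral>x. k x \<partial>lborel)"
    using i e w by auto
  assume k0: "\<And>x. 0 \<le> k x"
  have "(\<integral>x. \<bar>conv w k x\<bar> \<partial>lborel) \<le> (\<integral>x. conv (\<lambda>y. \<bar>w y\<bar>) k x \<partial>lborel)"
  proof (rule integral_mono)
    fix x
    have "\<bar>conv w k x\<bar> \<le> (\<integral>y. norm (w y * k (x - y)) \<partial>lborel)"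
      unfolding conv_def by (subst real_norm_def[symmetric]) (rule integral_norm_bound)
    then show "\<bar>conv w k x\<bar> \<le> conv (\<lambda>y. \<bar>w y\<bar>) k x"
      using k0 by (simp add: conv_def abs_mult)
  qed (use i w in auto)
  then show "(\<integral>x. \<bar>conv w k x\<bar> \<partial>lborel) \<le> (\<integral>x. \<bar>w x\<bar> \<partial>lborel) * (\<integral>x. k x \<partial>lborel)"
    using e[of "\<lambda>y. \<bar>w y\<bar>"] w by simp
qed

lemma moll_integrable_conv:
  fixes w :: "'a::euclidean_space \<Rightarrow> real"
  assumes d: "d > 0" and w: "integrable lborel w"
  shows "integrable lborel (\<lambda>y. w y * moll d (x - y))"
proof -
  obtain K where "\<And>x::'a. \<bar>moll d x\<bar> \<le> K"
    using continuous_vanishing_bounded[OF C1c_continuous[OF moll_C1c[OF d]], of d] moll_zero[OF d]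
    by (metis real_norm_def)
  from conv_integrable[OF w C1c_continuous[OF moll_C1c[OF d]] this] show ?thesis .
qed

lemma conv_moll_range:
  fixes w :: "'a::euclidean_space \<Rightarrow> real"
  assumes d: "d > 0" and w: "integrable lborel w" and r: "\<And>x. 0 \<le> w x" "\<And>x. w x \<le> 1"
  shows "0 \<le> conv w (moll d) x" "conv w (moll d) x \<le> 1"
proof -
  show "0 \<le> conv w (moll d) x"
    unfolding conv_def by (intro Bochner_Integration.integral_nonneg) (simp add: r moll_nonneg d)
  have "conv w (moll d) x \<le> (\<integral>y. moll d (x - y) \<partial>lborel)"
    unfolding conv_def
    by (intro integral_mono moll_integrable_conv d w)
       (use moll_integrable[OF d] lborel_integral_reflect(2)[of "moll d" x] r moll_nonneg[OF d] in \<open>auto intro: mult_left_le_one_le\<close>)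
  then show "conv w (moll d) x \<le> 1"
    using lborel_integral_reflect(1)[of "moll d" x] moll_integral[OF d, where 'a='a] by simp
qed

lemma conv_moll_local:
  fixes w :: "'a::euclidean_space \<Rightarrow> real"
  assumes d: "d > 0" and c: "\<And>y. norm (x - y) < d \<Longrightarrow> w y = c"
  shows "conv w (moll d) x = c"
proof -
  have "conv w (moll d) x = (\<integral>y. c * moll d (x - y) \<partial>lborel)"
    unfolding conv_def
    by (intro Bochner_Integration.integral_cong refl) (metis c moll_zero[OF d] mult_zero_right not_le)
  then show ?thesis
    using lborel_integral_reflect(1)[of "moll d" x] moll_integral[OF d, where 'a='a] by simp
qed

lemma conv_moll_add:
  assumes "d > 0" "integrable lborel f" "integrable lborel g"
  shows "conv (\<lambda>x. f x + g x) (moll d) x = conv f (moll d) x + conv g (moll d) x"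
    and "conv (\<lambda>x. f x - g x) (moll d) x = conv f (moll d) x - conv g (moll d) x"
  unfolding conv_def distrib_right left_diff_distrib
  using moll_integrable_conv[OF assms(1,2)] moll_integrable_conv[OF assms(1,3)] by auto

text \<open>Mollification preserves the integral and the range from 0 to 1, so the difference to the
  indicator has integral 0 and is negative only on \<open>A\<close>; controlling it there is enough.
  On \<open>A\<close> the set is replaced by an open \<open>U\<close> of nearly the same measure:
  the mollified indicator of \<open>U\<close> is eventually 1 at every point of \<open>U\<close>,
  and the replacement costs the mollified indicator of \<open>U - A\<close>.\<close>

lemma conv_moll_indicator:
  fixes A :: "'a::euclidean_space set"
  assumes A: "A \<in> sets borel" "emeasure lborel A < \<infinity>" and d: "\<And>n. d n > 0" "d \<longlonglongrightarrow> 0"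
  shows "(\<lambda>n. \<integral>x. \<bar>conv (indicator A) (moll (d n)) x - indicator A x\<bar> \<partial>lborel) \<longlonglongrightarrow> 0"
proof (rule LIMSEQ_I)
  fix r :: real assume r: "r > 0"
  obtain U where U: "open U" "A \<subseteq> U" "U - A \<in> lmeasurable" "emeasure lebesgue (U - A) < ennreal (r / 4)"
    using sets_lebesgue_outer_open[of A "r / 4"] A(1) r by auto
  have [measurable]: "A \<in> sets borel" "U \<in> sets borel" using A U by auto
  let ?iA = "indicator A :: 'a \<Rightarrow> real" and ?iU = "indicator U :: 'a \<Rightarrow> real" and ?iN = "indicator (U - A) :: 'a \<Rightarrow> real"
  have Nfin: "emeasure lborel (U - A) < ennreal (r / 4)" using U(4) by simp
  have "emeasure lborel (U - A) < top" by (rule order.strict_trans[OF Nfin ennreal_less_top])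
  then have Nm: "measure lborel (U - A) < r / 4"
    using Nfin r by (subst (asm) (2) emeasure_eq_ennreal_measure) (auto simp: ennreal_less_iff)
  have iA: "integrable lborel ?iA" using A by (intro integrable_real_indicator) auto
  have iN: "integrable lborel ?iN" using Nfin
    by (intro integrable_real_indicator) (auto intro: order_less_trans[OF _ ennreal_less_top])
  have eU: "?iU = (\<lambda>x. ?iA x + ?iN x)" using U(2) by (intro ext) (auto simp: indicator_def)
  have iU: "integrable lborel ?iU" unfolding eU using iA iN by simp
  have icv: "integrable lborel (conv w (moll (d n)))" if "integrable lborel w" for w :: "'a \<Rightarrow> real" and n
    by (rule conv_integrable_lborel[OF that moll_integrable[OF d(1)]])
  have lim: "(\<lambda>n. \<integral>x. ?iA x * (1 - conv ?iU (moll (d n)) x) \<partial>lborel) \<longlonglongrightarrow> (\<integral>x. 0 \<partial>(lborel :: 'a measure))"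
  proof (rule integral_dominated_convergence[where w = ?iA])
    show "(\<lambda>x. ?iA x * (1 - conv ?iU (moll (d n)) x)) \<in> borel_measurable lborel" for n
      using borel_measurable_integrable[OF icv[OF iU, of n]] by simp
    show "AE x in lborel. norm (?iA x * (1 - conv ?iU (moll (d n)) x)) \<le> ?iA x" for n
      using conv_moll_range[OF d(1)[of n] iU] by (intro AE_I2) (auto simp: indicator_def)
    show "AE x in lborel. (\<lambda>n. ?iA x * (1 - conv ?iU (moll (d n)) x)) \<longlonglongrightarrow> 0"
    proof (rule AE_I2)
      fix x
      show "(\<lambda>n. ?iA x * (1 - conv ?iU (moll (d n)) x)) \<longlonglongrightarrow> 0"
      proof (cases "x \<in> A")
        case True
        then obtain e where e: "e > 0" "ball x e \<subseteq> U" using U openE by blast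
        have "eventually (\<lambda>n. d n < e) sequentially" using d(2) e(1) by (rule order_tendstoD)
        then have "eventually (\<lambda>n. ?iA x * (1 - conv ?iU (moll (d n)) x) = 0) sequentially"
        proof eventually_elim
          case (elim n)
          have "conv ?iU (moll (d n)) x = 1"
            by (rule conv_moll_local[OF d(1)]) (use e elim in \<open>auto simp: indicator_def dist_norm\<close>)
          then show ?case by simp
        qed
        then show ?thesis by (rule tendsto_eventually)
      qed simp
    qed
  qed (use iA in auto)
  have bound: "(\<integral>x. \<bar>conv ?iA (moll (d n)) x - ?iA x\<bar> \<partial>lborel)
     \<le> 2 * (\<integral>x. ?iA x * (1 - conv ?iU (moll (d n)) x) \<partial>lborel) + 2 * measure lborel (U - A)" for n
  proof -
    let ?m = "moll (d n) :: 'a \<Rightarrow> real"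
    have rg: "0 \<le> conv ?iA ?m x" "conv ?iA ?m x \<le> 1" for x
      by (rule conv_moll_range[OF d(1) iA]; simp add: indicator_def)+
    have rgU: "0 \<le> conv ?iU ?m x" "conv ?iU ?m x \<le> 1" for x
      by (rule conv_moll_range[OF d(1) iU]; simp add: indicator_def)+
    have rgN: "0 \<le> conv ?iN ?m x" "conv ?iN ?m x \<le> 1" for x
      by (rule conv_moll_range[OF d(1) iN]; simp add: indicator_def)+
    have iAU: "integrable lborel (\<lambda>x. ?iA x * (1 - conv ?iU ?m x))"
      by (rule Bochner_Integration.integrable_bound[OF iA])
         (use borel_measurable_integrable[OF icv[OF iU, of n]] rgU in \<open>auto simp: indicator_def\<close>)
    \<comment> \<open>The decomposition \<open>|t| = t + 2 * max 0 (- t)\<close>; the first summand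
      will integrate to 0.\<close>
    have "(\<integral>x. \<bar>conv ?iA ?m x - ?iA x\<bar> \<partial>lborel)
       \<le> (\<integral>x. conv ?iA ?m x - ?iA x + 2 * (?iA x * (1 - conv ?iU ?m x)) + 2 * conv ?iN ?m x \<partial>lborel)"
    proof (rule integral_mono)
      fix x
      have "conv ?iU ?m x = conv ?iA ?m x + conv ?iN ?m x"
        unfolding eU by (rule conv_moll_add(1)[OF d(1) iA iN])
      then show "\<bar>conv ?iA ?m x - ?iA x\<bar> \<le> conv ?iA ?m x - ?iA x + 2 * (?iA x * (1 - conv ?iU ?m x)) + 2 * conv ?iN ?m x"
        using rg[of x] rgN[of x] by (auto simp: indicator_def)
    qed (use iA iAU icv[OF iA] icv[OF iN] in auto)
    also have "\<dots> = (\<integral>x. conv ?iA ?m x \<partial>lborel) - (\<integral>x. ?iA x \<partial>lborel)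
        + 2 * (\<integral>x. ?iA x * (1 - conv ?iU ?m x) \<partial>lborel) + 2 * (\<integral>x. conv ?iN ?m x \<partial>lborel)"
      using iA iAU icv[OF iA, of n] icv[OF iN, of n] by simp
    also have "\<dots> = 2 * (\<integral>x. ?iA x * (1 - conv ?iU ?m x) \<partial>lborel) + 2 * measure lborel (U - A)"
      using conv_integral[OF iA moll_integrable[OF d(1)]] conv_integral[OF iN moll_integrable[OF d(1)]]
      by (simp add: moll_integral[OF d(1)])
    finally show ?thesis .
  qed
  have "eventually (\<lambda>n. (\<integral>x. ?iA x * (1 - conv ?iU (moll (d n)) x) \<partial>lborel) < r / 4) sequentially"
    using lim r by (intro order_tendstoD(2)[OF lim]) simp
  then obtain N where N: "\<And>n. n \<ge> N \<Longrightarrow> (\<integral>x. ?iA x * (1 - conv ?iU (moll (d n)) x) \<partial>lborel) < r / 4"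
    by (auto simp: eventually_sequentially)
  show "\<exists>no. \<forall>n\<ge>no. norm ((\<integral>x. \<bar>conv ?iA (moll (d n)) x - ?iA x\<bar> \<partial>lborel) - 0) < r"
  proof (intro exI allI impI)
    fix n assume "n \<ge> N"
    from bound[of n] N[OF this] Nm
    have "(\<integral>x. \<bar>conv ?iA (moll (d n)) x - ?iA x\<bar> \<partial>lborel) < r" by linarith
    moreover have "0 \<le> (\<integral>x. \<bar>conv ?iA (moll (d n)) x - ?iA x\<bar> \<partial>lborel)"
      by (rule Bochner_Integration.integral_nonneg) simp
    ultimately show "norm ((\<integral>x. \<bar>conv ?iA (moll (d n)) x - ?iA x\<bar> \<partial>lborel) - 0) < r" by simp
  qed
qed

text \<open>Induction over integrable functions: indicators are already settled, and the
  \<open>L\<^sup>1\<close> contraction property \<open>conv_L1_bound\<close> carries the claim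
  through limits.\<close>

lemma conv_moll_L1:
  fixes w :: "'a::euclidean_space \<Rightarrow> real"
  assumes w: "integrable lborel w" and d: "\<And>n. d n > 0" "d \<longlonglongrightarrow> 0"
  shows "(\<lambda>n. \<integral>x. \<bar>conv w (moll (d n)) x - w x\<bar> \<partial>lborel) \<longlonglongrightarrow> 0"
  using w
proof (induction rule: integrable_induct)
  case (base A c)
  have "\<bar>conv (\<lambda>x. indicator A x *\<^sub>R c) (moll (d n)) x - indicator A x *\<^sub>R c\<bar>
     = \<bar>c\<bar> * \<bar>conv (indicator A) (moll (d n)) x - indicator A x\<bar>" for n x
  proof -
    have "conv (\<lambda>x. indicator A x *\<^sub>R c) (moll (d n)) x = c * conv (indicator A) (moll (d n)) x"
      unfolding conv_def by (subst integral_mult_right_zero[symmetric]) (simp add: mult_ac)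
    then show ?thesis by (simp add: abs_mult[symmetric] algebra_simps)
  qed
  then show ?case
    using tendsto_mult_right_zero[OF conv_moll_indicator[OF _ _ d, of A], of "\<bar>c\<bar>"] base by simp
next
  case (add f g)
  have icv: "integrable lborel (conv w (moll (d n)))" if "integrable lborel w" for w :: "'a \<Rightarrow> real" and n
    by (rule conv_integrable_lborel[OF that moll_integrable[OF d(1)]])
  have "norm (\<integral>x. \<bar>conv (\<lambda>x. f x + g x) (moll (d n)) x - (f x + g x)\<bar> \<partial>lborel)
    \<le> (\<integral>x. \<bar>conv f (moll (d n)) x - f x\<bar> \<partial>lborel) + (\<integral>x. \<bar>conv g (moll (d n)) x - g x\<bar> \<partial>lborel)" for n
  proof -
    have "norm (\<integral>x. \<bar>conv (\<lambda>x. f x + g x) (moll (d n)) x - (f x + g x)\<bar> \<partial>lborel)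
      = (\<integral>x. \<bar>conv (\<lambda>x. f x + g x) (moll (d n)) x - (f x + g x)\<bar> \<partial>lborel)"
      by simp
    also have "\<dots> \<le> (\<integral>x. \<bar>conv f (moll (d n)) x - f x\<bar> + \<bar>conv g (moll (d n)) x - g x\<bar> \<partial>lborel)"
      using add.hyps icv by (intro integral_mono) (auto simp: conv_moll_add[OF d(1)])
    also have "\<dots> = (\<integral>x. \<bar>conv f (moll (d n)) x - f x\<bar> \<partial>lborel) + (\<integral>x. \<bar>conv g (moll (d n)) x - g x\<bar> \<partial>lborel)"
      using add.hyps icv by simp
    finally show ?thesis .
  qed
  then show ?case
    by (intro Lim_null_comparison[OF _ tendsto_add_zero[OF add.IH]] always_eventually allI)
next
  case (lim f s)
  have icv: "integrable lborel (conv w (moll (d n)))" if "integrable lborel w" for w :: "'a \<Rightarrow> real" and n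
    by (rule conv_integrable_lborel[OF that moll_integrable[OF d(1)]])
  have sf: "(\<lambda>i. \<integral>x. \<bar>s i x - f x\<bar> \<partial>lborel) \<longlonglongrightarrow> (\<integral>x. 0 \<partial>(lborel :: 'a measure))"
  proof (rule integral_dominated_convergence[where w = "\<lambda>x. 3 * \<bar>f x\<bar>"])
    show "AE x in lborel. (\<lambda>i. \<bar>s i x - f x\<bar>) \<longlonglongrightarrow> 0"
      using lim.hyps(2) by (intro AE_I2 tendsto_rabs_zero LIM_zero) auto
    \<comment> \<open>The approximants of the induction rule satisfy
      \<open>|s i x| \<le> 2 * |f x|\<close>, whence the factor 3.\<close>
    show "AE x in lborel. norm \<bar>s i x - f x\<bar> \<le> 3 * \<bar>f x\<bar>" for i
    proof (rule AE_I2)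
      fix x show "norm \<bar>s i x - f x\<bar> \<le> 3 * \<bar>f x\<bar>" using lim.hyps(3)[of x i] by simp
    qed
  qed (use lim.hyps in auto)
  show ?case
  proof (rule LIMSEQ_I)
    fix r :: real assume r: "r > 0"
    have "eventually (\<lambda>i. (\<integral>x. \<bar>s i x - f x\<bar> \<partial>lborel) < r / 4) sequentially"
      using r by (intro order_tendstoD(2)[OF sf]) simp
    then obtain i where i: "(\<integral>x. \<bar>s i x - f x\<bar> \<partial>lborel) < r / 4"
      by (auto simp: eventually_sequentially)
    have "eventually (\<lambda>n. (\<integral>x. \<bar>conv (s i) (moll (d n)) x - s i x\<bar> \<partial>lborel) < r / 4) sequentially"
      using r by (intro order_tendstoD(2)[OF lim.IH]) simp
    then obtain N where N: "\<And>n. n \<ge> N \<Longrightarrow> (\<integral>x. \<bar>conv (s i) (moll (d n)) x - s i x\<bar> \<partial>lborel) < r / 4"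
      by (auto simp: eventually_sequentially)
    show "\<exists>no. \<forall>n\<ge>no. norm ((\<integral>x. \<bar>conv f (moll (d n)) x - f x\<bar> \<partial>lborel) - 0) < r"
    proof (intro exI allI impI)
      fix n assume n: "n \<ge> N"
      let ?m = "moll (d n) :: 'a \<Rightarrow> real"
      have isf: "integrable lborel (\<lambda>x. s i x - f x)" using lim.hyps by auto
      have "(\<integral>x. \<bar>conv f ?m x - f x\<bar> \<partial>lborel)
        \<le> (\<integral>x. \<bar>conv (\<lambda>x. s i x - f x) ?m x\<bar> + \<bar>conv (s i) ?m x - s i x\<bar> + \<bar>s i x - f x\<bar> \<partial>lborel)"
        using lim.hyps icv icv[OF isf] by (intro integral_mono) (auto simp: conv_moll_add[OF d(1)])
      also have "\<dots> = (\<integral>x. \<bar>conv (\<lambda>x. s i x - f x) ?m x\<bar> \<partial>lborel) + (\<integral>x. \<bar>conv (s i) ?m x - s i x\<bar> \<partial>lborel) + (\<integral>x. \<bar>s i x - f x\<bar> \<partial>lborel)"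
        using lim.hyps icv icv[OF isf] by simp
      also have "\<dots> \<le> r / 4 + r / 4 + r / 4"
        using conv_L1_bound[OF isf moll_integrable[OF d(1)] moll_nonneg[OF d(1)], of n] i N[OF n]
        by (simp add: moll_integral[OF d(1)])
      also have "\<dots> < r" using r by simp
      finally have "(\<integral>x. \<bar>conv f ?m x - f x\<bar> \<partial>lborel) < r" .
      moreover have "0 \<le> (\<integral>x. \<bar>conv f ?m x - f x\<bar> \<partial>lborel)"
        by (rule Bochner_Integration.integral_nonneg) simp
      ultimately show "norm ((\<integral>x. \<bar>conv f ?m x - f x\<bar> \<partial>lborel) - 0) < r" by simp
    qed
  qed
qed

subsection \<open>Weak derivatives\<close>

lemma C1c_abs_bounded:
  fixes k :: "'a::euclidean_space \<Rightarrow> real"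
  assumes "C1c k"
  obtains K where "K > 0" "\<And>x. \<bar>k x\<bar> \<le> K"
  using C1c_vanishes[OF assms] continuous_vanishing_bounded[OF C1c_continuous[OF assms]]
  by (metis real_norm_def)

lemma conv_continuous_partial:
  fixes w k :: "'a::euclidean_space \<Rightarrow> real"
  assumes w: "integrable lborel w" and k: "C1c k"
  shows "continuous_on UNIV (\<lambda>x. conv w (\<lambda>z. frechet_derivative k (at z) h) x)"
proof -
  obtain M where M: "M > 0" "\<And>x h. \<bar>frechet_derivative k (at x) h\<bar> \<le> M * norm h"
    using C1c_derivative_bounded[OF k] by (metis real_norm_def)
  show ?thesis
    using conv_continuous[OF w C1c_continuous_derivative[OF k] M(2)] by simp
qed

lemma conv_C1c_continuous:
  fixes w k :: "'a::euclidean_space \<Rightarrow> real"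
  assumes w: "integrable lborel w" and k: "C1c k"
  shows "continuous_on UNIV (conv w k)"
  by (intro continuous_at_imp_continuous_on ballI has_derivative_continuous[OF conv_has_derivative[OF w k]])

lemma C1c_reflect:
  fixes k :: "'a::euclidean_space \<Rightarrow> real"
  assumes k: "C1c k"
  shows "C1c (\<lambda>y. k (c - y))"
    and "frechet_derivative (\<lambda>y. k (c - y)) (at y) h = - frechet_derivative k (at (c - y)) h"
proof -
  have lin: "linear (frechet_derivative k (at z))" for z
    using C1c_has_derivative[OF k] has_derivative_linear by blast
  have d: "((\<lambda>y. k (c - y)) has_derivative (\<lambda>h. - frechet_derivative k (at (c - y)) h)) (at y)" for y
  proof -
    have "((\<lambda>y. c - y) has_derivative (\<lambda>h. - h)) (at y)"
      by (auto intro!: derivative_eq_intros)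
    from has_derivative_compose[OF this C1c_has_derivative[OF k]]
    show ?thesis by (simp add: linear_neg[OF lin])
  qed
  obtain R where R: "\<And>x. norm x \<ge> R \<Longrightarrow> k x = 0" using C1c_vanishes[OF k] by metis
  show "frechet_derivative (\<lambda>y. k (c - y)) (at y) h = - frechet_derivative k (at (c - y)) h"
    by (simp add: frechet_derivativeI[OF d])
  show "C1c (\<lambda>y. k (c - y))"
  proof (rule C1cI[OF d])
    show "continuous_on UNIV (\<lambda>y. - frechet_derivative k (at (c - y)) i)" for i
      by (intro continuous_intros continuous_on_compose2[OF C1c_continuous_derivative[OF k]]) auto
    show "k (c - x) = 0" if "norm x > R + norm c" for x
    proof (rule R)
      have "norm x \<le> norm (c - x) + norm c"
        by (metis norm_minus_commute norm_triangle_sub add.commute)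
      then show "R \<le> norm (c - x)" using that by simp
    qed
  qed
qed

text \<open>The notions of the theorem use the completed measure, while convolution and Fubini are
  carried out over \<open>lborel\<close>. A Borel representative mediates between the two.\<close>

lemma lborel_version:
  fixes u :: "'a::euclidean_space \<Rightarrow> real"
  assumes u: "u \<in> borel_measurable lebesgue"
  obtains w where "w \<in> borel_measurable borel" "AE x in lebesgue. u x = w x"
proof -
  obtain w where "w \<in> borel_measurable lborel" "AE x in lborel. u x = w x"
    using completion_ex_borel_measurable_real[OF u] by blast
  then show ?thesis using that AE_completion by fastforce
qed

lemma measurable_borel_lebesgue:
  "w \<in> borel_measurable borel \<Longrightarrow> w \<in> borel_measurable lebesgue"
  by (simp add: measurable_completion)

lemma lebesgue_integrable_version:
  fixes u w :: "'a::euclidean_space \<Rightarrow> real"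
  assumes w: "w \<in> borel_measurable borel" and e: "AE x in lebesgue. u x = w x"
    and u: "u \<in> borel_measurable lebesgue"
  shows "integrable lebesgue u \<longleftrightarrow> integrable lborel w"
    and "integral\<^sup>L lebesgue u = integral\<^sup>L lborel w"
proof -
  have m: "w \<in> borel_measurable lebesgue" by (rule measurable_borel_lebesgue[OF w])
  show "integrable lebesgue u \<longleftrightarrow> integrable lborel w"
    using integrable_cong_AE[OF u m e] integrable_completion[of w lborel] w by simp
  show "integral\<^sup>L lebesgue u = integral\<^sup>L lborel w"
    using integral_cong_AE[OF u m e] integral_completion[of w lborel] w by simp
qed

text \<open>The reflected kernel \<open>y \<mapsto> moll d (x - y)\<close> is itself an admissible
  test function once its ball lies in \<open>U\<close>. The sign produced by the reflection cancels
  the one in the definition of the weak derivative.\<close>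

lemma conv_weak_derivative:
  fixes u :: "'a::euclidean_space \<Rightarrow> real"
  assumes H: "H1_grad U u g" and i: "i \<in> Basis" and d: "d > 0" and c: "cball x d \<subseteq> U"
    and w: "integrable lborel w" "AE y in lebesgue. indicator U y * u y = w y"
    and v: "integrable lborel v" "AE y in lebesgue. indicator U y * (g y \<bullet> i) = v y"
  shows "conv w (\<lambda>z. frechet_derivative (moll d) (at z) i) x = conv v (moll d) x"
proof -
  let ?k = "\<lambda>y. moll d (x - y)"
  have k: "C1c ?k" by (rule C1c_reflect(1)[OF moll_C1c[OF d]])
  have "{y. ?k y \<noteq> 0} \<subseteq> cball x d"
    using moll_zero[OF d] by (force simp: dist_norm)
  then have "supp ?k \<subseteq> cball x d" unfolding supp_def by (rule closure_minimal) simp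
  then have "supp ?k \<subseteq> U" using c by blast
  then have e: "(LINT y:U|lebesgue. u y * frechet_derivative ?k (at y) i) = - (LINT y:U|lebesgue. (g y \<bullet> i) * ?k y)"
    using H k i unfolding H1_grad_def by blast
  have mU: "(\<lambda>y. indicator U y * u y) \<in> borel_measurable lebesgue"
    and mg: "(\<lambda>y. indicator U y *\<^sub>R g y) \<in> borel_measurable lebesgue"
    using H unfolding H1_grad_def set_borel_measurable_def by simp_all
  have mG: "(\<lambda>y. indicator U y * (g y \<bullet> i)) \<in> borel_measurable lebesgue"
    using borel_measurable_inner[OF mg borel_measurable_const[of i]] by simp
  have ck: "?k \<in> borel_measurable borel"
    using borel_measurable_continuous_onI[OF C1c_continuous[OF k]] .
  have cD: "(\<lambda>y. frechet_derivative ?k (at y) i) \<in> borel_measurable borel"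
    using borel_measurable_continuous_onI[OF C1c_continuous_partial[OF k i]] .
  have wm: "w \<in> borel_measurable borel" "v \<in> borel_measurable borel" using w v by (auto dest: borel_measurable_integrable)
  have "(LINT y:U|lebesgue. u y * frechet_derivative ?k (at y) i) = (\<integral>y. w y * frechet_derivative ?k (at y) i \<partial>lborel)"
    unfolding set_lebesgue_integral_def
    by (rule lebesgue_integrable_version(2))
       (use wm cD mU measurable_borel_lebesgue[OF cD] w(2) in
         \<open>auto elim!: eventually_mono simp: mult.assoc[symmetric] intro!: borel_measurable_times\<close>)
  also have "\<dots> = - conv w (\<lambda>z. frechet_derivative (moll d) (at z) i) x"
    unfolding conv_def C1c_reflect(2)[OF moll_C1c[OF d]] by simp
  finally have 1: "(LINT y:U|lebesgue. u y * frechet_derivative ?k (at y) i) = - conv w (\<lambda>z. frechet_derivative (moll d) (at z) i) x" .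
  have "(LINT y:U|lebesgue. (g y \<bullet> i) * ?k y) = (\<integral>y. v y * ?k y \<partial>lborel)"
    unfolding set_lebesgue_integral_def
    by (rule lebesgue_integrable_version(2))
       (use wm ck mG measurable_borel_lebesgue[OF ck] v(2) in
         \<open>auto elim!: eventually_mono simp: mult.assoc[symmetric] intro!: borel_measurable_times\<close>)
  then show ?thesis using 1 e by (simp add: conv_def)
qed

text \<open>On a bounded set square integrability implies integrability, through
  \<open>|t| \<le> 1 + t\<^sup>2\<close>.\<close>

lemma H1_grad_integrable:
  fixes u :: "'a::euclidean_space \<Rightarrow> real"
  assumes H: "H1_grad U u g" and U: "open U" "bounded U"
  shows "integrable lebesgue (\<lambda>y. indicator U y * u y)"
    and "integrable lebesgue (\<lambda>y. indicator U y * norm (g y))"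
    and "integrable lebesgue (\<lambda>y. indicator U y * (g y \<bullet> i))"
proof -
  have iU: "integrable lebesgue (indicator U :: 'a \<Rightarrow> real)"
    using integrable_indicator_bounded[OF U(2)] U(1) by (simp add: integrable_completion)
  have mU: "(\<lambda>y. indicator U y * u y) \<in> borel_measurable lebesgue"
    and mg: "(\<lambda>y. indicator U y *\<^sub>R g y) \<in> borel_measurable lebesgue"
    and i2: "integrable lebesgue (\<lambda>y. indicator U y * (u y)\<^sup>2)" "integrable lebesgue (\<lambda>y. indicator U y * (norm (g y))\<^sup>2)"
    using H unfolding H1_grad_def set_borel_measurable_def set_integrable_def by simp_all
  have mn: "(\<lambda>y. indicator U y * norm (g y)) \<in> borel_measurable lebesgue"
    using measurable_compose[OF mg borel_measurable_norm] by simp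
  have mG: "(\<lambda>y. indicator U y * (g y \<bullet> i)) \<in> borel_measurable lebesgue"
    using borel_measurable_inner[OF mg borel_measurable_const[of i]] by simp
  have q: "\<bar>t\<bar> \<le> 1 + t\<^sup>2" for t :: real
    using sum_squares_bound[of "\<bar>t\<bar>" 1] by simp
  show "integrable lebesgue (\<lambda>y. indicator U y * u y)"
    by (rule Bochner_Integration.integrable_bound[OF Bochner_Integration.integrable_add[OF iU i2(1)] mU])
       (use q in \<open>auto simp: indicator_def\<close>)
  show n: "integrable lebesgue (\<lambda>y. indicator U y * norm (g y))"
    by (rule Bochner_Integration.integrable_bound[OF Bochner_Integration.integrable_add[OF iU i2(2)] mn])
       (use q[of "norm _"] in \<open>auto simp: indicator_def\<close>)
  show "integrable lebesgue (\<lambda>y. indicator U y * (g y \<bullet> i))"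
    by (rule Bochner_Integration.integrable_bound[OF integrable_mult_right[OF n, of "norm i"] mG])
       (auto simp: indicator_def intro!: AE_I2 order_trans[OF Cauchy_Schwarz_ineq2] simp: mult.commute)
qed

text \<open>Mollifications obey the classical chain rule, and on the support of
  \<open>\<eta>\<close> their gradient is the mollified weak gradient. Both converge in
  \<open>L\<^sup>1\<close>. As \<open>\<psi>'\<close> is only continuous and bounded, the factor
  \<open>\<psi>' (f n)\<close> is treated along a subsequence that converges almost
  everywhere.\<close>

lemma weak_chain_rule:
  fixes u :: "'a::euclidean_space \<Rightarrow> real" and \<psi> :: "real \<Rightarrow> real"
  assumes H: "H1_grad U u g" and U: "open U" "bounded U" and i: "i \<in> Basis"
    and \<psi>: "\<And>s. (\<psi> has_real_derivative \<psi>' s) (at s)"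
    and c: "continuous_on UNIV \<psi>'" and b: "\<And>s. \<bar>\<psi>' s\<bar> \<le> M"
    and \<eta>: "C1c \<eta>" "supp \<eta> \<subseteq> U"
  shows "(LINT y:U|lebesgue. \<psi> (u y) * frechet_derivative \<eta> (at y) i)
     = - (LINT y:U|lebesgue. \<psi>' (u y) * (g y \<bullet> i) * \<eta> y)"
proof -
  define u' where "u' y = indicator U y * u y" for y
  define g' where "g' y = indicator U y * (g y \<bullet> i)" for y
  have iu: "integrable lebesgue u'" and ig: "integrable lebesgue g'"
    unfolding u'_def g'_def using H1_grad_integrable[OF H U] by auto
  obtain w where w: "w \<in> borel_measurable borel" "AE x in lebesgue. u' x = w x"
    using lborel_version borel_measurable_integrable[OF iu] by blast
  obtain v where v: "v \<in> borel_measurable borel" "AE x in lebesgue. g' x = v x"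
    using lborel_version borel_measurable_integrable[OF ig] by blast
  have iw: "integrable lborel w"
    using lebesgue_integrable_version(1)[OF w borel_measurable_integrable[OF iu]] iu by simp
  have iv: "integrable lborel v"
    using lebesgue_integrable_version(1)[OF v borel_measurable_integrable[OF ig]] ig by simp
  \<comment> \<open>Compactness of the support gives one radius for all its points, so every
    mollification with a smaller radius reads only values inside \<open>U\<close> there.\<close>
  obtain e where e: "e > 0" "(\<Union>x\<in>supp \<eta>. cball x e) \<subseteq> U"
    using compact_subset_open_imp_cball_epsilon_subset[OF _ U(1) \<eta>(2)] \<eta>(1) unfolding C1c_def by blast
  define d where "d n = e / real (Suc n)" for n
  have d: "d n > 0" "d n \<le> e" for n using e(1) by (auto simp: d_def field_simps)
  have d0: "d \<longlonglongrightarrow> 0"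
    unfolding d_def by (intro LIMSEQ_Suc tendsto_divide_0[OF tendsto_const] filterlim_at_top_imp_at_infinity filterlim_real_sequentially)
  define f where "f n = conv w (moll (d n) :: 'a \<Rightarrow> real)" for n
  define f' where "f' n = conv v (moll (d n) :: 'a \<Rightarrow> real)" for n
  have fi: "integrable lborel (f n)" "integrable lborel (f' n)" for n
    unfolding f_def f'_def by (intro conv_integrable_lborel iw iv moll_integrable d)+
  have L1: "(\<lambda>n. \<integral>x. \<bar>f n x - w x\<bar> \<partial>lborel) \<longlonglongrightarrow> 0" "(\<lambda>n. \<integral>x. \<bar>f' n x - v x\<bar> \<partial>lborel) \<longlonglongrightarrow> 0"
    unfolding f_def f'_def by (intro conv_moll_L1 iw iv d d0)+
  obtain r where r: "strict_mono r" "AE x in lborel. (\<lambda>n. f (r n) x - w x) \<longlonglongrightarrow> 0"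
    using tendsto_L1_AE_subseq[of lborel "\<lambda>n x. f n x - w x"] L1(1) fi iw by auto
  obtain K where K: "K > 0" "\<And>x. \<bar>\<eta> x\<bar> \<le> K" using C1c_abs_bounded[OF \<eta>(1)] by metis
  obtain N where N: "N > 0" "\<And>x h. \<bar>frechet_derivative \<eta> (at x) h\<bar> \<le> N * norm h"
    using C1c_derivative_bounded[OF \<eta>(1)] by (metis real_norm_def)
  let ?D = "\<lambda>x. frechet_derivative \<eta> (at x) i"
  have D: "\<bar>?D x\<bar> \<le> N" for x using N(2)[of x i] i by simp
  have M0: "M \<ge> 0" using b[of 0] by linarith
  have bK: "\<bar>\<psi>' s * t * \<eta> x\<bar> \<le> M * K * \<bar>t\<bar>" for s t x
  proof -
    have "\<bar>\<psi>' s\<bar> * \<bar>\<eta> x\<bar> \<le> M * K" using b K(2) M0 by (intro mult_mono) auto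
    then have "\<bar>\<psi>' s\<bar> * \<bar>\<eta> x\<bar> * \<bar>t\<bar> \<le> M * K * \<bar>t\<bar>" by (rule mult_right_mono) simp
    then show ?thesis by (simp add: abs_mult mult_ac)
  qed
  have Lip: "\<bar>\<psi> s - \<psi> t\<bar> \<le> M * \<bar>s - t\<bar>" for s t
    using has_derivative_bound[of \<psi> "\<lambda>s h. \<psi>' s * h" M s t] \<psi> b M0
    by (simp add: has_field_derivative_def abs_mult mult_right_mono)
  have \<psi>c: "continuous_on UNIV \<psi>"
    using \<psi> DERIV_isCont by (intro continuous_at_imp_continuous_on) blast
  have [measurable]: "\<psi> \<in> borel_measurable borel" "\<psi>' \<in> borel_measurable borel" "\<eta> \<in> borel_measurable borel"
    "?D \<in> borel_measurable borel" "w \<in> borel_measurable borel" "v \<in> borel_measurable borel"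
    using \<psi>c c C1c_continuous[OF \<eta>(1)] C1c_continuous_partial[OF \<eta>(1) i] w v
    by (auto intro!: borel_measurable_continuous_onI)
  have [measurable]: "f n \<in> borel_measurable borel" "f' n \<in> borel_measurable borel" for n
    using fi[of n] by (auto dest: borel_measurable_integrable)
  have iD: "integrable lborel ?D" and i\<eta>: "integrable lborel \<eta>"
    using C1c_vanishes[OF \<eta>(1)] continuous_vanishing_integrable[OF C1c_continuous[OF \<eta>(1)]]
      continuous_vanishing_integrable[OF C1c_continuous_partial[OF \<eta>(1) i]] by metis+
  have i1: "integrable lborel (\<lambda>x. \<psi> (h x) * ?D x)" if h: "integrable lborel h" for h :: "'a \<Rightarrow> real"
  proof -
    have [measurable]: "h \<in> borel_measurable borel" using h by (auto dest: borel_measurable_integrable)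
    show ?thesis
    proof (rule Bochner_Integration.integrable_bound[of _ "\<lambda>x. \<bar>\<psi> 0\<bar> * \<bar>?D x\<bar> + M * N * \<bar>h x\<bar>"])
      show "AE x in lborel. norm (\<psi> (h x) * ?D x) \<le> norm (\<bar>\<psi> 0\<bar> * \<bar>?D x\<bar> + M * N * \<bar>h x\<bar>)"
      proof (rule AE_I2)
        fix x
        have "\<bar>\<psi> (h x)\<bar> \<le> \<bar>\<psi> 0\<bar> + M * \<bar>h x\<bar>" using Lip[of "h x" 0] by auto
        then have "\<bar>\<psi> (h x)\<bar> * \<bar>?D x\<bar> \<le> (\<bar>\<psi> 0\<bar> + M * \<bar>h x\<bar>) * \<bar>?D x\<bar>" by (rule mult_right_mono) simp
        also have "\<dots> \<le> \<bar>\<psi> 0\<bar> * \<bar>?D x\<bar> + (M * \<bar>h x\<bar>) * N"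
          unfolding distrib_right using D M0 by (intro add_mono mult_left_mono) auto
        finally show "norm (\<psi> (h x) * ?D x) \<le> norm (\<bar>\<psi> 0\<bar> * \<bar>?D x\<bar> + M * N * \<bar>h x\<bar>)"
          by (simp add: abs_mult mult_ac) linarith
      qed
    qed (use iD h in auto)
  qed
  have i2: "integrable lborel (\<lambda>x. \<psi>' (k x) * h x * \<eta> x)"
    if h: "integrable lborel h" and k[measurable]: "k \<in> borel_measurable borel" for h k :: "'a \<Rightarrow> real"
  proof -
    have [measurable]: "h \<in> borel_measurable borel" using h by (auto dest: borel_measurable_integrable)
    show ?thesis
    proof (rule Bochner_Integration.integrable_bound[of _ "\<lambda>x. M * K * \<bar>h x\<bar>"])
      show "AE x in lborel. norm (\<psi>' (k x) * h x * \<eta> x) \<le> norm (M * K * \<bar>h x\<bar>)"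
        using order_trans[OF bK abs_ge_self] by (intro AE_I2) simp
    qed (use h in auto)
  qed
  have ibp: "(\<integral>x. \<psi> (f n x) * ?D x \<partial>lborel) = - (\<integral>x. \<psi>' (f n x) * f' n x * \<eta> x \<partial>lborel)" for n
  proof -
    let ?k = "moll (d n) :: 'a \<Rightarrow> real"
    let ?p' = "\<lambda>x h. conv w (\<lambda>z. frechet_derivative ?k (at z) h) x * \<psi>' (f n x)"
    have "((\<lambda>x. \<psi> (f n x)) has_derivative ?p' x) (at x)" for x
      unfolding f_def by (rule DERIV_compose_FDERIV[OF \<psi> conv_has_derivative[OF iw moll_C1c[OF d(1)]]])
    moreover have "continuous_on UNIV (\<lambda>x. ?p' x j)" for j
      unfolding f_def
      by (intro continuous_intros conv_continuous_partial[OF iw moll_C1c[OF d(1)]]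
           continuous_on_compose2[OF c conv_C1c_continuous[OF iw moll_C1c[OF d(1)]]]) auto
    ultimately have "(\<integral>x. \<psi> (f n x) * ?D x \<partial>lborel) = - (\<integral>x. ?p' x i * \<eta> x \<partial>lborel)"
      by (intro integration_by_parts_C1c(3)[OF _ _ \<eta>(1) i])
    also have "(\<lambda>x. ?p' x i * \<eta> x) = (\<lambda>x. \<psi>' (f n x) * f' n x * \<eta> x)"
    proof (rule ext)
      fix x
      show "?p' x i * \<eta> x = \<psi>' (f n x) * f' n x * \<eta> x"
      proof (cases "x \<in> supp \<eta>")
        case True
        then have "cball x (d n) \<subseteq> U" using e d[of n] by fastforce
        from conv_weak_derivative[OF H i d(1) this iw w(2)[unfolded u'_def] iv v(2)[unfolded g'_def]]
        show ?thesis by (simp add: f'_def)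
      qed (simp add: not_in_supp)
    qed
    finally show ?thesis .
  qed
  have lim1: "(\<lambda>n. \<integral>x. \<psi> (f n x) * ?D x \<partial>lborel) \<longlonglongrightarrow> (\<integral>x. \<psi> (w x) * ?D x \<partial>lborel)"
  proof (rule LIM_zero_cancel, rule Lim_null_comparison[OF _ tendsto_mult_right_zero[OF L1(1)]])
    show "eventually (\<lambda>n. norm ((\<integral>x. \<psi> (f n x) * ?D x \<partial>lborel) - (\<integral>x. \<psi> (w x) * ?D x \<partial>lborel))
       \<le> M * N * (\<integral>x. \<bar>f n x - w x\<bar> \<partial>lborel)) sequentially"
    proof (intro always_eventually allI)
      fix n
      have "(\<integral>x. \<psi> (f n x) * ?D x \<partial>lborel) - (\<integral>x. \<psi> (w x) * ?D x \<partial>lborel) = (\<integral>x. \<psi> (f n x) * ?D x - \<psi> (w x) * ?D x \<partial>lborel)"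
        using i1[OF fi(1)] i1[OF iw] by simp
      also have "norm \<dots> \<le> (\<integral>x. norm (\<psi> (f n x) * ?D x - \<psi> (w x) * ?D x) \<partial>lborel)"
        by (rule integral_norm_bound)
      also have "\<dots> \<le> (\<integral>x. M * N * \<bar>f n x - w x\<bar> \<partial>lborel)"
      proof (rule integral_mono)
        fix x
        have "\<bar>\<psi> (f n x) - \<psi> (w x)\<bar> * \<bar>?D x\<bar> \<le> (M * \<bar>f n x - w x\<bar>) * N"
          using Lip D M0 by (intro mult_mono) auto
        then show "norm (\<psi> (f n x) * ?D x - \<psi> (w x) * ?D x) \<le> M * N * \<bar>f n x - w x\<bar>"
          unfolding left_diff_distrib[symmetric] by (simp add: abs_mult mult_ac)
      next
        show "integrable lborel (\<lambda>x. norm (\<psi> (f n x) * ?D x - \<psi> (w x) * ?D x))"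
          by (intro integrable_norm Bochner_Integration.integrable_diff i1 fi iw)
      qed (use fi iw in auto)
      finally show "norm ((\<integral>x. \<psi> (f n x) * ?D x \<partial>lborel) - (\<integral>x. \<psi> (w x) * ?D x \<partial>lborel))
       \<le> M * N * (\<integral>x. \<bar>f n x - w x\<bar> \<partial>lborel)" by simp
    qed
  qed
  have a: "(\<lambda>n. \<integral>x. \<psi>' (f (r n) x) * v x * \<eta> x \<partial>lborel) \<longlonglongrightarrow> (\<integral>x. \<psi>' (w x) * v x * \<eta> x \<partial>lborel)"
  proof (rule integral_dominated_convergence[where w = "\<lambda>x. M * K * \<bar>v x\<bar>"])
    show "AE x in lborel. (\<lambda>n. \<psi>' (f (r n) x) * v x * \<eta> x) \<longlonglongrightarrow> \<psi>' (w x) * v x * \<eta> x"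
      using r(2)
    proof eventually_elim
      case (elim x)
      have "isCont \<psi>' (w x)" using c by (simp add: continuous_on_eq_continuous_at)
      from isCont_tendsto_compose[OF this LIM_zero_cancel[OF elim]]
      show ?case by (intro tendsto_intros)
    qed
    show "AE x in lborel. norm (\<psi>' (f (r n) x) * v x * \<eta> x) \<le> M * K * \<bar>v x\<bar>" for n
      using bK by (intro AE_I2) simp
  qed (use iv in auto)
  \<comment> \<open>Replacing the mollified gradient by its limit \<open>v\<close> costs at most a
    multiple of their \<open>L\<^sup>1\<close> distance; the term with \<open>v\<close> held fixed
    is \<open>a\<close>.\<close>
  have bz: "(\<lambda>n. (\<integral>x. \<psi>' (f (r n) x) * f' (r n) x * \<eta> x \<partial>lborel) - (\<integral>x. \<psi>' (f (r n) x) * v x * \<eta> x \<partial>lborel)) \<longlonglongrightarrow> 0"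
  proof (rule Lim_null_comparison[OF _ tendsto_mult_right_zero[OF LIMSEQ_subseq_LIMSEQ[OF L1(2) r(1)]]])
    show "eventually (\<lambda>n. norm ((\<integral>x. \<psi>' (f (r n) x) * f' (r n) x * \<eta> x \<partial>lborel) - (\<integral>x. \<psi>' (f (r n) x) * v x * \<eta> x \<partial>lborel))
       \<le> M * K * ((\<lambda>n. \<integral>x. \<bar>f' n x - v x\<bar> \<partial>lborel) \<circ> r) n) sequentially"
    proof (intro always_eventually allI)
      fix n
      have "(\<integral>x. \<psi>' (f (r n) x) * f' (r n) x * \<eta> x \<partial>lborel) - (\<integral>x. \<psi>' (f (r n) x) * v x * \<eta> x \<partial>lborel)
        = (\<integral>x. \<psi>' (f (r n) x) * (f' (r n) x - v x) * \<eta> x \<partial>lborel)"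
        using i2[OF fi(2), of "f (r n)" "r n"] i2[OF iv, of "f (r n)"]
        by (simp add: left_diff_distrib right_diff_distrib)
      also have "norm \<dots> \<le> (\<integral>x. norm (\<psi>' (f (r n) x) * (f' (r n) x - v x) * \<eta> x) \<partial>lborel)"
        by (rule integral_norm_bound)
      also have "\<dots> \<le> (\<integral>x. M * K * \<bar>f' (r n) x - v x\<bar> \<partial>lborel)"
      proof (rule integral_mono)
        show "integrable lborel (\<lambda>x. norm (\<psi>' (f (r n) x) * (f' (r n) x - v x) * \<eta> x))"
          by (intro integrable_norm i2 Bochner_Integration.integrable_diff fi iv) simp
        show "norm (\<psi>' (f (r n) x) * (f' (r n) x - v x) * \<eta> x) \<le> M * K * \<bar>f' (r n) x - v x\<bar>" for x
          using bK by simp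
      qed (use fi iv in auto)
      finally show "norm ((\<integral>x. \<psi>' (f (r n) x) * f' (r n) x * \<eta> x \<partial>lborel) - (\<integral>x. \<psi>' (f (r n) x) * v x * \<eta> x \<partial>lborel))
       \<le> M * K * ((\<lambda>n. \<integral>x. \<bar>f' n x - v x\<bar> \<partial>lborel) \<circ> r) n" by simp
    qed
  qed
  from tendsto_add[OF bz a]
  have lim2: "(\<lambda>n. \<integral>x. \<psi>' (f (r n) x) * f' (r n) x * \<eta> x \<partial>lborel) \<longlonglongrightarrow> (\<integral>x. \<psi>' (w x) * v x * \<eta> x \<partial>lborel)"
    by simp
  have "(\<lambda>n. \<integral>x. \<psi> (f (r n) x) * ?D x \<partial>lborel) \<longlonglongrightarrow> (\<integral>x. \<psi> (w x) * ?D x \<partial>lborel)"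
    using LIMSEQ_subseq_LIMSEQ[OF lim1 r(1)] by (simp add: o_def)
  note fin = LIMSEQ_unique[OF this[unfolded ibp] tendsto_minus[OF lim2]]
  have "y \<notin> U \<Longrightarrow> y \<notin> supp \<eta>" for y using \<eta>(2) by blast
  then have out: "y \<notin> U \<Longrightarrow> \<eta> y = 0" "y \<notin> U \<Longrightarrow> ?D y = 0" for y
    by (simp_all add: not_in_supp)
  have [measurable]: "u' \<in> borel_measurable lebesgue" "g' \<in> borel_measurable lebesgue"
    using iu ig by (auto dest: borel_measurable_integrable)
  have [measurable]: "\<eta> \<in> borel_measurable lebesgue" "?D \<in> borel_measurable lebesgue"
    by (auto intro!: measurable_borel_lebesgue)
  have "(LINT y:U|lebesgue. \<psi> (u y) * ?D y) = (LINT y|lebesgue. \<psi> (u' y) * ?D y)"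
    unfolding set_lebesgue_integral_def
    by (intro Bochner_Integration.integral_cong refl) (use out in \<open>auto simp: u'_def indicator_def\<close>)
  also have "\<dots> = (\<integral>x. \<psi> (w x) * ?D x \<partial>lborel)"
    by (rule lebesgue_integrable_version(2)) (use w(2) in \<open>auto elim!: eventually_mono\<close>)
  also note fin
  also have "(\<integral>x. \<psi>' (w x) * v x * \<eta> x \<partial>lborel) = (LINT y|lebesgue. \<psi>' (u' y) * g' y * \<eta> y)"
    by (rule lebesgue_integrable_version(2)[symmetric])
       (use w(2) v(2) in \<open>auto elim: eventually_elim2\<close>)
  also have "(LINT y|lebesgue. \<psi>' (u' y) * g' y * \<eta> y) = (LINT y:U|lebesgue. \<psi>' (u y) * (g y \<bullet> i) * \<eta> y)"
    unfolding set_lebesgue_integral_def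
    by (intro Bochner_Integration.integral_cong refl) (use out in \<open>auto simp: u'_def g'_def indicator_def\<close>)
  finally show ?thesis .
qed

text \<open>Both gradients have the same mollification wherever the kernel fits into
  \<open>U\<close>, namely the derivative of the mollified \<open>u\<close>; letting the radius
  shrink identifies them almost everywhere. This makes the value of \<open>E_phiL\<close>
  independent of the gradient chosen by \<open>SOME\<close>.\<close>

lemma weak_gradient_unique:
  fixes u :: "'a::euclidean_space \<Rightarrow> real"
  assumes H: "H1_grad U u g" and H': "H1_grad U u g'" and U: "open U" "bounded U"
  shows "AE x in lebesgue. x \<in> U \<longrightarrow> g x = g' x"
proof -
  have "AE x in lebesgue. x \<in> U \<longrightarrow> g x \<bullet> i = g' x \<bullet> i" if i: "i \<in> Basis" for i
  proof -
    have iu: "integrable lebesgue (\<lambda>y. indicator U y * u y)" 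
      and ig: "integrable lebesgue (\<lambda>y. indicator U y * (g y \<bullet> i))"
      and ig': "integrable lebesgue (\<lambda>y. indicator U y * (g' y \<bullet> i))"
      using H1_grad_integrable[OF H U] H1_grad_integrable[OF H' U] by auto
    obtain w where w: "w \<in> borel_measurable borel" "AE x in lebesgue. indicator U x * u x = w x"
      using lborel_version borel_measurable_integrable[OF iu] by blast
    obtain v where v: "v \<in> borel_measurable borel" "AE x in lebesgue. indicator U x * (g x \<bullet> i) = v x"
      using lborel_version borel_measurable_integrable[OF ig] by blast
    obtain v' where v': "v' \<in> borel_measurable borel" "AE x in lebesgue. indicator U x * (g' x \<bullet> i) = v' x"
      using lborel_version borel_measurable_integrable[OF ig'] by blast
    have iw: "integrable lborel w"
      using lebesgue_integrable_version(1)[OF w borel_measurable_integrable[OF iu]] iu by simp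
    have iv: "integrable lborel v"
      using lebesgue_integrable_version(1)[OF v borel_measurable_integrable[OF ig]] ig by simp
    have iv': "integrable lborel v'"
      using lebesgue_integrable_version(1)[OF v' borel_measurable_integrable[OF ig']] ig' by simp
    define d where "d n = 1 / real (Suc n)" for n
    have d: "d n > 0" for n by (simp add: d_def)
    have d0: "d \<longlonglongrightarrow> 0" unfolding d_def using LIMSEQ_Suc[OF lim_1_over_n[where 'a=real]] by simp
    define z where "z x = v x - v' x" for x
    have iz: "integrable lborel z" unfolding z_def using iv iv' by simp
    have "(\<lambda>n. \<integral>x. \<bar>conv z (moll (d n)) x - z x\<bar> \<partial>lborel) \<longlonglongrightarrow> 0"
      by (rule conv_moll_L1[OF iz d d0])
    then obtain r where r: "strict_mono r" "AE x in lborel. (\<lambda>n. conv z (moll (d (r n))) x - z x) \<longlonglongrightarrow> 0"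
      using tendsto_L1_AE_subseq[of lborel "\<lambda>n x. conv z (moll (d n)) x - z x"] iz
        conv_integrable_lborel[OF iz moll_integrable[OF d]] by auto
    have z0: "x \<in> U \<longrightarrow> z x = 0" if "(\<lambda>n. conv z (moll (d (r n))) x - z x) \<longlonglongrightarrow> 0" for x
    proof
      assume "x \<in> U"
      then obtain e where e: "e > 0" "cball x e \<subseteq> U" using U(1) open_contains_cball by blast
      have "eventually (\<lambda>n. d (r n) < e) sequentially"
        using LIMSEQ_subseq_LIMSEQ[OF d0 r(1)] e(1) by (intro order_tendstoD(2)) (auto simp: o_def)
      \<comment> \<open>Once the ball of the mollifier lies in \<open>U\<close>, the mollification
        of \<open>z\<close> is exactly 0 at \<open>x\<close>.\<close>
      then have "eventually (\<lambda>n. conv z (moll (d (r n))) x - z x = - z x) sequentially"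
      proof eventually_elim
        case (elim n)
        then have c: "cball x (d (r n)) \<subseteq> U" using e(2) by fastforce
        show ?case
          using conv_weak_derivative[OF H i d c iw w(2) iv v(2)] conv_weak_derivative[OF H' i d c iw w(2) iv' v'(2)]
            conv_moll_add(2)[OF d iv iv'] by (simp add: z_def[abs_def])
      qed
      then have "(\<lambda>n. conv z (moll (d (r n))) x - z x) \<longlonglongrightarrow> - z x" by (rule tendsto_eventually)
      with that have "- z x = 0" by (rule LIMSEQ_unique[rotated])
      then show "z x = 0" by simp
    qed
    have "AE x in lebesgue. x \<in> U \<longrightarrow> z x = 0"
      using AE_completion[OF r(2)] by eventually_elim (rule z0)
    then show ?thesis
      using v(2) v'(2) by eventually_elim (auto simp: z_def)
  qed
  then have "AE x in lebesgue. \<forall>i\<in>Basis. x \<in> U \<longrightarrow> g x \<bullet> i = g' x \<bullet> i"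
    by (intro AE_ball_countable' countable_finite) auto
  then show ?thesis by eventually_elim (auto intro: euclidean_eqI)
qed

subsection \<open>The Modica-Mortola estimate\<close>

text \<open>The primitive of \<open>mm_density b\<close>, normalised to vanish at \<open>- b\<close>
  and constant outside the interval from \<open>- b\<close> to \<open>b\<close>. For
  \<open>b = 1\<close> the density would be \<open>sqrt (2 * G s)\<close> between the wells, with
  total integral \<open>c0\<close>.\<close>

definition mm_primitive :: "real \<Rightarrow> real \<Rightarrow> real" where
  "mm_primitive b s = (let y = max (- b) (min b s) in (b\<^sup>2 * y - y ^ 3 / 3 + 2 * b ^ 3 / 3) / sqrt 2)"

text \<open>Moving the zeros from 1 to \<open>b\<close> makes the density vanish for
  \<open>s \<le> - b\<close>, which leaves the whole potential there to pay for the
  background.\<close>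

definition mm_density :: "real \<Rightarrow> real \<Rightarrow> real" where
  "mm_density b s = (b\<^sup>2 - (max (- b) (min b s))\<^sup>2) / sqrt 2"

lemma mm_primitive_has_derivative:
  assumes "0 < b"
  shows "(mm_primitive b has_real_derivative mm_density b s) (at s)"
proof -
  have "((\<lambda>y. b\<^sup>2 * y - y ^ 3 / 3 + 2 * b ^ 3 / 3) has_real_derivative b\<^sup>2 - y\<^sup>2) (at y)" for y
    by (auto intro!: derivative_eq_intros)
  from DERIV_cdivide[OF this]
  have "((\<lambda>y. (b\<^sup>2 * y - y ^ 3 / 3 + 2 * b ^ 3 / 3) / sqrt 2) has_real_derivative (b\<^sup>2 - y\<^sup>2) / sqrt 2) (at y)" for y .
  from has_real_derivative_clamp[OF this, of "- b" b s] assms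
  show ?thesis unfolding mm_primitive_def[abs_def] mm_density_def Let_def by simp
qed

lemma mm_density_continuous: "continuous_on UNIV (mm_density b)"
  unfolding mm_density_def[abs_def] by (intro continuous_intros) auto

lemma mm_density_range:
  assumes "0 < b" "b < 1"
  shows "0 \<le> mm_density b s" "mm_density b s \<le> 1" "\<bar>s\<bar> \<ge> b \<Longrightarrow> mm_density b s = 0"
proof -
  let ?y = "max (- b) (min b s)"
  have "\<bar>?y\<bar> \<le> b" using assms by (auto simp: max_def min_def)
  then have y: "?y\<^sup>2 \<le> b\<^sup>2" by (metis abs_le_square_iff abs_of_pos assms(1))
  then show "0 \<le> mm_density b s" by (simp add: mm_density_def)
  have "b\<^sup>2 \<le> 1" using assms by (intro power_le_one) auto
  then have "b\<^sup>2 - ?y\<^sup>2 \<le> 1" by (smt (verit) zero_le_power2)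
  also have "1 \<le> sqrt 2" by simp
  finally show "mm_density b s \<le> 1" by (simp add: mm_density_def)
  assume "\<bar>s\<bar> \<ge> b"
  then have "?y = b \<or> ?y = - b" using assms by auto
  then show "mm_density b s = 0" by (auto simp: mm_density_def)
qed

lemma mm_primitive_values:
  assumes "0 < b" "b < 1"
  shows "mm_primitive b 1 = c0 * b ^ 3" "mm_primitive b (-1) = 0"
proof -
  have "sqrt 2 * sqrt 2 = (2::real)" by simp
  then show "mm_primitive b 1 = c0 * b ^ 3"
    using assms by (simp add: mm_primitive_def c0_def max_def min_def field_simps power2_eq_square power3_eq_cube)
  show "mm_primitive b (-1) = 0"
    using assms by (simp add: mm_primitive_def max_def min_def power2_eq_square power3_eq_cube)
qed

lemma mm_primitive_bounded:
  assumes "0 < b" "b < 1"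
  shows "\<bar>mm_primitive b s\<bar> \<le> 2"
proof -
  define y where "y = max (- b) (min b s)"
  have y: "\<bar>y\<bar> \<le> 1" using assms by (auto simp: y_def max_def min_def)
  have b: "\<bar>b\<^sup>2\<bar> \<le> 1" "\<bar>b ^ 3\<bar> \<le> 1" using assms by (auto intro!: power_le_one)
  have "\<bar>b\<^sup>2 * y\<bar> \<le> 1 * 1" unfolding abs_mult using b y by (intro mult_mono) auto
  moreover have "\<bar>y ^ 3\<bar> \<le> 1" unfolding power_abs using y by (intro power_le_one) auto
  ultimately have "\<bar>b\<^sup>2 * y - y ^ 3 / 3 + 2 * b ^ 3 / 3\<bar> \<le> 2" using b by linarith
  moreover have "\<bar>x / sqrt 2\<bar> \<le> \<bar>x\<bar>" for x :: real
    using mult_left_mono[of 1 "sqrt 2" "\<bar>x\<bar>"] by (simp add: field_simps)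
  ultimately show ?thesis unfolding mm_primitive_def y_def[symmetric] Let_def using order_trans by blast
qed

lemma G_nonneg: "0 \<le> G s"
  by (simp add: G_def)

text \<open>For \<open>s \<le> - b\<close> the density is 0, and \<open>G s\<close> is the product
  of \<open>((1 - s) / 2)\<^sup>2\<close> and \<open>(1 + s)\<^sup>2\<close> with
  \<open>1 - s \<ge> 1 + b\<close>. Elsewhere the density \<open>q\<close> satisfies
  \<open>q\<^sup>2 \<le> 2 * G s\<close>, and the nonnegative square
  \<open>(\<phi> * t - q)\<^sup>2\<close> yields the product \<open>q * t\<close>.\<close>

lemma modica_mortola_pointwise:
  assumes b: "0 < b" "b < 1" and \<phi>: "\<phi> > 0"
  shows "mm_density b s * t + (if s \<le> - b then ((1 + b) / 2)\<^sup>2 / \<phi> * (1 + s)\<^sup>2 else 0)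
     \<le> \<phi> / 2 * t\<^sup>2 + 1 / \<phi> * G s"
proof (cases "s \<le> - b")
  case True
  then have z: "mm_density b s = 0" using mm_density_range(3)[OF b] b by simp
  have "((1 + b) / 2)\<^sup>2 \<le> ((1 - s) / 2)\<^sup>2" using True b by (intro power_mono) auto
  then have "((1 + b) / 2)\<^sup>2 * (1 + s)\<^sup>2 \<le> ((1 - s) / 2)\<^sup>2 * (1 + s)\<^sup>2" by (rule mult_right_mono) simp
  also have "\<dots> = G s" by (simp add: G_def power2_eq_square field_simps)
  finally have "((1 + b) / 2)\<^sup>2 * (1 + s)\<^sup>2 / \<phi> \<le> G s / \<phi>" using \<phi> by (simp add: divide_right_mono)
  moreover have "0 \<le> \<phi> / 2 * t\<^sup>2" using \<phi> by simp
  ultimately show ?thesis using True z by simp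
next
  case False
  define q where "q = mm_density b s"
  have "q\<^sup>2 \<le> 2 * G s"
  proof (cases "s \<ge> b")
    case True
    then show ?thesis using mm_density_range(3)[OF b] b G_nonneg[of s] by (simp add: q_def)
  next
    case F2: False
    have sb: "\<bar>s\<bar> \<le> b" using False F2 by auto
    then have s2: "s\<^sup>2 \<le> b\<^sup>2" by (metis abs_le_square_iff abs_of_pos b(1))
    have b2: "b\<^sup>2 \<le> 1" using b by (intro power_le_one) auto
    have "q = (b\<^sup>2 - s\<^sup>2) / sqrt 2" using False F2 by (simp add: q_def mm_density_def)
    then have "q\<^sup>2 = (b\<^sup>2 - s\<^sup>2)\<^sup>2 / 2" by (simp add: power_divide)
    also have "\<dots> \<le> (1 - s\<^sup>2)\<^sup>2 / 2" using s2 b2 by (intro divide_right_mono power_mono) auto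
    finally show ?thesis by (simp add: G_def)
  qed
  then have "q\<^sup>2 / (2 * \<phi>) \<le> G s / \<phi>" using \<phi> by (simp add: field_simps)
  moreover have "q * t \<le> \<phi> / 2 * t\<^sup>2 + q\<^sup>2 / (2 * \<phi>)"
  proof -
    have "0 \<le> (\<phi> * t - q)\<^sup>2 / (2 * \<phi>)" using \<phi> by simp
    also have "\<dots> = \<phi> / 2 * t\<^sup>2 + q\<^sup>2 / (2 * \<phi>) - q * t"
      using \<phi> by (simp add: power2_eq_square field_simps)
    finally show ?thesis by simp
  qed
  ultimately show ?thesis using False by (simp add: q_def)
qed

lemma mm_primitive_lipschitz:
  assumes "0 < b" "b < 1"
  shows "\<bar>mm_primitive b s - mm_primitive b t\<bar> \<le> \<bar>s - t\<bar>"
proof -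
  have "\<bar>mm_density b s * h\<bar> \<le> 1 * \<bar>h\<bar>" for s h
    using mm_density_range[OF assms, of s] mult_right_mono[of "mm_density b s" 1 "\<bar>h\<bar>"]
    by (simp add: abs_mult)
  then show ?thesis
    using has_derivative_bound[of "mm_primitive b" "\<lambda>s h. mm_density b s * h" 1 s t]
      mm_primitive_has_derivative[OF assms(1)] by (simp add: has_field_derivative_def)
qed

section \<open>The cube and the expansion of the energy\<close>

lemma Omega_interior:
  "interior (Omega \<phi> L :: 'a::euclidean_space set) = box (- ((\<phi> * L / 2) *\<^sub>R One)) ((\<phi> * L / 2) *\<^sub>R One)"
  by (simp add: Omega_def interior_cbox)

lemma open_interior_Omega: "open (interior (Omega \<phi> L))" by simp

lemma bounded_interior_Omega: "bounded (interior (Omega \<phi> L))"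
  unfolding Omega_interior by simp

text \<open>Energy and mass are integrals over the closed cube, the Sobolev condition concerns its
  interior; the frontier between them is negligible.\<close>

lemma Omega_AE: "AE x in lebesgue. x \<in> Omega \<phi> L \<longleftrightarrow> x \<in> interior (Omega \<phi> L :: 'a::euclidean_space set)"
proof -
  have "negligible (Omega \<phi> L - interior (Omega \<phi> L) :: 'a set)"
    unfolding Omega_def interior_cbox using negligible_frontier_interval by auto
  then have "Omega \<phi> L - interior (Omega \<phi> L :: 'a set) \<in> null_sets lebesgue"
    by (simp add: negligible_iff_null_sets)
  then have "AE x in lebesgue. x \<notin> Omega \<phi> L - interior (Omega \<phi> L :: 'a set)"
    by (rule AE_not_in)
  then show ?thesis
    by (rule AE_mp) (intro AE_I2, use interior_subset[of "Omega \<phi> L :: 'a set"] in blast)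
qed

lemma Omega_measure:
  assumes "\<phi> > 0" "L > 0"
  shows "measure lebesgue (Omega \<phi> L :: 'a::euclidean_space set) = (\<phi> * L) ^ DIM('a)"
proof -
  have "measure lborel (cbox (- ((\<phi> * L / 2) *\<^sub>R One)) ((\<phi> * L / 2) *\<^sub>R One) :: 'a set) = (\<phi> * L) ^ DIM('a)"
    using assms by (subst content_cbox) (auto simp: inner_diff_left mult.commute)
  then show ?thesis by (simp add: Omega_def)
qed

lemma interior_Omega_measure:
  assumes "\<phi> > 0" "L > 0"
  shows "measure lebesgue (interior (Omega \<phi> L) :: 'a::euclidean_space set) = (\<phi> * L) ^ DIM('a)"
proof -
  have "measure lebesgue (Omega \<phi> L :: 'a set) = measure lebesgue (interior (Omega \<phi> L) :: 'a set)"
    by (rule measure_eq_AE[OF Omega_AE]) (auto simp: Omega_def)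
  then show ?thesis using Omega_measure[OF assms, where 'a='a] by simp
qed

lemma ball_subset_Omega:
  assumes "r < \<phi> * L / 2"
  shows "cball (0::'a::euclidean_space) r \<subseteq> interior (Omega \<phi> L)"
  unfolding Omega_interior
proof
  fix x :: 'a assume "x \<in> cball 0 r"
  then have "norm x \<le> r" by simp
  then have "- (\<phi> * L / 2) < x \<bullet> i \<and> x \<bullet> i < \<phi> * L / 2" if "i \<in> Basis" for i
    using Basis_le_norm[OF that, of x] assms unfolding abs_le_iff by linarith
  then show "x \<in> box (- ((\<phi> * L / 2) *\<^sub>R One)) ((\<phi> * L / 2) *\<^sub>R One)"
    by (simp add: mem_box)
qed

lemma measurable_AE_lebesgue:
  fixes f g :: "'a::euclidean_space \<Rightarrow> real"
  assumes "f \<in> borel_measurable lebesgue" "AE x in lebesgue. f x = g x"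
  shows "g \<in> borel_measurable lebesgue"
  using assms by (rule borel_measurable_AE)

lemma integrable_indicator_bounded_lebesgue:
  fixes U :: "'a::euclidean_space set"
  assumes "open U" "bounded U"
  shows "integrable lebesgue (indicator U :: 'a \<Rightarrow> real)"
  using integrable_indicator_bounded[OF assms(2)] assms(1) by (simp add: integrable_completion)

text \<open>The integral may be split because each part is integrable: the gradient by
  \<open>H1_grad\<close>, the potential by the \<open>L\<^sup>4\<close> condition and
  \<open>G s \<le> 1 + s ^ 4\<close>. The mass is restated for \<open>1 + u\<close>, the deviation
  from the background phase.\<close>

lemma energy_expand:
  fixes u :: "'a::euclidean_space \<Rightarrow> real" and \<phi> L :: real
  defines "U \<equiv> interior (Omega \<phi> L) :: 'a set"
  assumes a: "admissible \<phi> L u" and um: "u \<in> borel_measurable lebesgue" and pos: "\<phi> > 0" "L > 0"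
  obtains g where "H1_grad U u g" and "integrable lebesgue (\<lambda>x. indicator U x * (norm (g x))\<^sup>2)"
    and "integrable lebesgue (\<lambda>x. indicator U x * G (u x))"
    and "E_phiL \<phi> L u = ereal (\<phi> / 2 * (LINT x|lebesgue. indicator U x * (norm (g x))\<^sup>2)
       + 1 / \<phi> * (LINT x|lebesgue. indicator U x * G (u x)) - (\<phi> * L) ^ DIM('a) * G (-1 + \<phi>) / \<phi>)"
    and "(LINT x|lebesgue. indicator U x * (1 + u x)) = \<phi> * (\<phi> * L) ^ DIM('a)"
proof -
  define g where "g = (SOME g. H1_grad U u g)"
  have "\<exists>g. H1_grad U u g" using a unfolding admissible_def U_def by blast
  then have H: "H1_grad U u g" unfolding g_def by (rule someI_ex)
  have iU: "integrable lebesgue (indicator U :: 'a \<Rightarrow> real)"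
    unfolding U_def by (intro integrable_indicator_bounded_lebesgue open_interior_Omega bounded_interior_Omega)
  have mU: "(LINT x|lebesgue. indicator U x) = (\<phi> * L) ^ DIM('a)"
    using interior_Omega_measure[OF pos, where 'a='a] by (simp add: U_def)
  have [measurable]: "U \<in> sets lebesgue" unfolding U_def by simp
  have [measurable]: "u \<in> borel_measurable lebesgue" by (rule um)
  have i1: "integrable lebesgue (\<lambda>x. indicator U x * (norm (g x))\<^sup>2)"
    using H unfolding H1_grad_def set_integrable_def by simp
  have AEU: "AE x in lebesgue. (indicator U x :: real) = indicator (Omega \<phi> L) x"
    using Omega_AE[of \<phi> L] unfolding U_def by eventually_elim (auto simp: indicator_def)
  have "integrable lebesgue (\<lambda>x. indicator (Omega \<phi> L) x * (u x) ^ 4)"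
    using a unfolding admissible_def set_integrable_def by simp
  then have i4: "integrable lebesgue (\<lambda>x. indicator U x * (u x) ^ 4)"
    by (rule integrable_cong_AE_imp) (use AEU in \<open>auto elim!: eventually_mono\<close>)
  have i2: "integrable lebesgue (\<lambda>x. indicator U x * G (u x))"
  proof (rule Bochner_Integration.integrable_bound[OF Bochner_Integration.integrable_add[OF iU i4]])
    show "(\<lambda>x. indicator U x * G (u x)) \<in> borel_measurable lebesgue" unfolding G_def by measurable
    have "G s \<le> 1 + s ^ 4" for s
    proof -
      have "1 + s ^ 4 - G s = (3 + 2 * s\<^sup>2 + 3 * s ^ 4) / 4"
        unfolding G_def by (simp add: power2_eq_square field_simps power4_eq_xxxx)
      moreover have "0 \<le> \<dots>" by simp
      ultimately show ?thesis by linarith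
    qed
    then show "AE x in lebesgue. norm (indicator U x * G (u x)) \<le> norm (indicator U x + indicator U x * (u x) ^ 4)"
      using G_nonneg by (intro AE_I2) (auto simp: indicator_def)
  qed
  let ?F = "\<lambda>x. \<phi> / 2 * (norm (g x))\<^sup>2 + 1 / \<phi> * (G (u x) - G (-1 + \<phi>))"
  have iF: "integrable lebesgue (\<lambda>x. indicator U x * ?F x)"
  proof -
    have "integrable lebesgue (\<lambda>x. \<phi> / 2 * (indicator U x * (norm (g x))\<^sup>2) + 1 / \<phi> * (indicator U x * G (u x)) - G (-1 + \<phi>) / \<phi> * indicator U x)"
      using i1 i2 iU by (intro Bochner_Integration.integrable_add Bochner_Integration.integrable_diff integrable_mult_right)
    then show ?thesis by (simp add: algebra_simps diff_divide_distrib)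
  qed
  have "(LINT x:Omega \<phi> L|lebesgue. ?F x) = (LINT x|lebesgue. indicator U x * ?F x)"
    unfolding set_lebesgue_integral_def
  proof (rule integral_cong_AE[symmetric])
    show m: "(\<lambda>x. indicator U x * ?F x) \<in> borel_measurable lebesgue"
      using iF by (rule borel_measurable_integrable)
    show e: "AE x in lebesgue. indicator U x * ?F x = indicator (Omega \<phi> L) x *\<^sub>R ?F x"
      using AEU by eventually_elim simp
    show "(\<lambda>x. indicator (Omega \<phi> L) x *\<^sub>R ?F x) \<in> borel_measurable lebesgue"
      by (rule measurable_AE_lebesgue[OF m e])
  qed
  also have "\<dots> = (LINT x|lebesgue. \<phi> / 2 * (indicator U x * (norm (g x))\<^sup>2) + 1 / \<phi> * (indicator U x * G (u x)) - G (-1 + \<phi>) / \<phi> * indicator U x)"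
    by (simp add: algebra_simps diff_divide_distrib)
  also have "\<dots> = \<phi> / 2 * (LINT x|lebesgue. indicator U x * (norm (g x))\<^sup>2)
       + 1 / \<phi> * (LINT x|lebesgue. indicator U x * G (u x)) - G (-1 + \<phi>) / \<phi> * (LINT x|lebesgue. indicator U x)"
    using i1 i2 iU by simp
  finally have E: "E_phiL \<phi> L u = ereal (\<phi> / 2 * (LINT x|lebesgue. indicator U x * (norm (g x))\<^sup>2)
       + 1 / \<phi> * (LINT x|lebesgue. indicator U x * G (u x)) - (\<phi> * L) ^ DIM('a) * G (-1 + \<phi>) / \<phi>)"
    using a mU unfolding E_phiL_def Let_def g_def U_def by (simp add: mult.commute)
  have iu: "integrable lebesgue (\<lambda>x. indicator U x * u x)"
    using H1_grad_integrable(1)[OF H] open_interior_Omega bounded_interior_Omega unfolding U_def by blast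
  have "(LINT x:Omega \<phi> L|lebesgue. u x) = (LINT x|lebesgue. indicator U x * u x)"
    unfolding set_lebesgue_integral_def
  proof (rule integral_cong_AE)
    have [measurable]: "Omega \<phi> L \<in> sets (lebesgue :: 'a measure)" by (simp add: Omega_def)
    show "(\<lambda>x. indicator (Omega \<phi> L) x *\<^sub>R u x) \<in> borel_measurable lebesgue" by measurable
    show "(\<lambda>x. indicator U x * u x) \<in> borel_measurable lebesgue" by measurable
    show "AE x in lebesgue. indicator (Omega \<phi> L) x *\<^sub>R u x = indicator U x * u x"
      using AEU by eventually_elim simp
  qed
  then have "(LINT x|lebesgue. indicator U x * u x) = (-1 + \<phi>) * (\<phi> * L) ^ DIM('a)"
    using a pos unfolding admissible_def Omega_measure[OF pos] by (auto simp: field_simps)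
  then have "(LINT x|lebesgue. indicator U x * (1 + u x)) = \<phi> * (\<phi> * L) ^ DIM('a)"
    using iu iU mU by (simp add: distrib_left algebra_simps)
  then show ?thesis using that[OF H i1 i2 E] by simp
qed

section \<open>Elementary inequalities for convergence in \<open>L\<^sup>p\<close>\<close>

lemma powr_add_bound:
  fixes x y p :: real
  assumes "x \<ge> 0" "y \<ge> 0" "p > 0"
  shows "(x + y) powr p \<le> 2 powr p * (x powr p + y powr p)"
proof -
  have "(x + y) powr p \<le> (2 * max x y) powr p" using assms by (intro powr_mono2) auto
  also have "\<dots> = 2 powr p * max x y powr p" using assms by (simp add: powr_mult)
  also have "max x y powr p \<le> x powr p + y powr p" by (auto simp: max_def)
  finally show ?thesis by simp
qed

text \<open>For \<open>x > e\<close> the factor \<open>x powr (1 - p)\<close> is at most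
  \<open>e powr (1 - p)\<close>. So \<open>L\<^sup>p\<close> smallness yields a linear estimate up
  to an additive \<open>e\<close>, affordable against an integrable weight.\<close>

lemma young_cutoff:
  fixes x e p :: real
  assumes "x \<ge> 0" "e > 0" "p > 1"
  shows "x \<le> e + e powr (1 - p) * x powr p"
proof (cases "x \<le> e")
  case True
  then show ?thesis using assms by (simp add: add_increasing2)
next
  case False
  then have "x powr (1 - p) \<le> e powr (1 - p)" using assms by (intro powr_mono2') auto
  then have "x powr p * x powr (1 - p) \<le> x powr p * e powr (1 - p)" by (rule mult_left_mono) simp
  moreover have "x powr p * x powr (1 - p) = x" using False assms by (simp add: powr_add[symmetric])
  ultimately show ?thesis using assms by (simp add: mult.commute)
qed

lemma Lp_conv_integrals:
  assumes p: "p > 1" and un: "\<And>n. minus1_Lp p (un n)" and u0: "minus1_Lp p u0" and c: "Lp_conv p un u0"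
  shows "integrable lebesgue (\<lambda>x. \<bar>un n x - u0 x\<bar> powr p)"
    and "(\<lambda>n. LINT x|lebesgue. \<bar>un n x - u0 x\<bar> powr p) \<longlonglongrightarrow> 0"
proof -
  have i: "integrable lebesgue (\<lambda>x. \<bar>u x + 1\<bar> powr p)" if "minus1_Lp p u" for u :: "'a::euclidean_space \<Rightarrow> real"
    using that unfolding minus1_Lp_def by (intro integrableI_bounded) auto
  have m: "un n \<in> borel_measurable lebesgue" "u0 \<in> borel_measurable lebesgue" for n
    using un u0 unfolding minus1_Lp_def by auto
  show int: "integrable lebesgue (\<lambda>x. \<bar>un n x - u0 x\<bar> powr p)" for n
  proof (rule Bochner_Integration.integrable_bound[OF
      integrable_mult_right[OF Bochner_Integration.integrable_add[OF i[OF un[of n]] i[OF u0]], of "2 powr p"]])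
    show "(\<lambda>x. \<bar>un n x - u0 x\<bar> powr p) \<in> borel_measurable lebesgue" using m(1)[of n] m(2) by measurable
    show "AE x in lebesgue. norm (\<bar>un n x - u0 x\<bar> powr p) \<le> norm (2 powr p * (\<bar>un n x + 1\<bar> powr p + \<bar>u0 x + 1\<bar> powr p))"
    proof (rule AE_I2)
      fix x
      have "\<bar>un n x - u0 x\<bar> powr p \<le> (\<bar>un n x + 1\<bar> + \<bar>u0 x + 1\<bar>) powr p" using p by (intro powr_mono2) auto
      also have "\<dots> \<le> 2 powr p * (\<bar>un n x + 1\<bar> powr p + \<bar>u0 x + 1\<bar> powr p)" using p by (intro powr_add_bound) auto
      finally show "norm (\<bar>un n x - u0 x\<bar> powr p) \<le> norm (2 powr p * (\<bar>un n x + 1\<bar> powr p + \<bar>u0 x + 1\<bar> powr p))" by simp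
    qed
  qed
  have "(\<lambda>n. ennreal (LINT x|lebesgue. \<bar>un n x - u0 x\<bar> powr p)) \<longlonglongrightarrow> ennreal 0"
    using c unfolding Lp_conv_def by (simp add: nn_integral_eq_integral[OF int])
  then show "(\<lambda>n. LINT x|lebesgue. \<bar>un n x - u0 x\<bar> powr p) \<longlonglongrightarrow> 0"
    by (rule tendsto_ennrealD) auto
qed

section \<open>Test fields and the duality estimate\<close>

lemma C1c_inner:
  fixes X :: "'a::euclidean_space \<Rightarrow> 'a"
  assumes X: "C1c X"
  shows "C1c (\<lambda>x. X x \<bullet> i)"
    and "frechet_derivative (\<lambda>x. X x \<bullet> i) (at x) h = frechet_derivative X (at x) h \<bullet> i"
    and "supp (\<lambda>x. X x \<bullet> i) \<subseteq> supp X"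
proof -
  have d: "((\<lambda>x. X x \<bullet> i) has_derivative (\<lambda>h. frechet_derivative X (at x) h \<bullet> i)) (at x)" for x
    by (intro has_derivative_inner_left C1c_has_derivative[OF X])
  obtain R where R: "\<And>x. norm x \<ge> R \<Longrightarrow> X x = 0" using C1c_vanishes[OF X] by metis
  show "C1c (\<lambda>x. X x \<bullet> i)"
    by (rule C1cI[OF d, of R]) (auto intro!: continuous_intros C1c_continuous_partial[OF X] simp: R)
  show "frechet_derivative (\<lambda>x. X x \<bullet> i) (at x) h = frechet_derivative X (at x) h \<bullet> i"
    by (simp add: frechet_derivativeI[OF d])
  show "supp (\<lambda>x. X x \<bullet> i) \<subseteq> supp X"
    unfolding supp_def by (rule closure_mono) auto
qed

lemma div_field_continuous:
  assumes "C1c X"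
  shows "continuous_on UNIV (div_field X)"
  unfolding div_field_def[abs_def] by (intro continuous_intros C1c_continuous_partial[OF assms])

lemma div_field_zero: "x \<notin> supp X \<Longrightarrow> div_field X x = 0"
  by (simp add: div_field_def not_in_supp)

lemma div_field_bounded_integrable:
  fixes X :: "'a::euclidean_space \<Rightarrow> 'a"
  assumes X: "C1c X"
  obtains B where "B > 0" "\<And>x. \<bar>div_field X x\<bar> \<le> B" "integrable lborel (div_field X)"
proof -
  obtain R where R: "\<And>x. norm x \<ge> R \<Longrightarrow> frechet_derivative X (at x) = (\<lambda>_. 0)"
    using C1c_vanishes[OF X] by metis
  then have z: "norm x \<ge> R \<Longrightarrow> div_field X x = 0" for x by (simp add: div_field_def)
  from continuous_vanishing_bounded[OF div_field_continuous[OF X] z]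
  obtain B where "B > 0" "\<And>x. \<bar>div_field X x\<bar> \<le> B" by (metis real_norm_def)
  then show ?thesis using that continuous_vanishing_integrable[OF div_field_continuous[OF X] z] by blast
qed

text \<open>Summing the chain rule over the coordinates turns the divergence into the integrand
  \<open>- \<psi>' (u y) * (g y \<bullet> X y)\<close>, and \<open>norm (X y) \<le> 1\<close> bounds
  it by \<open>\<psi>' (u y) * norm (g y)\<close>. In this way the total variation of the composed
  function enters by duality.\<close>

lemma weak_chain_rule_div:
  fixes u :: "'a::euclidean_space \<Rightarrow> real" and \<psi> :: "real \<Rightarrow> real"
  assumes H: "H1_grad U u g" and U: "open U" "bounded U" and um: "u \<in> borel_measurable lebesgue"
    and \<psi>: "\<And>s. (\<psi> has_real_derivative \<psi>' s) (at s)"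
    and c: "continuous_on UNIV \<psi>'" and b: "\<And>s. 0 \<le> \<psi>' s" "\<And>s. \<psi>' s \<le> M" and B: "\<And>s. \<bar>\<psi> s\<bar> \<le> N"
    and X: "C1c X" "supp X \<subseteq> U" "\<And>x. norm (X x) \<le> 1"
  shows "integrable lebesgue (\<lambda>y. indicator U y * \<psi>' (u y) * norm (g y))"
    and "(LINT y|lebesgue. \<psi> (u y) * div_field X y) \<le> (LINT y|lebesgue. indicator U y * \<psi>' (u y) * norm (g y))"
proof -
  have iU: "integrable lebesgue (indicator U :: 'a \<Rightarrow> real)" by (rule integrable_indicator_bounded_lebesgue[OF U])
  have [measurable]: "U \<in> sets lebesgue" using U(1) by simp
  have [measurable]: "u \<in> borel_measurable lebesgue" by (rule um)
  have \<psi>c: "continuous_on UNIV \<psi>" using \<psi> DERIV_isCont by (intro continuous_at_imp_continuous_on) blast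
  have [measurable]: "\<psi> \<in> borel_measurable borel" "\<psi>' \<in> borel_measurable borel"
    using \<psi>c c by (auto intro!: borel_measurable_continuous_onI)
  have ig: "integrable lebesgue (\<lambda>y. indicator U y * norm (g y))" by (rule H1_grad_integrable(2)[OF H U])
  have igi: "integrable lebesgue (\<lambda>y. indicator U y * (g y \<bullet> i))" for i by (rule H1_grad_integrable(3)[OF H U])
  have bound: "integrable lebesgue (\<lambda>y. \<psi>' (u y) * f y)" if f: "integrable lebesgue f" for f
  proof (rule Bochner_Integration.integrable_bound[OF integrable_mult_right[OF f, of M]])
    show "AE x in lebesgue. norm (\<psi>' (u x) * f x) \<le> norm (M * f x)"
      using b order_trans[OF b(1) b(2)] by (intro AE_I2) (auto simp: abs_mult intro!: mult_right_mono)
  qed (use borel_measurable_integrable[OF f] in measurable)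
  show i1: "integrable lebesgue (\<lambda>y. indicator U y * \<psi>' (u y) * norm (g y))"
    using bound[OF ig] by (simp add: mult_ac)
  have Xm: "(\<lambda>x. X x \<bullet> i) \<in> borel_measurable lebesgue" for i
    using borel_measurable_continuous_onI[OF C1c_continuous[OF C1c_inner(1)[OF X(1)]]] measurable_borel_lebesgue by blast
  have i2: "integrable lebesgue (\<lambda>y. indicator U y * (\<psi>' (u y) * (g y \<bullet> i) * (X y \<bullet> i)))" for i
  proof -
    have "integrable lebesgue (\<lambda>y. (indicator U y * (g y \<bullet> i)) * (X y \<bullet> i))"
    proof (rule Bochner_Integration.integrable_bound[OF integrable_mult_right[OF igi, of "norm i"]])
      show "(\<lambda>y. (indicator U y * (g y \<bullet> i)) * (X y \<bullet> i)) \<in> borel_measurable lebesgue"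
        using borel_measurable_integrable[OF igi] Xm by measurable
      show "AE x in lebesgue. norm (indicator U x * (g x \<bullet> i) * (X x \<bullet> i)) \<le> norm (norm i * (indicator U x * (g x \<bullet> i)))"
      proof (rule AE_I2)
        fix x
        have "\<bar>X x \<bullet> i\<bar> \<le> norm (X x) * norm i" by (rule Cauchy_Schwarz_ineq2)
        also have "\<dots> \<le> 1 * norm i" by (intro mult_right_mono X(3)) simp
        finally have "\<bar>indicator U x * (g x \<bullet> i)\<bar> * \<bar>X x \<bullet> i\<bar> \<le> \<bar>indicator U x * (g x \<bullet> i)\<bar> * norm i"
          by (intro mult_left_mono) auto
        then show "norm (indicator U x * (g x \<bullet> i) * (X x \<bullet> i)) \<le> norm (norm i * (indicator U x * (g x \<bullet> i)))"
          by (simp add: abs_mult mult_ac)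
      qed
    qed
    from bound[OF this] show ?thesis by (simp add: mult_ac)
  qed
  have Dm: "(\<lambda>x. frechet_derivative X (at x) i \<bullet> i) \<in> borel_measurable lebesgue" if "i \<in> Basis" for i
    using borel_measurable_continuous_onI[OF C1c_continuous_partial[OF C1c_inner(1)[OF X(1)] that]]
    by (auto simp: C1c_inner(2)[OF X(1)] intro: measurable_borel_lebesgue)
  have i3: "integrable lebesgue (\<lambda>y. indicator U y * (\<psi> (u y) * (frechet_derivative X (at y) i \<bullet> i)))" if i: "i \<in> Basis" for i
  proof -
    obtain K where K: "\<And>x h. \<bar>frechet_derivative (\<lambda>x. X x \<bullet> i) (at x) h\<bar> \<le> K * norm h"
      using C1c_derivative_bounded[OF C1c_inner(1)[OF X(1)]] by (metis real_norm_def)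
    show ?thesis
    proof (rule Bochner_Integration.integrable_bound[OF integrable_mult_right[OF iU, of "N * K"]])
      show "(\<lambda>y. indicator U y * (\<psi> (u y) * (frechet_derivative X (at y) i \<bullet> i))) \<in> borel_measurable lebesgue"
        using Dm[OF i] by measurable
      have "\<bar>\<psi> (u x) * (frechet_derivative X (at x) i \<bullet> i)\<bar> \<le> N * K" for x
        unfolding abs_mult
        using B K[of x i] i order_trans[OF abs_ge_zero B]
        by (intro mult_mono) (auto simp: C1c_inner(2)[OF X(1)])
      then show "AE x in lebesgue. norm (indicator U x * (\<psi> (u x) * (frechet_derivative X (at x) i \<bullet> i))) \<le> norm (N * K * indicator U x)"
        by (intro AE_I2) (auto simp: indicator_def abs_mult[symmetric] intro: order_trans[OF _ abs_ge_self])
    qed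
  qed
  have "(LINT y|lebesgue. \<psi> (u y) * div_field X y) = (LINT y|lebesgue. (\<Sum>i\<in>Basis. indicator U y * (\<psi> (u y) * (frechet_derivative X (at y) i \<bullet> i))))"
  proof (rule Bochner_Integration.integral_cong[OF refl])
    fix y
    show "\<psi> (u y) * div_field X y = (\<Sum>i\<in>Basis. indicator U y * (\<psi> (u y) * (frechet_derivative X (at y) i \<bullet> i)))"
    proof (cases "y \<in> U")
      case True then show ?thesis by (simp add: div_field_def sum_distrib_left)
    next
      case False then show ?thesis using X(2) div_field_zero[of y X] by auto
    qed
  qed
  also have "\<dots> = (\<Sum>i\<in>Basis. LINT y|lebesgue. indicator U y * (\<psi> (u y) * (frechet_derivative X (at y) i \<bullet> i)))"
    by (rule Bochner_Integration.integral_sum) (rule i3)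
  also have "\<dots> = (\<Sum>i\<in>Basis. - (LINT y|lebesgue. indicator U y * (\<psi>' (u y) * (g y \<bullet> i) * (X y \<bullet> i))))"
  proof (rule sum.cong[OF refl])
    fix i :: 'a assume i: "i \<in> Basis"
    have "\<bar>\<psi>' s\<bar> \<le> M" for s using b[of s] by simp
    from weak_chain_rule[OF H U i \<psi> c this C1c_inner(1)[OF X(1)]] C1c_inner(3)[OF X(1), of i] X(2)
    show "(LINT y|lebesgue. indicator U y * (\<psi> (u y) * (frechet_derivative X (at y) i \<bullet> i)))
      = - (LINT y|lebesgue. indicator U y * (\<psi>' (u y) * (g y \<bullet> i) * (X y \<bullet> i)))"
      by (auto simp: set_lebesgue_integral_def C1c_inner(2)[OF X(1)])
  qed
  also have "\<dots> = (LINT y|lebesgue. - (\<Sum>i\<in>Basis. indicator U y * (\<psi>' (u y) * (g y \<bullet> i) * (X y \<bullet> i))))"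
    unfolding Bochner_Integration.integral_minus sum_negf
    by (subst Bochner_Integration.integral_sum) (use i2 in auto)
  also have "\<dots> \<le> (LINT y|lebesgue. indicator U y * \<psi>' (u y) * norm (g y))"
  proof (rule integral_mono[OF _ i1])
    show "integrable lebesgue (\<lambda>y. - (\<Sum>i\<in>Basis. indicator U y * (\<psi>' (u y) * (g y \<bullet> i) * (X y \<bullet> i))))"
      by (intro integrable_minus Bochner_Integration.integrable_sum i2)
    fix y
    have "\<bar>g y \<bullet> X y\<bar> \<le> norm (g y) * norm (X y)" by (rule Cauchy_Schwarz_ineq2)
    also have "\<dots> \<le> norm (g y) * 1" by (intro mult_left_mono X(3)) simp
    finally have "- (g y \<bullet> X y) \<le> norm (g y)" by linarith
    then have "indicator U y * \<psi>' (u y) * (- (g y \<bullet> X y)) \<le> indicator U y * \<psi>' (u y) * norm (g y)"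
      using b(1) by (intro mult_left_mono) auto
    moreover have "(\<Sum>i\<in>Basis. indicator U y * (\<psi>' (u y) * (g y \<bullet> i) * (X y \<bullet> i))) = indicator U y * \<psi>' (u y) * (g y \<bullet> X y)"
      by (subst euclidean_inner) (simp add: sum_distrib_left mult_ac)
    ultimately show "- (\<Sum>i\<in>Basis. indicator U y * (\<psi>' (u y) * (g y \<bullet> i) * (X y \<bullet> i))) \<le> indicator U y * \<psi>' (u y) * norm (g y)"
      by simp
  qed
  finally show "(LINT y|lebesgue. \<psi> (u y) * div_field X y) \<le> (LINT y|lebesgue. indicator U y * \<psi>' (u y) * norm (g y))" .
qed

text \<open>The Cauchy-Schwarz inequality, obtained by expanding
  \<open>(f x - c)\<^sup>2 \<ge> 0\<close> on \<open>U\<close> with \<open>c\<close> the mean of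
  \<open>f\<close> over \<open>U\<close>.\<close>

lemma background_lower_bound:
  fixes f :: "'a \<Rightarrow> real"
  assumes i: "integrable M f" "integrable M (\<lambda>x. (f x)\<^sup>2)" and f: "\<And>x. x \<notin> U \<Longrightarrow> f x = 0"
    and U: "integrable M (indicator U :: 'a \<Rightarrow> real)" and V: "(LINT x|M. indicator U x) = V" "V > 0"
  shows "(LINT x|M. f x)\<^sup>2 / V \<le> (LINT x|M. (f x)\<^sup>2)"
proof -
  define J where "J = (LINT x|M. f x)"
  define c where "c = J / V"
  have "2 * c * J - c\<^sup>2 * V = (LINT x|M. 2 * c * f x - c\<^sup>2 * indicator U x)"
    using i U V by (simp add: J_def)
  also have "\<dots> \<le> (LINT x|M. (f x)\<^sup>2)"
  proof (rule integral_mono)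
    fix x
    have "0 \<le> (f x - c)\<^sup>2" by simp
    then show "2 * c * f x - c\<^sup>2 * indicator U x \<le> (f x)\<^sup>2"
      using f[of x] by (cases "x \<in> U") (auto simp: power2_eq_square algebra_simps)
  qed (use i U in auto)
  finally show ?thesis using V by (simp add: c_def J_def power2_eq_square field_simps)
qed

text \<open>\<open>S\<close> is the mass of \<open>1 + u\<close> where \<open>u > - b\<close>, so
  the mass constraint leaves exactly \<open>\<phi> * V - S\<close> to the background, and its
  quadratic cost is bounded below through its mean. The density term of the pointwise estimate
  becomes the divergence pairing.\<close>

lemma energy_lower_bound:
  fixes u :: "'a::euclidean_space \<Rightarrow> real" and \<phi> L :: real
  defines "U \<equiv> interior (Omega \<phi> L) :: 'a set" and "V \<equiv> (\<phi> * L) ^ DIM('a)"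
  assumes a: "admissible \<phi> L u" and um: "u \<in> borel_measurable lebesgue" and pos: "\<phi> > 0" "L > 0"
    and E: "E_phiL \<phi> L u \<le> ereal M" and b: "0 < b" "b < 1"
    and X: "C1c X" "supp X \<subseteq> U" "\<And>x. norm (X x) \<le> 1"
    and S: "S = (LINT x|lebesgue. indicator U x * (if - b < u x then 1 + u x else 0))"
  shows "(LINT y|lebesgue. mm_primitive b (u y) * div_field X y) + ((1 + b) / 2)\<^sup>2 * ((\<phi> * V - S)\<^sup>2 / (\<phi> * V))
      \<le> M + V * G (-1 + \<phi>) / \<phi>"
proof -
  obtain g where H: "H1_grad U u g" and i1: "integrable lebesgue (\<lambda>x. indicator U x * (norm (g x))\<^sup>2)"
    and i2: "integrable lebesgue (\<lambda>x. indicator U x * G (u x))"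
    and Eq: "E_phiL \<phi> L u = ereal (\<phi> / 2 * (LINT x|lebesgue. indicator U x * (norm (g x))\<^sup>2)
       + 1 / \<phi> * (LINT x|lebesgue. indicator U x * G (u x)) - V * G (-1 + \<phi>) / \<phi>)"
    and mass: "(LINT x|lebesgue. indicator U x * (1 + u x)) = \<phi> * V"
    using energy_expand[OF a um pos] unfolding U_def V_def by blast
  have oU: "open U" "bounded U" unfolding U_def using open_interior_Omega bounded_interior_Omega by auto
  have V: "V > 0" using pos by (simp add: V_def)
  have iU: "integrable lebesgue (indicator U :: 'a \<Rightarrow> real)" by (rule integrable_indicator_bounded_lebesgue[OF oU])
  have VU: "(LINT x|lebesgue. indicator U x) = V"
    using interior_Omega_measure[OF pos, where 'a='a] by (simp add: U_def V_def)
  have [measurable]: "U \<in> sets lebesgue" "u \<in> borel_measurable lebesgue" using oU um by auto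
  define lam where "lam = ((1 + b) / 2)\<^sup>2"
  have l0: "lam > 0" using b by (simp add: lam_def)
  define f where "f x = indicator U x * (if u x \<le> - b then 1 + u x else 0)" for x
  have iu: "integrable lebesgue (\<lambda>x. indicator U x * (1 + u x))"
    using H1_grad_integrable(1)[OF H oU] iU by (simp add: distrib_left)
  have if1: "integrable lebesgue f"
    unfolding f_def by (rule Bochner_Integration.integrable_bound[OF iu]) (auto simp: indicator_def)
  \<comment> \<open>The pointwise estimate with \<open>\<phi> = 1\<close> and zero gradient; it
    makes the background part square integrable, since the potential is integrable.\<close>
  have G_low: "lam * (1 + s)\<^sup>2 \<le> G s" if "s \<le> - b" for s
    using modica_mortola_pointwise[OF b, of 1 s 0] that mm_density_range(3)[OF b, of s] b by (simp add: lam_def)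
  have if2: "integrable lebesgue (\<lambda>x. (f x)\<^sup>2)"
  proof (rule Bochner_Integration.integrable_bound[OF integrable_mult_right[OF i2, of "1 / lam"]])
    show "AE x in lebesgue. norm ((f x)\<^sup>2) \<le> norm (1 / lam * (indicator U x * G (u x)))"
    proof (rule AE_I2)
      fix x
      show "norm ((f x)\<^sup>2) \<le> norm (1 / lam * (indicator U x * G (u x)))"
        using G_low[of "u x"] l0 G_nonneg[of "u x"] by (auto simp: f_def indicator_def field_simps)
    qed
  qed (auto simp: f_def)
  have iS: "integrable lebesgue (\<lambda>x. indicator U x * (if - b < u x then 1 + u x else 0))"
    by (rule Bochner_Integration.integrable_bound[OF iu]) (auto simp: indicator_def)
  have "(LINT x|lebesgue. f x) + S = (LINT x|lebesgue. f x + indicator U x * (if - b < u x then 1 + u x else 0))"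
    using if1 iS by (simp add: S)
  also have "\<dots> = \<phi> * V"
    unfolding mass[symmetric] by (intro Bochner_Integration.integral_cong refl) (auto simp: f_def)
  finally have fS: "(LINT x|lebesgue. f x) = \<phi> * V - S" by simp
  have q: "(\<phi> * V - S)\<^sup>2 / V \<le> (LINT x|lebesgue. (f x)\<^sup>2)"
    unfolding fS[symmetric] by (rule background_lower_bound[OF if1 if2 _ iU VU V]) (simp add: f_def)
  note ch = weak_chain_rule_div[OF H oU um mm_primitive_has_derivative[OF b(1)] mm_density_continuous
      mm_density_range(1,2)[OF b] mm_primitive_bounded[OF b] X]
  have "(LINT y|lebesgue. mm_primitive b (u y) * div_field X y) + lam / \<phi> * ((\<phi> * V - S)\<^sup>2 / V)
     \<le> (LINT y|lebesgue. indicator U y * mm_density b (u y) * norm (g y)) + lam / \<phi> * (LINT x|lebesgue. (f x)\<^sup>2)"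
    using ch(2) q l0 pos by (intro add_mono mult_left_mono) auto
  also have "\<dots> = (LINT y|lebesgue. indicator U y * mm_density b (u y) * norm (g y) + lam / \<phi> * (f y)\<^sup>2)"
    using ch(1) if2 by simp
  also have "\<dots> \<le> (LINT y|lebesgue. \<phi> / 2 * (indicator U y * (norm (g y))\<^sup>2) + 1 / \<phi> * (indicator U y * G (u y)))"
  proof (rule integral_mono)
    fix y
    show "indicator U y * mm_density b (u y) * norm (g y) + lam / \<phi> * (f y)\<^sup>2
      \<le> \<phi> / 2 * (indicator U y * (norm (g y))\<^sup>2) + 1 / \<phi> * (indicator U y * G (u y))"
      using modica_mortola_pointwise[OF b pos(1), of "u y" "norm (g y)"]
      by (cases "y \<in> U") (auto simp: f_def lam_def)
  qed (use ch(1) if2 i1 i2 in auto)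
  also have "\<dots> = \<phi> / 2 * (LINT y|lebesgue. indicator U y * (norm (g y))\<^sup>2) + 1 / \<phi> * (LINT y|lebesgue. indicator U y * G (u y))"
    using i1 i2 by simp
  also have "\<dots> \<le> M + V * G (-1 + \<phi>) / \<phi>" using E unfolding Eq by simp
  finally show ?thesis by (simp add: lam_def)
qed

subsection \<open>Sequences of bounded energy\<close>

lemma finite_energy_admissible:
  "E_phiL \<phi> L u \<le> ereal M \<Longrightarrow> admissible \<phi> L u"
  by (auto simp: E_phiL_def split: if_splits)

text \<open>Where \<open>u0 = 1\<close> the integrand \<open>|u0 + 1| powr p\<close> is at least 1,
  so the phase has finite measure.\<close>

lemma minus1_Lp_finite_phase:
  assumes p: "p > 1" and u0: "minus1_Lp p u0"
  shows "integrable lebesgue (indicator {x. u0 x = 1} :: 'a::euclidean_space \<Rightarrow> real)"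
    and "{x. u0 x = 1} \<in> sets lebesgue"
proof -
  have m[measurable]: "u0 \<in> borel_measurable lebesgue" using u0 by (simp add: minus1_Lp_def)
  have "{x \<in> space lebesgue. u0 x = 1} \<in> sets lebesgue" by measurable
  then show s: "{x. u0 x = 1} \<in> sets lebesgue" by simp
  have "integrable lebesgue (\<lambda>x. \<bar>u0 x + 1\<bar> powr p)"
    using u0 unfolding minus1_Lp_def by (intro integrableI_bounded) auto
  then show "integrable lebesgue (indicator {x. u0 x = 1} :: 'a \<Rightarrow> real)"
    by (rule Bochner_Integration.integrable_bound)
       (use s p in \<open>auto simp: indicator_def intro!: borel_measurable_indicator ge_one_powr_ge_zero\<close>)
qed

text \<open>Later \<open>s\<close> and \<open>t\<close> are the values of \<open>un\<close> and
  \<open>u0\<close>, and \<open>P\<close> is membership in the cube. The additive error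
  \<open>e\<close> is charged only where \<open>t = 1\<close>, a set of finite measure; elsewhere
  the error has to be bounded by the \<open>p\<close>-th power of the distance alone.\<close>

lemma phase_mass_pointwise:
  fixes s t e b p :: real
  assumes b: "0 < b" "b < 1" and e: "e > 0" and p: "p > 1" and t: "t = 1 \<or> t = -1" and out: "\<not> P \<Longrightarrow> s = -1"
  shows "\<bar>(if P \<and> - b < s then 1 + s else 0) - (1 + t)\<bar>
    \<le> e * (if t = 1 then 1 else 0) + (e powr (1 - p) + (1 - b) powr (1 - p) + 2) * \<bar>s - t\<bar> powr p"
proof -
  define \<delta> where "\<delta> = \<bar>s - t\<bar>"
  define lhs where "lhs = \<bar>(if P \<and> - b < s then 1 + s else 0) - (1 + t)\<bar>"
  define a1 where "a1 = e * (if t = 1 then 1 else 0)"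
  define a2 where "a2 = e powr (1 - p) * \<delta> powr p"
  define a3 where "a3 = (1 - b) powr (1 - p) * \<delta> powr p"
  define a4 where "a4 = 2 * \<delta> powr p"
  have nn: "0 \<le> a1" "0 \<le> a2" "0 \<le> a3" "0 \<le> a4" using e by (auto simp: a1_def a2_def a3_def a4_def)
  consider "P \<and> - b < s" "t = 1" | "P \<and> - b < s" "t = -1" | "\<not> (P \<and> - b < s)" "t = 1" | "\<not> (P \<and> - b < s)" "t = -1"
    using t by blast
  then have "lhs \<le> a1 + (a2 + a3 + a4)"
  proof cases
    case 1
    then have "lhs = \<delta>" "a1 = e" by (auto simp: lhs_def \<delta>_def a1_def)
    moreover have "\<delta> \<le> e + a2" unfolding a2_def by (rule young_cutoff[OF _ e p]) (simp add: \<delta>_def)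
    ultimately show ?thesis using nn by linarith
  next
    case 2
    \<comment> \<open>A point counted although its limit is \<open>-1\<close> deviates by at least
      \<open>1 - b\<close>, which converts \<open>\<delta>\<close> into a multiple of
      \<open>\<delta> powr p\<close>.\<close>
    have d: "lhs = \<delta>" "\<delta> \<ge> 1 - b" using 2 b by (auto simp: lhs_def \<delta>_def)
    have "\<delta> powr (1 - p) \<le> (1 - b) powr (1 - p)" using d b p by (intro powr_mono2') auto
    then have "\<delta> powr (1 - p) * \<delta> powr p \<le> a3" unfolding a3_def by (rule mult_right_mono) simp
    moreover have "\<delta> powr (1 - p) * \<delta> powr p = \<delta>" using d b by (simp add: powr_add[symmetric])
    ultimately show ?thesis using nn d by linarith
  next
    case 3
    then have "s \<le> - b" using out b by (cases P) auto
    then have "\<delta> \<ge> 1" using 3 b by (simp add: \<delta>_def)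
    then have "2 \<le> a4" using p by (simp add: ge_one_powr_ge_zero a4_def)
    moreover have "lhs = 2" using 3 by (auto simp: lhs_def)
    ultimately show ?thesis using nn by linarith
  next
    case 4
    then have "lhs = 0" by (auto simp: lhs_def)
    then show ?thesis using nn by linarith
  qed
  then show ?thesis by (simp add: lhs_def a1_def a2_def a3_def a4_def \<delta>_def distrib_right)
qed

text \<open>The factor \<open>c e\<close> may blow up as \<open>e\<close> tends to 0, so
  \<open>e\<close> is fixed first and \<open>n\<close> sent to infinity afterwards.\<close>

lemma tendsto_of_split_bound:
  fixes a d :: "nat \<Rightarrow> real"
  assumes A: "0 \<le> A" and d: "d \<longlonglongrightarrow> 0" and bound: "\<And>e n. e > 0 \<Longrightarrow> \<bar>a n - l\<bar> \<le> e * A + c e * d n"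
  shows "a \<longlonglongrightarrow> l"
proof (rule LIMSEQ_I)
  fix r :: real assume r: "r > 0"
  \<comment> \<open>\<open>A\<close> may be 0; adding 1 makes the division in \<open>e\<close>
    legitimate.\<close>
  define B where "B = A + 1"
  define e where "e = r / (2 * B)"
  have B: "B > 0" "A \<le> B" using A by (auto simp: B_def)
  then have e: "e > 0" using r by (simp add: e_def)
  then have "e * A \<le> e * B" using B by simp
  also have "\<dots> = r / 2" using B by (simp add: e_def)
  finally have eA: "e * A \<le> r / 2" .
  have "(\<lambda>n. c e * d n) \<longlonglongrightarrow> c e * 0" by (intro tendsto_intros d)
  then have "eventually (\<lambda>n. c e * d n < r / 2) sequentially" using r by (intro order_tendstoD(2)) auto
  then obtain N where N: "\<And>n. n \<ge> N \<Longrightarrow> c e * d n < r / 2" by (auto simp: eventually_sequentially)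
  show "\<exists>no. \<forall>n\<ge>no. norm (a n - l) < r"
  proof (intro exI allI impI)
    fix n assume "n \<ge> N"
    from N[OF this] bound[OF e, of n] eA show "norm (a n - l) < r" unfolding real_norm_def by linarith
  qed
qed

text \<open>\<open>M\<close> is any uniform energy bound. It is later taken strictly between the
  lower limit of the energies and the limit energy, along a subsequence, in order to reach a
  contradiction.\<close>

locale bounded_energy =
  fixes p m M :: real and \<phi> L :: "nat \<Rightarrow> real" and un :: "nat \<Rightarrow> 'a::euclidean_space \<Rightarrow> real" and u0 :: "'a \<Rightarrow> real"
  assumes p: "1 < p" and pos: "\<And>n. \<phi> n > 0" "\<And>n. L n > 0" and \<phi>0: "\<phi> \<longlonglongrightarrow> 0"
    and big: "filterlim (\<lambda>n. \<phi> n * L n) at_top sequentially"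
    and mass: "(\<lambda>n. \<phi> n * (\<phi> n * L n) ^ DIM('a)) \<longlonglongrightarrow> m" and m0: "m > 0"
    and un: "\<And>n. minus1_Lp p (un n)" and u0: "minus1_Lp p u0" and conv: "Lp_conv p un u0"
    and E: "\<And>n. E_phiL (\<phi> n) (L n) (un n) \<le> ereal M"
begin

definition U where "U n = (interior (Omega (\<phi> n) (L n)) :: 'a set)"
definition V where "V n = (\<phi> n * L n) ^ DIM('a)"
definition dist_p where "dist_p n = (LINT x|lebesgue. \<bar>un n x - u0 x\<bar> powr p)"

lemma measurable_un: "un n \<in> borel_measurable lebesgue" "u0 \<in> borel_measurable lebesgue"
  using un u0 by (auto simp: minus1_Lp_def)

lemma dist_p: "integrable lebesgue (\<lambda>x. \<bar>un n x - u0 x\<bar> powr p)" "dist_p \<longlonglongrightarrow> 0"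
  using Lp_conv_integrals[OF p un u0 conv] unfolding dist_p_def[abs_def] by auto

lemma adm: "admissible (\<phi> n) (L n) (un n)"
  using E finite_energy_admissible by blast

text \<open>\<open>G (-1 + \<phi>)\<close> equals
  \<open>\<phi>\<^sup>2 * (2 - \<phi>)\<^sup>2 / 4\<close>, so the subtracted constant is
  \<open>\<phi> * V\<close> up to a factor tending to 1.\<close>

lemma energy_constant: "(\<lambda>n. V n * G (-1 + \<phi> n) / \<phi> n) \<longlonglongrightarrow> m"
proof -
  have "(\<lambda>n. \<phi> n * V n * ((2 - \<phi> n)\<^sup>2 / 4)) \<longlonglongrightarrow> m * ((2 - 0)\<^sup>2 / 4)"
    unfolding V_def by (intro tendsto_intros mass \<phi>0) auto
  moreover have "V n * G (-1 + \<phi> n) / \<phi> n = \<phi> n * V n * ((2 - \<phi> n)\<^sup>2 / 4)" for n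
    using pos(1)[of n] by (simp add: G_def power2_eq_square field_simps)
  ultimately show ?thesis by (simp only:) simp
qed

lemma eventually_in_U: "bounded K \<Longrightarrow> eventually (\<lambda>n. K \<subseteq> U n) sequentially"
proof -
  assume "bounded K"
  then obtain r where r: "K \<subseteq> cball 0 r" using bounded_subset_ballD[of K 0] ball_subset_cball by blast
  have "eventually (\<lambda>n. 2 * r < \<phi> n * L n) sequentially"
    using big by (simp add: filterlim_at_top_dense)
  then show ?thesis
  proof eventually_elim
    case (elim n)
    then have "cball 0 r \<subseteq> U n" unfolding U_def by (intro ball_subset_Omega) simp
    then show ?case using r by blast
  qed
qed

text \<open>The potential term is at most \<open>\<phi>\<close> times a convergent sequence and
  therefore tends to 0. After two successive extractions both \<open>un\<close> and the potential
  converge almost everywhere; every point eventually lies in the growing cubes, and continuity of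
  \<open>G\<close> forces \<open>G (u0 x) = 0\<close>.\<close>

lemma phases: "AE x in lebesgue. u0 x = 1 \<or> u0 x = -1"
proof -
  have "\<forall>n. \<exists>g::'a \<Rightarrow> 'a. integrable lebesgue (\<lambda>x. indicator (U n) x * G (un n x))
     \<and> E_phiL (\<phi> n) (L n) (un n) = ereal (\<phi> n / 2 * (LINT x|lebesgue. indicator (U n) x * (norm (g x))\<^sup>2)
       + 1 / \<phi> n * (LINT x|lebesgue. indicator (U n) x * G (un n x)) - V n * G (-1 + \<phi> n) / \<phi> n)"
  proof
    fix n
    obtain g :: "'a \<Rightarrow> 'a" where "integrable lebesgue (\<lambda>x. indicator (interior (Omega (\<phi> n) (L n))) x * G (un n x))"
      "E_phiL (\<phi> n) (L n) (un n) = ereal (\<phi> n / 2 * (LINT x|lebesgue. indicator (interior (Omega (\<phi> n) (L n))) x * (norm (g x))\<^sup>2)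
       + 1 / \<phi> n * (LINT x|lebesgue. indicator (interior (Omega (\<phi> n) (L n))) x * G (un n x))
       - (\<phi> n * L n) ^ DIM('a) * G (-1 + \<phi> n) / \<phi> n)"
      by (rule energy_expand[OF adm[of n] measurable_un(1)[of n] pos(1)[of n] pos(2)[of n]]) (rule that)
    then show "\<exists>g::'a \<Rightarrow> 'a. integrable lebesgue (\<lambda>x. indicator (U n) x * G (un n x))
     \<and> E_phiL (\<phi> n) (L n) (un n) = ereal (\<phi> n / 2 * (LINT x|lebesgue. indicator (U n) x * (norm (g x))\<^sup>2)
       + 1 / \<phi> n * (LINT x|lebesgue. indicator (U n) x * G (un n x)) - V n * G (-1 + \<phi> n) / \<phi> n)"
      unfolding U_def V_def by (intro exI conjI)
  qed
  from choice[OF this] obtain g :: "nat \<Rightarrow> 'a \<Rightarrow> 'a" where g: "\<forall>n. integrable lebesgue (\<lambda>x. indicator (U n) x * G (un n x))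
     \<and> E_phiL (\<phi> n) (L n) (un n) = ereal (\<phi> n / 2 * (LINT x|lebesgue. indicator (U n) x * (norm (g n x))\<^sup>2)
       + 1 / \<phi> n * (LINT x|lebesgue. indicator (U n) x * G (un n x)) - V n * G (-1 + \<phi> n) / \<phi> n)" ..
  have i2: "integrable lebesgue (\<lambda>x. indicator (U n) x * G (un n x))" for n using g by simp
  have e: "E_phiL (\<phi> n) (L n) (un n) = ereal (\<phi> n / 2 * (LINT x|lebesgue. indicator (U n) x * (norm (g n x))\<^sup>2)
       + 1 / \<phi> n * (LINT x|lebesgue. indicator (U n) x * G (un n x)) - V n * G (-1 + \<phi> n) / \<phi> n)" for n
    using g by simp
  define I where "I n = (LINT x|lebesgue. indicator (U n) x * G (un n x))" for n
  have I0: "0 \<le> I n" for n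
    unfolding I_def by (intro Bochner_Integration.integral_nonneg) (simp add: G_nonneg)
  have Ib: "I n \<le> \<phi> n * (M + V n * G (-1 + \<phi> n) / \<phi> n)" for n
  proof -
    have "0 \<le> \<phi> n / 2 * (LINT x|lebesgue. indicator (U n) x * (norm (g n x))\<^sup>2)"
      using pos(1)[of n] by (intro mult_nonneg_nonneg Bochner_Integration.integral_nonneg) auto
    then have "1 / \<phi> n * I n \<le> M + V n * G (-1 + \<phi> n) / \<phi> n"
      using E[of n] unfolding e I_def by simp
    from mult_left_mono[OF this, of "\<phi> n"] pos(1)[of n]
    have "\<phi> n * (1 / \<phi> n * I n) \<le> \<phi> n * (M + V n * G (-1 + \<phi> n) / \<phi> n)" by simp
    moreover have "\<phi> n * (1 / \<phi> n * I n) = I n" using pos(1)[of n] by simp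
    ultimately show ?thesis by simp
  qed
  have "(\<lambda>n. \<phi> n * (M + V n * G (-1 + \<phi> n) / \<phi> n)) \<longlonglongrightarrow> 0 * (M + m)"
    by (intro tendsto_mult tendsto_add tendsto_const \<phi>0 energy_constant)
  then have g0: "(\<lambda>n. \<phi> n * (M + V n * G (-1 + \<phi> n) / \<phi> n)) \<longlonglongrightarrow> 0" by simp
  have "I \<longlonglongrightarrow> 0"
    by (rule Lim_null_comparison[OF always_eventually g0]) (use I0 Ib in \<open>simp add: abs_of_nonneg\<close>)
  obtain r where r: "strict_mono r" "AE x in lebesgue. (\<lambda>n. \<bar>un (r n) x - u0 x\<bar> powr p) \<longlonglongrightarrow> 0"
    using tendsto_L1_AE_subseq[of lebesgue "\<lambda>n x. \<bar>un n x - u0 x\<bar> powr p"] dist_p unfolding dist_p_def[abs_def] by auto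
  have "(\<lambda>n. I (r n)) \<longlonglongrightarrow> 0" using LIMSEQ_subseq_LIMSEQ[OF \<open>I \<longlonglongrightarrow> 0\<close> r(1)] by (simp add: o_def)
  then obtain r' where r': "strict_mono r'" "AE x in lebesgue. (\<lambda>n. indicator (U (r (r' n))) x * G (un (r (r' n)) x)) \<longlonglongrightarrow> 0"
    using tendsto_L1_AE_subseq[of lebesgue "\<lambda>n x. indicator (U (r n)) x * G (un (r n) x)"] i2
    unfolding I_def by (auto simp: G_nonneg)
  show ?thesis using r(2) r'(2)
  proof eventually_elim
    case (elim x)
    define q where "q n = un (r (r' n)) x" for n
    have "(\<lambda>n. \<bar>q n - u0 x\<bar> powr p) \<longlonglongrightarrow> 0"
      using LIMSEQ_subseq_LIMSEQ[OF elim(1) r'(1)] by (simp add: o_def q_def)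
    then have "(\<lambda>n. (\<bar>q n - u0 x\<bar> powr p) powr (1 / p)) \<longlonglongrightarrow> 0 powr (1 / p)"
      by (rule tendsto_powr'[OF _ tendsto_const]) (use p in auto)
    then have "(\<lambda>n. \<bar>q n - u0 x\<bar>) \<longlonglongrightarrow> 0" using p by (simp add: powr_powr)
    then have q: "q \<longlonglongrightarrow> u0 x" by (simp add: tendsto_rabs_zero_iff LIM_zero_iff)
    have "isCont G (u0 x)" unfolding G_def[abs_def] by (intro continuous_intros) auto
    then have lim: "(\<lambda>n. G (q n)) \<longlonglongrightarrow> G (u0 x)" by (rule isCont_tendsto_compose[OF _ q])
    have "eventually (\<lambda>n. {x} \<subseteq> U n) sequentially" by (rule eventually_in_U) simp
    then have "eventually (\<lambda>n. x \<in> U (r (r' n))) sequentially"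
      using eventually_subseq[OF strict_mono_o[OF r(1) r'(1)]] by (simp add: o_def)
    then have "eventually (\<lambda>n. indicator (U (r (r' n))) x * G (q n) = G (q n)) sequentially"
      by eventually_elim simp
    then have "(\<lambda>n. G (q n)) \<longlonglongrightarrow> 0" using elim(2) unfolding q_def[symmetric]
      by (rule Lim_transform_eventually[rotated])
    then have "G (u0 x) = 0" using lim LIMSEQ_unique by blast
    then have "(u0 x)\<^sup>2 = 1" by (simp add: G_def)
    then show ?case by (simp add: power2_eq_1_iff)
  qed
qed

definition C where "C = {x. u0 x = 1}"

lemma C_props: "integrable lebesgue (indicator C :: 'a \<Rightarrow> real)" "C \<in> sets lebesgue"
  using minus1_Lp_finite_phase[OF p u0] by (auto simp: C_def)

definition S where "S b n = (LINT x|lebesgue. indicator (U n) x * (if - b < un n x then 1 + un n x else 0))"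

lemma S_lim:
  assumes b: "0 < b" "b < 1"
  shows "S b \<longlonglongrightarrow> 2 * measure lebesgue C"
proof -
  have bound: "\<bar>S b n - 2 * measure lebesgue C\<bar> \<le> e * measure lebesgue C + (e powr (1 - p) + (1 - b) powr (1 - p) + 2) * dist_p n"
    if e: "e > 0" for e n
  proof -
    let ?c = "e powr (1 - p) + (1 - b) powr (1 - p) + 2"
    let ?f = "\<lambda>x. indicator (U n) x * (if - b < un n x then 1 + un n x else 0)"
    have [measurable]: "un n \<in> borel_measurable lebesgue" "U n \<in> sets lebesgue" "C \<in> sets lebesgue"
      using measurable_un C_props by (auto simp: U_def)
    have iC: "integrable lebesgue (indicator C :: 'a \<Rightarrow> real)" by (rule C_props)
    have out: "AE x in lebesgue. x \<notin> U n \<longrightarrow> un n x = -1"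
      using adm[of n] Omega_AE[of "\<phi> n" "L n", where 'a='a] unfolding admissible_def U_def
      by (auto elim!: eventually_elim2)
    have pt: "AE x in lebesgue. \<bar>?f x - 2 * indicator C x\<bar> \<le> e * indicator C x + ?c * \<bar>un n x - u0 x\<bar> powr p"
      using phases out
    proof eventually_elim
      case (elim x)
      have "?f x = (if x \<in> U n \<and> - b < un n x then 1 + un n x else 0)" by simp
      moreover have "2 * indicator C x = 1 + u0 x" "indicator C x = (if u0 x = 1 then 1 else (0::real))"
        using elim(1) by (auto simp: C_def)
      ultimately show ?case
        using phase_mass_pointwise[OF b e p elim(1), of "x \<in> U n" "un n x"] elim(2) by simp
    qed
    have ib: "integrable lebesgue (\<lambda>x. e * indicator C x + ?c * \<bar>un n x - u0 x\<bar> powr p)"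
      using iC dist_p(1) by (intro Bochner_Integration.integrable_add integrable_mult_right)
    have id: "integrable lebesgue (\<lambda>x. ?f x - 2 * indicator C x)"
    proof (rule Bochner_Integration.integrable_bound[OF ib])
      show "AE x in lebesgue. norm (?f x - 2 * indicator C x) \<le> norm (e * indicator C x + ?c * \<bar>un n x - u0 x\<bar> powr p)"
        using pt by eventually_elim simp
    qed measurable
    have i2C: "integrable lebesgue (\<lambda>x. 2 * indicator C x :: real)" using iC by simp
    have eq: "S b n - 2 * measure lebesgue C = (LINT x|lebesgue. ?f x - 2 * indicator C x)"
    proof -
      have "integrable lebesgue ?f" using Bochner_Integration.integrable_add[OF id i2C] by simp
      then show ?thesis using iC by (simp add: S_def)
    qed
    have "\<bar>S b n - 2 * measure lebesgue C\<bar> \<le> (LINT x|lebesgue. \<bar>?f x - 2 * indicator C x\<bar>)"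
      unfolding eq by (rule integral_abs_bound)
    also have "\<dots> \<le> (LINT x|lebesgue. e * indicator C x + ?c * \<bar>un n x - u0 x\<bar> powr p)"
      by (rule integral_mono_AE[OF integrable_abs[OF id] ib pt])
    also have "\<dots> = e * measure lebesgue C + ?c * dist_p n"
      using iC dist_p(1)[of n] by (simp add: dist_p_def)
    finally show ?thesis .
  qed
  show ?thesis
    by (rule tendsto_of_split_bound[OF measure_nonneg dist_p(2) bound])
qed

text \<open>The divergence of a test field is both integrable and bounded, so it can pay for the
  additive term of \<open>young_cutoff\<close> and for the \<open>p\<close>-th power term. In the
  limit the primitive takes only two values, 0 and \<open>c0 * b ^ 3\<close>.\<close>

lemma primitive_lim:
  assumes b: "0 < b" "b < 1" and X: "C1c X"
  shows "(\<lambda>n. LINT y|lebesgue. mm_primitive b (un n y) * div_field X y)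
     \<longlonglongrightarrow> c0 * b ^ 3 * (LINT x:C|lebesgue. div_field X x)"
proof -
  obtain B where B: "B > 0" "\<And>x. \<bar>div_field X x\<bar> \<le> B" "integrable lborel (div_field X)"
    using div_field_bounded_integrable[OF X] by metis
  have iD: "integrable lebesgue (div_field X)" using B(3) by (simp add: integrable_completion)
  have [measurable]: "div_field X \<in> borel_measurable lebesgue" using iD by (rule borel_measurable_integrable)
  have [measurable]: "u0 \<in> borel_measurable lebesgue" "un n \<in> borel_measurable lebesgue" for n using measurable_un by auto
  have "continuous_on UNIV (mm_primitive b)"
    using mm_primitive_has_derivative[OF b(1)] DERIV_isCont by (intro continuous_at_imp_continuous_on) blast
  then have [measurable]: "mm_primitive b \<in> borel_measurable borel" by (rule borel_measurable_continuous_onI)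
  have i: "integrable lebesgue (\<lambda>y. mm_primitive b (u y) * div_field X y)" if [measurable]: "u \<in> borel_measurable lebesgue" for u :: "'a \<Rightarrow> real"
    by (rule Bochner_Integration.integrable_bound[OF integrable_mult_right[OF iD, of 2]])
       (use mm_primitive_bounded[OF b] in \<open>auto simp: abs_mult intro!: AE_I2 mult_right_mono\<close>)
  have lim: "c0 * b ^ 3 * (LINT x:C|lebesgue. div_field X x) = (LINT y|lebesgue. mm_primitive b (u0 y) * div_field X y)"
    unfolding set_lebesgue_integral_def integral_mult_right_zero[symmetric]
  proof (rule integral_cong_AE)
    show "AE x in lebesgue. c0 * b ^ 3 * (indicator C x *\<^sub>R div_field X x) = mm_primitive b (u0 x) * div_field X x"
      using phases by eventually_elim (auto simp: C_def mm_primitive_values[OF b])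
  qed (use C_props in measurable)
  have bound: "\<bar>(LINT y|lebesgue. mm_primitive b (un n y) * div_field X y) - (LINT y|lebesgue. mm_primitive b (u0 y) * div_field X y)\<bar>
     \<le> e * (LINT y|lebesgue. \<bar>div_field X y\<bar>) + e powr (1 - p) * B * dist_p n" if e: "e > 0" for e n
  proof -
    have "\<bar>(LINT y|lebesgue. mm_primitive b (un n y) * div_field X y) - (LINT y|lebesgue. mm_primitive b (u0 y) * div_field X y)\<bar>
       = \<bar>LINT y|lebesgue. mm_primitive b (un n y) * div_field X y - mm_primitive b (u0 y) * div_field X y\<bar>"
      using i by simp
    also have "\<dots> \<le> (LINT y|lebesgue. \<bar>mm_primitive b (un n y) * div_field X y - mm_primitive b (u0 y) * div_field X y\<bar>)"
      by (rule integral_abs_bound)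
    also have "\<dots> \<le> (LINT y|lebesgue. e * \<bar>div_field X y\<bar> + e powr (1 - p) * B * \<bar>un n y - u0 y\<bar> powr p)"
    proof (rule integral_mono)
      show "integrable lebesgue (\<lambda>y. \<bar>mm_primitive b (un n y) * div_field X y - mm_primitive b (u0 y) * div_field X y\<bar>)"
        by (intro integrable_abs Bochner_Integration.integrable_diff i) measurable
      show "integrable lebesgue (\<lambda>y. e * \<bar>div_field X y\<bar> + e powr (1 - p) * B * \<bar>un n y - u0 y\<bar> powr p)"
        by (intro Bochner_Integration.integrable_add integrable_mult_right integrable_abs iD dist_p)
      fix y
      have "\<bar>mm_primitive b (un n y) - mm_primitive b (u0 y)\<bar> \<le> e + e powr (1 - p) * \<bar>un n y - u0 y\<bar> powr p"
        using mm_primitive_lipschitz[OF b] young_cutoff[OF abs_ge_zero e p] order_trans by blast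
      then have "\<bar>mm_primitive b (un n y) - mm_primitive b (u0 y)\<bar> * \<bar>div_field X y\<bar>
         \<le> (e + e powr (1 - p) * \<bar>un n y - u0 y\<bar> powr p) * \<bar>div_field X y\<bar>" by (rule mult_right_mono) simp
      also have "\<dots> \<le> e * \<bar>div_field X y\<bar> + e powr (1 - p) * \<bar>un n y - u0 y\<bar> powr p * B"
        unfolding distrib_right using B(2)[of y] e by (intro add_mono mult_left_mono) auto
      finally show "\<bar>mm_primitive b (un n y) * div_field X y - mm_primitive b (u0 y) * div_field X y\<bar>
         \<le> e * \<bar>div_field X y\<bar> + e powr (1 - p) * B * \<bar>un n y - u0 y\<bar> powr p"
        unfolding left_diff_distrib[symmetric] by (simp add: abs_mult mult_ac)
    qed
    also have "\<dots> = e * (LINT y|lebesgue. \<bar>div_field X y\<bar>) + e powr (1 - p) * B * dist_p n"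
      using iD dist_p(1)[of n] by (simp add: dist_p_def)
    finally show ?thesis .
  qed
  show ?thesis unfolding lim
    by (rule tendsto_of_split_bound[OF _ dist_p(2) bound]) auto
qed

text \<open>The support of \<open>X\<close> is eventually contained in the cubes, so the estimate
  for a single energy holds for all large \<open>n\<close>, and every term of it converges.\<close>

lemma limit_inequality:
  assumes b: "0 < b" "b < 1" and X: "C1c X" "\<And>x. norm (X x) \<le> 1"
  shows "c0 * b ^ 3 * (LINT x:C|lebesgue. div_field X x) + ((1 + b) / 2)\<^sup>2 * ((m - 2 * measure lebesgue C)\<^sup>2 / m) \<le> M + m"
proof (rule tendsto_le[OF sequentially_bot])
  show "(\<lambda>n. (LINT y|lebesgue. mm_primitive b (un n y) * div_field X y) + ((1 + b) / 2)\<^sup>2 * ((\<phi> n * V n - S b n)\<^sup>2 / (\<phi> n * V n)))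
     \<longlonglongrightarrow> c0 * b ^ 3 * (LINT x:C|lebesgue. div_field X x) + ((1 + b) / 2)\<^sup>2 * ((m - 2 * measure lebesgue C)\<^sup>2 / m)"
    unfolding V_def by (intro tendsto_add primitive_lim[OF b X(1)] tendsto_mult tendsto_const tendsto_divide tendsto_power tendsto_diff mass S_lim[OF b])
       (use m0 in auto)
  show "(\<lambda>n. M + V n * G (-1 + \<phi> n) / \<phi> n) \<longlonglongrightarrow> M + m"
    by (intro tendsto_intros energy_constant)
  have "bounded (supp X)" using X(1) compact_imp_bounded by (auto simp: C1c_def)
  from eventually_in_U[OF this]
  show "eventually (\<lambda>n. (LINT y|lebesgue. mm_primitive b (un n y) * div_field X y) + ((1 + b) / 2)\<^sup>2 * ((\<phi> n * V n - S b n)\<^sup>2 / (\<phi> n * V n))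
     \<le> M + V n * G (-1 + \<phi> n) / \<phi> n) sequentially"
  proof eventually_elim
    case (elim n)
    from energy_lower_bound[OF adm measurable_un(1) pos E b X(1) elim[unfolded U_def] X(2), of "S b n"]
    show ?case by (simp add: S_def U_def V_def)
  qed
qed

text \<open>The passage to the limit in \<open>n\<close> was made with \<open>b\<close> fixed; only
  now does \<open>b\<close> tend to 1, which restores the exact constants of both terms.\<close>

lemma limit_inequality_1:
  assumes X: "C1c X" "\<And>x. norm (X x) \<le> 1"
  shows "c0 * (LINT x:C|lebesgue. div_field X x) + (m - 2 * measure lebesgue C)\<^sup>2 / m \<le> M + m"
proof (rule tendsto_le[OF sequentially_bot])
  \<comment> \<open>The shift by two keeps \<open>b n\<close> strictly between 0 and 1 from
    \<open>n = 0\<close> on.\<close>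
  define b where "b n = 1 - 1 / real (Suc (Suc n))" for n
  have b: "0 < b n" "b n < 1" for n by (auto simp: b_def field_simps)
  have "b \<longlonglongrightarrow> 1 - 0"
    unfolding b_def by (intro tendsto_diff tendsto_const LIMSEQ_Suc[OF LIMSEQ_Suc[OF lim_1_over_n]])
  then have "b \<longlonglongrightarrow> 1" by simp
  then have "(\<lambda>n. c0 * b n ^ 3 * (LINT x:C|lebesgue. div_field X x) + ((1 + b n) / 2)\<^sup>2 * ((m - 2 * measure lebesgue C)\<^sup>2 / m))
     \<longlonglongrightarrow> c0 * 1 ^ 3 * (LINT x:C|lebesgue. div_field X x) + ((1 + 1) / 2)\<^sup>2 * ((m - 2 * measure lebesgue C)\<^sup>2 / m)"
    by (intro tendsto_intros) auto
  then show "(\<lambda>n. c0 * b n ^ 3 * (LINT x:C|lebesgue. div_field X x) + ((1 + b n) / 2)\<^sup>2 * ((m - 2 * measure lebesgue C)\<^sup>2 / m))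
     \<longlonglongrightarrow> c0 * (LINT x:C|lebesgue. div_field X x) + (m - 2 * measure lebesgue C)\<^sup>2 / m" by simp
  show "(\<lambda>n. M + m) \<longlonglongrightarrow> M + m" by simp
  show "eventually (\<lambda>n. c0 * b n ^ 3 * (LINT x:C|lebesgue. div_field X x) + ((1 + b n) / 2)\<^sup>2 * ((m - 2 * measure lebesgue C)\<^sup>2 / m) \<le> M + m) sequentially"
    using limit_inequality[OF b X] by simp
qed

text \<open>The bound does not depend on the test field, so it passes to the supremum. In particular
  the limit phase has finite perimeter.\<close>

lemma Per_bound: "Per C \<le> ereal ((M + m - (m - 2 * measure lebesgue C)\<^sup>2 / m) / c0)"
  unfolding Per_def
proof (rule SUP_least)
  fix X :: "'a \<Rightarrow> 'a" assume X: "X \<in> {f. C1c f \<and> (\<forall>x. norm (f x) \<le> 1)}"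
  have "c0 > 0" by (simp add: c0_def)
  then have "(LINT x:C|lebesgue. div_field X x) \<le> (M + m - (m - 2 * measure lebesgue C)\<^sup>2 / m) / c0"
    using limit_inequality_1[of X] X by (simp add: field_simps)
  then show "ereal (LINT x:C|lebesgue. div_field X x) \<le> ereal ((M + m - (m - 2 * measure lebesgue C)\<^sup>2 / m) / c0)" by simp
qed

end

text \<open>The zero field competes in the supremum. This rules out the value minus infinity when a
  finite perimeter is written as a real number.\<close>

lemma Per_nonneg: "0 \<le> Per (C :: 'a::euclidean_space set)"
proof -
  have "C1c (\<lambda>_::'a. 0::'a)" by (rule C1cI[of _ "\<lambda>_ _. 0" 0]) auto
  moreover have "div_field (\<lambda>_::'a. 0::'a) = (\<lambda>_. 0)"
    by (rule ext) (simp add: div_field_def frechet_derivativeI[OF has_derivative_const])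
  ultimately show ?thesis
    unfolding Per_def by (intro SUP_upper2[of "\<lambda>_. 0"]) auto
qed

lemma liminf_core:
  fixes un :: "nat \<Rightarrow> 'a::euclidean_space \<Rightarrow> real"
  assumes p: "1 < p" and pos: "\<And>n. \<phi> n > 0" "\<And>n. L n > 0" and \<phi>0: "\<phi> \<longlonglongrightarrow> 0"
    and big: "filterlim (\<lambda>n. \<phi> n * L n) at_top sequentially"
    and mass: "(\<lambda>n. \<phi> n * (\<phi> n * L n) ^ DIM('a)) \<longlonglongrightarrow> \<xi> ^ (DIM('a) + 1)" and xi: "\<xi> > 0"
    and un: "\<And>n. minus1_Lp p (un n)" and u0: "minus1_Lp p u0" and conv: "Lp_conv p un u0"
    and E: "\<And>n. E_phiL (\<phi> n) (L n) (un n) \<le> ereal M"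
  shows "E0 \<xi> u0 \<le> ereal M"
proof -
  define m where "m = \<xi> ^ (DIM('a) + 1)"
  have m0: "m > 0" using xi by (simp add: m_def)
  let ?C = "{x. u0 x = 1}"
  interpret bounded_energy p m M \<phi> L un u0
    by unfold_locales (use assms m0 in \<open>auto simp: m_def\<close>)
  have PC: "Per ?C \<le> ereal ((M + m - (m - 2 * measure lebesgue ?C)\<^sup>2 / m) / c0)"
    using Per_bound unfolding C_def .
  then obtain P where P: "Per ?C = ereal P" using Per_nonneg[of ?C] by (cases "Per ?C") auto
  have "c0 > 0" by (simp add: c0_def)
  then have "c0 * P + (m - 2 * measure lebesgue ?C)\<^sup>2 / m - m \<le> M"
    using PC by (simp add: P field_simps)
  \<comment> \<open>Completing the square in \<open>|C|\<close>: the linear and the quadratic term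
    of \<open>E0\<close> are together a square minus \<open>m\<close>.\<close>
  moreover have "(m - 2 * measure lebesgue ?C)\<^sup>2 / m - m = - 4 * measure lebesgue ?C + 4 * inverse m * (measure lebesgue ?C)\<^sup>2"
    using m0 by (simp add: power2_eq_square field_simps)
  ultimately show ?thesis
    using phases unfolding E0_def Let_def m_def[symmetric] by (simp add: P)
qed

subsection \<open>A compactly varying profile with nearly optimal cost\<close>

text \<open>An odd polynomial with value 1 and vanishing derivative at 1; its derivative is at most
  \<open>1 + 1 / (2 k)\<close> on the unit interval, so clamping it makes the optimal profile \<open>tanh (s / sqrt 2)\<close>
  constant outside a bounded interval at little cost, while remaining \<open>C\<^sup>1\<close>.\<close>
definition prof_poly :: "nat \<Rightarrow> real \<Rightarrow> real" where
  "prof_poly k z = z + (z - z ^ (2 * k + 1)) / (2 * real k)"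

definition prof_poly' :: "nat \<Rightarrow> real \<Rightarrow> real" where
  "prof_poly' k z = 1 + (1 - (2 * real k + 1) * z ^ (2 * k)) / (2 * real k)"

lemma prof_poly_has_derivative: "(prof_poly k has_real_derivative prof_poly' k z) (at z)"
proof -
  have "((\<lambda>z. z ^ (2 * k + 1)) has_real_derivative (2 * real k + 1) * z ^ (2 * k)) (at z)"
    using DERIV_pow[of "2 * k + 1" z] by (simp add: add.commute)
  from DERIV_add[OF DERIV_ident DERIV_cdivide[OF DERIV_diff[OF DERIV_ident this]]]
  show ?thesis unfolding prof_poly_def[abs_def] prof_poly'_def .
qed

lemma prof_poly_ends:
  assumes "k > 0"
  shows "prof_poly k 1 = 1" "prof_poly k (-1) = -1" "prof_poly' k 1 = 0" "prof_poly' k (-1) = 0"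
  using assms by (auto simp: prof_poly_def prof_poly'_def field_simps)

lemma even_power_le_one:
  fixes z :: real
  assumes "\<bar>z\<bar> \<le> 1"
  shows "z ^ (2 * k) \<le> 1"
  unfolding power_mult by (rule power_le_one[OF zero_le_power2]) (use assms in \<open>simp add: abs_square_le_1\<close>)

lemma prof_poly'_range:
  assumes "k > 0" "\<bar>z\<bar> \<le> 1"
  shows "0 \<le> prof_poly' k z" "prof_poly' k z \<le> 1 + 1 / (2 * real k)"
proof -
  have z: "0 \<le> z ^ (2 * k)" "z ^ (2 * k) \<le> 1"
    using even_power_le_one[OF assms(2)] by (auto simp: power_mult)
  have "(2 * real k + 1) * z ^ (2 * k) \<le> (2 * real k + 1) * 1" using z by (intro mult_left_mono) auto
  then have "- 1 \<le> (1 - (2 * real k + 1) * z ^ (2 * k)) / (2 * real k)" using assms(1) by (simp add: field_simps)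
  then show "0 \<le> prof_poly' k z" by (simp add: prof_poly'_def)
  have "0 \<le> (2 * real k + 1) * z ^ (2 * k)" using z by simp
  then have "(1 - (2 * real k + 1) * z ^ (2 * k)) / (2 * real k) \<le> 1 / (2 * real k)"
    by (intro divide_right_mono) auto
  then show "prof_poly' k z \<le> 1 + 1 / (2 * real k)" by (simp add: prof_poly'_def)
qed

text \<open>The polynomial is increasing on the interval from -1 to 1 and moves values away from 0,
  hence towards the wells; replacing \<open>z\<close> by \<open>prof_poly k z\<close> therefore does
  not raise the potential.\<close>

lemma prof_poly_range:
  assumes k: "k > 0" and z: "\<bar>z\<bar> \<le> 1"
  shows "\<bar>z\<bar> \<le> \<bar>prof_poly k z\<bar>" "\<bar>prof_poly k z\<bar> \<le> 1"
proof -
  have le: "prof_poly k x \<le> prof_poly k y" if "x \<le> y" "-1 \<le> x" "y \<le> 1" for x y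
    by (rule DERIV_nonneg_imp_nondecreasing[OF that(1)])
       (use that prof_poly_has_derivative prof_poly'_range(1)[OF k] in \<open>force simp: abs_le_iff\<close>)
  show "\<bar>prof_poly k z\<bar> \<le> 1"
    using le[of z 1] le[of "-1" z] z prof_poly_ends[OF k] by (auto simp: abs_le_iff)
  have "1 * \<bar>z\<bar> \<le> (1 + (1 - z ^ (2 * k)) / (2 * real k)) * \<bar>z\<bar>"
  proof (rule mult_right_mono)
    have "z ^ (2 * k) \<le> 1" using even_power_le_one[OF z] .
    then show "1 \<le> 1 + (1 - z ^ (2 * k)) / (2 * real k)" by simp
  qed simp
  moreover have "prof_poly k z = (1 + (1 - z ^ (2 * k)) / (2 * real k)) * z"
    by (simp add: prof_poly_def algebra_simps diff_divide_distrib)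
  ultimately show "\<bar>z\<bar> \<le> \<bar>prof_poly k z\<bar>"
    by (simp only: abs_mult) (smt (verit) mult_right_mono abs_ge_zero)
qed

definition clamp1 :: "real \<Rightarrow> real" where "clamp1 z = max (-1) (min 1 z)"

lemma clamp1_range: "\<bar>clamp1 z\<bar> \<le> 1" by (auto simp: clamp1_def)

lemma clamp1_id: "\<bar>z\<bar> \<le> 1 \<Longrightarrow> clamp1 z = z" by (auto simp: clamp1_def)

lemma clamp1_out: "\<not> \<bar>z\<bar> \<le> 1 \<Longrightarrow> \<bar>clamp1 z\<bar> = 1" by (auto simp: clamp1_def)

text \<open>This function solves \<open>y' = sqrt (2 * G y)\<close>, the equality case of the
  Modica-Mortola estimate.\<close>

lemma tanh_profile_derivative:
  "((\<lambda>s. tanh (s / sqrt 2)) has_real_derivative (1 - (tanh (s / sqrt 2))\<^sup>2) / sqrt 2) (at s)"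
  by (auto intro!: derivative_eq_intros simp: field_simps)

text \<open>Dividing \<open>y\<close> by \<open>b\<close> makes it reach the values 1 and -1 at
  finite distance, where the polynomial has slope 0. The derivative grows at most by the factor
  \<open>(1 + 1 / (2 k)) / b\<close> and the potential does not grow. Since gradient and potential
  share the optimal cost \<open>c0\<close> equally, only one of its halves is enlarged.\<close>

lemma profile_family:
  fixes b :: real and k :: nat
  assumes b: "0 < b" "b < 1" and k: "k > 0"
  obtains q q' S where "S > 0" "\<And>s. (q has_real_derivative q' s) (at s)" "continuous_on UNIV q'"
    "\<And>s. \<bar>q s\<bar> \<le> 1" "\<And>s. s \<ge> S \<Longrightarrow> q s = 1" "\<And>s. s \<le> - S \<Longrightarrow> q s = -1" "\<And>s. \<bar>s\<bar> \<ge> S \<Longrightarrow> q' s = 0"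
    "(\<integral>s. (q' s)\<^sup>2 / 2 + G (q s) \<partial>lborel) \<le> (((1 + 1 / (2 * real k)) / b)\<^sup>2 + 1) / 2 * c0"
proof -
  define y where "y s = tanh (s / sqrt 2)" for s :: real
  define y' where "y' s = (1 - (y s)\<^sup>2) / sqrt 2" for s
  have dy: "(y has_real_derivative y' s) (at s)" for s
    unfolding y_def[abs_def] y'_def using tanh_profile_derivative by (simp add: y_def)
  have y1: "\<bar>y s\<bar> < 1" for s using tanh_real_lt_1[of "s / sqrt 2"] tanh_real_gt_neg1[of "s / sqrt 2"]
    unfolding y_def by linarith
  have cy: "continuous_on UNIV y" using dy DERIV_isCont by (intro continuous_at_imp_continuous_on) blast
  have cy': "continuous_on UNIV y'" unfolding y'_def[abs_def] by (intro continuous_intros cy) auto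
  define q where "q s = prof_poly k (clamp1 (y s / b))" for s
  define q' where "q' s = prof_poly' k (clamp1 (y s / b)) * (y' s / b)" for s
  have dq: "(q has_real_derivative q' s) (at s)" for s
  proof -
    have "((\<lambda>z. prof_poly k (clamp1 z)) has_real_derivative prof_poly' k (clamp1 z)) (at z)" for z
      unfolding clamp1_def
      by (rule has_real_derivative_clamp[OF prof_poly_has_derivative]) (use prof_poly_ends[OF k] in simp_all)
    from DERIV_chain2[OF this DERIV_cdivide[OF dy]] show ?thesis unfolding q_def[abs_def] q'_def .
  qed
  have cq': "continuous_on UNIV q'"
    unfolding q'_def[abs_def] prof_poly'_def clamp1_def by (intro continuous_intros cy cy') (use b k in auto)
  have "((\<lambda>s. tanh (s / sqrt 2)) \<longlongrightarrow> 1) at_top"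
    by (rule filterlim_compose[OF tanh_real_at_top])
       (auto intro!: filterlim_at_top_mult_tendsto_pos[OF tendsto_const] filterlim_ident simp: divide_inverse)
  then have "eventually (\<lambda>s. b < y s) at_top" unfolding y_def by (rule order_tendstoD) (rule b)
  then obtain S0 where S0: "\<And>s. s \<ge> S0 \<Longrightarrow> b < y s" by (auto simp: eventually_at_top_linorder)
  define S where "S = max 1 S0"
  have S: "S > 0" "\<And>s. s \<ge> S \<Longrightarrow> b < y s" using S0 by (auto simp: S_def)
  have odd: "y (- s) = - y s" for s by (simp add: y_def)
  have up: "clamp1 (y s / b) = 1" if "s \<ge> S" for s
    using S(2)[OF that] b by (simp add: clamp1_def min_def max_def field_simps)
  have dn: "clamp1 (y s / b) = -1" if "s \<le> - S" for s
  proof -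
    have "b < y (- s)" using that by (intro S(2)) simp
    then have "y s / b < -1" using b by (simp add: odd field_simps)
    then show ?thesis by (simp add: clamp1_def)
  qed
  let ?K = "(((1 + 1 / (2 * real k)) / b)\<^sup>2 + 1) / 2"
  have W: "(q' s)\<^sup>2 / 2 + G (q s) \<le> ?K * (y' s)\<^sup>2" for s
  proof -
    have "(q' s)\<^sup>2 = (prof_poly' k (clamp1 (y s / b)) / b)\<^sup>2 * (y' s)\<^sup>2" by (simp add: q'_def power_mult_distrib power_divide)
    also have "\<dots> \<le> ((1 + 1 / (2 * real k)) / b)\<^sup>2 * (y' s)\<^sup>2"
      using prof_poly'_range[OF k clamp1_range, of "y s / b"] b
      by (intro mult_right_mono power_mono divide_right_mono divide_nonneg_pos) auto
    finally have 1: "(q' s)\<^sup>2 \<le> ((1 + 1 / (2 * real k)) / b)\<^sup>2 * (y' s)\<^sup>2" .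
    have "\<bar>y s\<bar> \<le> \<bar>clamp1 (y s / b)\<bar>"
    proof (cases "\<bar>y s / b\<bar> \<le> 1")
      case True
      then have "clamp1 (y s / b) = y s / b" by (rule clamp1_id)
      then have "b * clamp1 (y s / b) = y s" using b by simp
      then have "\<bar>y s\<bar> = b * \<bar>clamp1 (y s / b)\<bar>" by (metis abs_mult abs_of_pos b(1))
      also have "\<dots> \<le> 1 * \<bar>clamp1 (y s / b)\<bar>" using b by (intro mult_right_mono) auto
      finally show ?thesis by simp
    next
      case False
      then have "\<bar>clamp1 (y s / b)\<bar> = 1" by (rule clamp1_out)
      then show ?thesis using y1[of s] by simp
    qed
    then have "\<bar>y s\<bar> \<le> \<bar>q s\<bar>" "\<bar>q s\<bar> \<le> 1"
      using prof_poly_range[OF k clamp1_range, of "y s / b"] unfolding q_def by auto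
    then have "(y s)\<^sup>2 \<le> (q s)\<^sup>2" "(q s)\<^sup>2 \<le> 1" by (auto simp: abs_le_square_iff abs_square_le_1)
    then have "(1 - (q s)\<^sup>2)\<^sup>2 \<le> (1 - (y s)\<^sup>2)\<^sup>2" by (intro power_mono) auto
    then have "G (q s) \<le> (y' s)\<^sup>2 / 2" by (simp add: G_def y'_def power_divide)
    with 1 show ?thesis by (simp add: field_simps)
  qed
  have W0: "(q' s)\<^sup>2 / 2 + G (q s) = 0" if "\<bar>s\<bar> \<ge> S" for s
  proof -
    consider "s \<ge> S" | "s \<le> - S" using \<open>\<bar>s\<bar> \<ge> S\<close> by linarith
    then show ?thesis
      by cases (auto simp: q'_def q_def up dn prof_poly_ends[OF k] G_def)
  qed
  \<comment> \<open>An explicit primitive of \<open>(y' s)\<^sup>2\<close>: by the differential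
    equation it is a function of \<open>y\<close> alone, and its oscillation is at most
    \<open>c0\<close>.\<close>
  define H where "H s = (y s - y s ^ 3 / 3) / sqrt 2" for s
  have dH: "(H has_real_derivative (y' s)\<^sup>2) (at s)" for s
  proof -
    have "((\<lambda>s. y s - y s ^ 3 / 3) has_real_derivative y' s - (y s)\<^sup>2 * y' s) (at s)"
      by (auto intro!: derivative_eq_intros dy simp: power2_eq_square)
    from DERIV_cdivide[OF this, of "sqrt 2"]
    have "(H has_real_derivative (y' s - (y s)\<^sup>2 * y' s) / sqrt 2) (at s)"
      unfolding H_def[abs_def] .
    moreover have "(y' s - (y s)\<^sup>2 * y' s) / sqrt 2 = (y' s)\<^sup>2"
      by (simp add: y'_def power2_eq_square field_simps)
    ultimately show ?thesis by simp
  qed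
  have Hb: "\<bar>H s\<bar> \<le> c0 / 2" for s
  proof -
    have "\<bar>t - t ^ 3 / 3\<bar> \<le> 2 / 3" if "\<bar>t\<bar> \<le> 1" for t :: real
    proof -
      have "2 / 3 - (t - t ^ 3 / 3) = (1 - t)\<^sup>2 * (2 + t) / 3" by (simp add: power2_eq_square power3_eq_cube field_simps)
      moreover have "0 \<le> (1 - t)\<^sup>2 * (2 + t) / 3" using that by auto
      moreover have "2 / 3 + (t - t ^ 3 / 3) = (1 + t)\<^sup>2 * (2 - t) / 3" by (simp add: power2_eq_square power3_eq_cube field_simps)
      moreover have "0 \<le> (1 + t)\<^sup>2 * (2 - t) / 3" using that by auto
      ultimately show ?thesis by linarith
    qed
    from this[of "y s"] y1[of s] have "\<bar>y s - y s ^ 3 / 3\<bar> \<le> 2 / 3" by simp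
    from divide_right_mono[OF this, of "sqrt 2"] have "\<bar>H s\<bar> \<le> 2 / 3 / sqrt 2" by (simp add: H_def abs_divide)
    also have "\<dots> = c0 / 2" by (simp add: c0_def field_simps)
    finally show ?thesis .
  qed
  have "(\<integral>s. (q' s)\<^sup>2 / 2 + G (q s) \<partial>lborel) \<le> (\<integral>s. ?K * ((y' s)\<^sup>2 * indicator {- S..S} s) \<partial>lborel)"
  proof (rule integral_mono_AE')
    have "integrable lborel (\<lambda>s. indicator {- S..S} s *\<^sub>R (y' s)\<^sup>2)"
      by (rule borel_integrable_compact) (auto intro!: continuous_intros continuous_on_subset[OF cy'])
    then show "integrable lborel (\<lambda>s. ?K * ((y' s)\<^sup>2 * indicator {- S..S} s))" by (simp add: mult.commute)
    show "AE s in lborel. (q' s)\<^sup>2 / 2 + G (q s) \<le> ?K * ((y' s)\<^sup>2 * indicator {- S..S} s)"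
    proof (rule AE_I2)
      fix s
      show "(q' s)\<^sup>2 / 2 + G (q s) \<le> ?K * ((y' s)\<^sup>2 * indicator {- S..S} s)"
      proof (cases "s \<in> {- S..S}")
        case True
        then show ?thesis using W[of s] by simp
      next
        case False
        then have "\<bar>s\<bar> \<ge> S" by auto
        from W0[OF this] show ?thesis using False by simp
      qed
    qed
    show "AE s in lborel. 0 \<le> ?K * ((y' s)\<^sup>2 * indicator {- S..S} s)" by (intro AE_I2) (auto intro!: mult_nonneg_nonneg)
  qed
  also have "\<dots> = ?K * (H S - H (- S))"
    by (subst integral_mult_right_zero, subst integral_FTC_Icc_real)
       (use S dH cy' in \<open>auto simp: continuous_on_eq_continuous_at intro!: continuous_intros\<close>)
  also have "\<dots> \<le> ?K * c0"
    using Hb[of S] Hb[of "- S"] by (intro mult_left_mono) (auto simp: abs_le_iff)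
  finally have "(\<integral>s. (q' s)\<^sup>2 / 2 + G (q s) \<partial>lborel) \<le> ?K * c0" .
  moreover have "\<bar>q s\<bar> \<le> 1" for s unfolding q_def by (rule prof_poly_range(2)[OF k clamp1_range])
  moreover have "q s = 1" if "s \<ge> S" for s using up[OF that] prof_poly_ends[OF k] by (simp add: q_def)
  moreover have "q s = -1" if "s \<le> - S" for s using dn[OF that] prof_poly_ends[OF k] by (simp add: q_def)
  moreover have "q' s = 0" if "\<bar>s\<bar> \<ge> S" for s
    using W0[OF that] G_nonneg[of "q s"] zero_le_power2[of "q' s"] by (smt (verit) power2_eq_iff_nonneg half_gt_zero zero_less_power2)
  ultimately show ?thesis using that[OF S(1) dq cq'] by simp
qed

lemma profile_exists:
  assumes "\<kappa> > 0"
  obtains q q' S where "S > 0" "\<And>s. (q has_real_derivative q' s) (at s)" "continuous_on UNIV q'"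
    "\<And>s. \<bar>q s\<bar> \<le> 1" "\<And>s. s \<ge> S \<Longrightarrow> q s = 1" "\<And>s. s \<le> - S \<Longrightarrow> q s = -1" "\<And>s. \<bar>s\<bar> \<ge> S \<Longrightarrow> q' s = 0"
    "(\<integral>s. (q' s)\<^sup>2 / 2 + G (q s) \<partial>lborel) \<le> c0 + \<kappa>"
proof -
  \<comment> \<open>One index drives both parameters: \<open>b = 1 - r n\<close> and
    \<open>k = n + 2\<close>, so that \<open>1 / (2 k)\<close> is \<open>r n / 2\<close>.\<close>
  define r where "r n = 1 / real (Suc (Suc n))" for n
  have r0: "r \<longlonglongrightarrow> 0" unfolding r_def by (rule LIMSEQ_Suc[OF LIMSEQ_Suc[OF lim_1_over_n]])
  have "(\<lambda>n. (((1 + r n / 2) / (1 - r n))\<^sup>2 + 1) / 2 * c0) \<longlonglongrightarrow> (((1 + 0 / 2) / (1 - 0))\<^sup>2 + 1) / 2 * c0"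
    by (intro tendsto_intros r0) auto
  then have "eventually (\<lambda>n. (((1 + r n / 2) / (1 - r n))\<^sup>2 + 1) / 2 * c0 < c0 + \<kappa>) sequentially"
    by (rule order_tendstoD) (use assms in simp)
  then obtain n where n: "(((1 + r n / 2) / (1 - r n))\<^sup>2 + 1) / 2 * c0 < c0 + \<kappa>" by (auto simp: eventually_sequentially)
  have b: "0 < 1 - r n" "1 - r n < 1" by (auto simp: r_def field_simps)
  have e: "1 / (2 * real (Suc (Suc n))) = r n / 2" by (simp add: r_def)
  from profile_family[OF b, of "Suc (Suc n)"] that n show ?thesis unfolding e
    by (smt (verit) zero_less_Suc)
qed

subsection \<open>Smooth approximation of a set of finite perimeter\<close>

lemma C1c_translate:
  fixes X :: "'a::euclidean_space \<Rightarrow> 'b::real_normed_vector"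
  assumes X: "C1c X"
  shows "C1c (\<lambda>y. X (z + y))"
    and "frechet_derivative (\<lambda>y. X (z + y)) (at y) = frechet_derivative X (at (z + y))"
proof -
  have d: "((\<lambda>y. X (z + y)) has_derivative frechet_derivative X (at (z + y))) (at y)" for y
  proof -
    have "((\<lambda>y. z + y) has_derivative (\<lambda>h. h)) (at y)" by (auto intro!: derivative_eq_intros)
    from has_derivative_compose[OF this C1c_has_derivative[OF X]] show ?thesis by simp
  qed
  obtain R where R: "\<And>x. norm x \<ge> R \<Longrightarrow> X x = 0" using C1c_vanishes[OF X] by metis
  show "frechet_derivative (\<lambda>y. X (z + y)) (at y) = frechet_derivative X (at (z + y))"
    by (rule frechet_derivativeI[OF d])
  show "C1c (\<lambda>y. X (z + y))"
  proof (rule C1cI[OF d])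
    show "continuous_on UNIV (\<lambda>y. frechet_derivative X (at (z + y)) i)" for i
      by (intro continuous_on_compose2[OF C1c_continuous_derivative[OF X]] continuous_intros) auto
    show "X (z + x) = 0" if "norm x > R + norm z" for x
    proof (rule R)
      have "norm x \<le> norm (z + x) + norm z" using norm_triangle_ineq4[of "z + x" z] by simp
      then show "R \<le> norm (z + x)" using that by simp
    qed
  qed
qed

text \<open>\<open>w * moll\<close> is an average of translates of \<open>w\<close>, and translating \<open>w\<close> amounts to
  translating the test field, which does not change the supremum defining the perimeter.\<close>
lemma perimeter_mollification:
  fixes w :: "'a::euclidean_space \<Rightarrow> real"
  assumes w: "integrable lborel w" and d: "d > 0"
    and P: "\<And>X::'a \<Rightarrow> 'a. C1c X \<Longrightarrow> (\<And>x. norm (X x) \<le> 1) \<Longrightarrow> (\<integral>x. w x * div_field X x \<partial>lborel) \<le> P"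
    and X: "C1c X" "\<And>x. norm (X x) \<le> 1"
  shows "(\<integral>x. conv w (moll d) x * div_field X x \<partial>lborel) \<le> P"
proof -
  let ?k = "moll d :: 'a \<Rightarrow> real" and ?g = "div_field X"
  obtain B where B: "\<And>x. \<bar>?g x\<bar> \<le> B" using div_field_bounded_integrable[OF X(1)] by metis
  have k: "integrable lborel ?k" by (rule moll_integrable[OF d])
  have [measurable]: "?g \<in> borel_measurable borel"
    by (rule borel_measurable_continuous_onI[OF div_field_continuous[OF X(1)]])
  have [measurable]: "w \<in> borel_measurable borel" "?k \<in> borel_measurable borel"
    using w k by (auto dest: borel_measurable_integrable)
  have i: "integrable (lborel \<Otimes>\<^sub>M lborel) (\<lambda>(y, z). w y * ?k z * ?g (y + z))"
  proof (rule lborel_pair_integrable_bound[OF w k, where B = B and c = 0])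
    fix y z
    have "\<bar>w y * ?k z\<bar> * \<bar>?g (y + z)\<bar> \<le> \<bar>w y * ?k z\<bar> * B"
      using B by (rule mult_left_mono) simp
    then show "\<bar>w y * ?k z * ?g (y + z)\<bar> \<le> B * (\<bar>w y\<bar> * \<bar>?k (z + 0 *\<^sub>R y)\<bar>)"
      by (simp add: abs_mult mult_ac)
  qed measurable
  have "(\<integral>x. conv w ?k x * ?g x \<partial>lborel) = (\<integral>y. w y * (\<integral>x. ?k (x - y) * ?g x \<partial>lborel) \<partial>lborel)"
    by (rule conv_pairing(2)[OF w k _ B]) measurable
  also have "\<dots> = (\<integral>y. \<integral>z. w y * ?k z * ?g (y + z) \<partial>lborel \<partial>lborel)"
  proof (rule Bochner_Integration.integral_cong[OF refl])
    fix y
    have "(\<integral>x. ?k (x - y) * ?g x \<partial>lborel) = (\<integral>z. ?k z * ?g (y + z) \<partial>lborel)"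
      using lborel_integral_translate(1)[of "\<lambda>x. ?k (x - y) * ?g x" y] by simp
    then show "w y * (\<integral>x. ?k (x - y) * ?g x \<partial>lborel) = (\<integral>z. w y * ?k z * ?g (y + z) \<partial>lborel)"
      by (simp add: mult.assoc)
  qed
  also have "\<dots> = (\<integral>z. \<integral>y. w y * ?k z * ?g (y + z) \<partial>lborel \<partial>lborel)"
    by (rule lborel_pair.Fubini_integral[OF i, symmetric])
  also have "\<dots> \<le> (\<integral>z. ?k z * P \<partial>lborel)"
  proof (rule integral_mono)
    show "integrable lborel (\<lambda>z. \<integral>y. w y * ?k z * ?g (y + z) \<partial>lborel)" by (rule lborel_pair.integrable_snd[OF i])
    show "integrable lborel (\<lambda>z. ?k z * P)" using k by simp
    fix z
    have tr: "div_field (\<lambda>y. X (z + y)) y = ?g (y + z)" for y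
      unfolding div_field_def C1c_translate(2)[OF X(1)] by (simp add: add.commute)
    have "(\<integral>y. w y * ?k z * ?g (y + z) \<partial>lborel) = ?k z * (\<integral>y. w y * div_field (\<lambda>y. X (z + y)) y \<partial>lborel)"
      unfolding tr integral_mult_right_zero[symmetric] by (simp add: mult_ac)
    also have "\<dots> \<le> ?k z * P"
      by (intro mult_left_mono P C1c_translate(1)[OF X(1)] X(2) moll_nonneg[OF d])
    finally show "(\<integral>y. w y * ?k z * ?g (y + z) \<partial>lborel) \<le> ?k z * P" .
  qed
  also have "\<dots> = P" by (simp add: moll_integral[OF d])
  finally show ?thesis .
qed

lemma C1c_scaleR:
  fixes \<beta> :: "'a::euclidean_space \<Rightarrow> real" and X :: "'a \<Rightarrow> 'b::real_normed_vector"
  assumes \<beta>: "\<And>x. (\<beta> has_derivative \<beta>' x) (at x)" and c: "\<And>i. i \<in> Basis \<Longrightarrow> continuous_on UNIV (\<lambda>x. \<beta>' x i)"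
    and X: "C1c X"
  shows "C1c (\<lambda>x. \<beta> x *\<^sub>R X x)"
    and "frechet_derivative (\<lambda>x. \<beta> x *\<^sub>R X x) (at x) h = \<beta> x *\<^sub>R frechet_derivative X (at x) h + \<beta>' x h *\<^sub>R X x"
proof -
  have d: "((\<lambda>x. \<beta> x *\<^sub>R X x) has_derivative (\<lambda>h. \<beta> x *\<^sub>R frechet_derivative X (at x) h + \<beta>' x h *\<^sub>R X x)) (at x)" for x
    by (rule has_derivative_scaleR[OF \<beta> C1c_has_derivative[OF X]])
  show "frechet_derivative (\<lambda>x. \<beta> x *\<^sub>R X x) (at x) h = \<beta> x *\<^sub>R frechet_derivative X (at x) h + \<beta>' x h *\<^sub>R X x"
    by (subst frechet_derivativeI[OF d]) simp
  obtain R where R: "\<And>x. norm x \<ge> R \<Longrightarrow> X x = 0" using C1c_vanishes[OF X] by metis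
  have "continuous_on UNIV \<beta>"
    by (intro continuous_at_imp_continuous_on ballI has_derivative_continuous[OF \<beta>])
  then show "C1c (\<lambda>x. \<beta> x *\<^sub>R X x)"
    by (intro C1cI[OF d, of R] continuous_intros c C1c_continuous[OF X] C1c_continuous_partial[OF X])
       (use R in auto)
qed

lemma bump_tendsto_one: "(\<lambda>n. bump (real (Suc n)) x) \<longlonglongrightarrow> 1"
proof -
  have "(\<lambda>n. 1 / real (Suc n)) \<longlonglongrightarrow> 0" using LIMSEQ_Suc[OF lim_1_over_n[where 'a=real]] by simp
  then have "(\<lambda>n. max 0 (1 - (x \<bullet> x) * (1 / real (Suc n))\<^sup>2) ^ 3) \<longlonglongrightarrow> max 0 (1 - (x \<bullet> x) * 0\<^sup>2) ^ 3"
    by (intro tendsto_intros)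
  then show ?thesis by (simp add: bump_def power_divide)
qed

text \<open>Two derivatives of \<open>f\<close> are what allows its gradient, suitably rescaled, to
  serve as a \<open>C\<^sup>1\<close> test field.\<close>

lemma C2c_gradient:
  fixes f :: "'a::euclidean_space \<Rightarrow> real"
  assumes f: "C2c f"
  defines "D \<equiv> \<lambda>x. \<Sum>i\<in>Basis. frechet_derivative f (at x) i *\<^sub>R i"
  shows "C1c D" and "(f has_derivative (\<lambda>h. D x \<bullet> h)) (at x)"
proof -
  have fi: "C1c (\<lambda>x. frechet_derivative f (at x) i)" if "i \<in> Basis" for i using f that by (simp add: C2c_def)
  have f1: "C1c f" using f by (simp add: C2c_def)
  have d: "(D has_derivative (\<lambda>h. \<Sum>i\<in>Basis. frechet_derivative (\<lambda>x. frechet_derivative f (at x) i) (at x) h *\<^sub>R i)) (at x)" for x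
    unfolding D_def by (intro has_derivative_sum has_derivative_scaleR_left C1c_has_derivative fi)
  obtain R where R: "\<And>x. norm x \<ge> R \<Longrightarrow> frechet_derivative f (at x) = (\<lambda>_. 0)" using C1c_vanishes[OF f1] by metis
  show "C1c D"
    by (rule C1cI[OF d, of R])
       (auto intro!: continuous_intros C1c_continuous_partial fi simp: D_def R)
  have "D x \<bullet> h = frechet_derivative f (at x) h" for h
    unfolding D_def C1c_derivative_expand[OF f1, of x h] by (simp add: inner_sum_left inner_commute[of h] mult.commute)
  then show "(f has_derivative (\<lambda>h. D x \<bullet> h)) (at x)" using C1c_has_derivative[OF f1, of x] by presburger
qed

text \<open>Mollification keeps the dual bound \<open>P\<close>. The cut-off is then moved onto the
  test field: \<open>Y = bump r *\<^sub>R X\<close> is again admissible, and its divergence differs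
  from \<open>bump r\<close> times that of \<open>X\<close> by a term of size at most
  \<open>6 / r\<close>.\<close>

lemma smooth_approximation:
  fixes w :: "'a::euclidean_space \<Rightarrow> real"
  assumes w: "integrable lborel w" and w01: "\<And>x. 0 \<le> w x" "\<And>x. w x \<le> 1"
    and P: "\<And>X::'a \<Rightarrow> 'a. C1c X \<Longrightarrow> (\<And>x. norm (X x) \<le> 1) \<Longrightarrow> (\<integral>x. w x * div_field X x \<partial>lborel) \<le> P"
    and e: "e > 0"
  obtains f where "C2c f" "\<And>x. 0 \<le> f x" "\<And>x. f x \<le> 1" "integrable lborel f"
    "(\<integral>x. \<bar>f x - w x\<bar> \<partial>lborel) \<le> e"
    "\<forall>X::'a \<Rightarrow> 'a. C1c X \<longrightarrow> (\<forall>x. norm (X x) \<le> 1) \<longrightarrow> (\<integral>x. f x * div_field X x \<partial>lborel) \<le> P + e"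
proof -
  have d0: "(\<lambda>n. 1 / real (Suc n)) \<longlonglongrightarrow> 0" using LIMSEQ_Suc[OF lim_1_over_n[where 'a=real]] by simp
  have "(\<lambda>n. \<integral>x. \<bar>conv w (moll (1 / real (Suc n))) x - w x\<bar> \<partial>lborel) \<longlonglongrightarrow> 0"
    by (rule conv_moll_L1[OF w _ d0]) simp
  then have "eventually (\<lambda>n. (\<integral>x. \<bar>conv w (moll (1 / real (Suc n))) x - w x\<bar> \<partial>lborel) < e / 2) sequentially"
    using e by (intro order_tendstoD(2)) auto
  then obtain n0 where n0: "(\<integral>x. \<bar>conv w (moll (1 / real (Suc n0))) x - w x\<bar> \<partial>lborel) < e / 2"
    by (auto simp: eventually_sequentially)
  define d where "d = 1 / real (Suc n0)"
  have d: "d > 0" by (simp add: d_def)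
  define f0 where "f0 = conv w (moll d :: 'a \<Rightarrow> real)"
  have L0: "(\<integral>x. \<bar>f0 x - w x\<bar> \<partial>lborel) < e / 2" using n0 by (simp add: f0_def d_def)
  have r0: "0 \<le> f0 x" "f0 x \<le> 1" for x unfolding f0_def by (rule conv_moll_range[OF d w w01])+
  have i0: "integrable lborel f0" unfolding f0_def by (rule conv_integrable_lborel[OF w moll_integrable[OF d]])
  have [measurable]: "f0 \<in> borel_measurable borel" "w \<in> borel_measurable borel"
    using i0 w by (auto dest: borel_measurable_integrable)
  have I0: "(\<integral>x. f0 x \<partial>lborel) = (\<integral>x. w x \<partial>lborel)"
    unfolding f0_def using conv_integral[OF w moll_integrable[OF d]] by (simp add: moll_integral[OF d])
  have bC: "C1c (bump r :: 'a \<Rightarrow> real)" if "r > 0" for r using bump_C2c[OF that, where 'a='a] by (simp add: C2c_def)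
  have bm[measurable]: "(bump r :: 'a \<Rightarrow> real) \<in> borel_measurable borel" for r
    unfolding bump_def[abs_def] by measurable
  have "(\<lambda>n. \<integral>x. \<bar>bump (real (Suc n)) x * f0 x - f0 x\<bar> \<partial>lborel) \<longlonglongrightarrow> (\<integral>x. 0 \<partial>(lborel :: 'a measure))"
  proof (rule integral_dominated_convergence[where w = f0])
    show "AE x in lborel. (\<lambda>n. \<bar>bump (real (Suc n)) x * f0 x - f0 x\<bar>) \<longlonglongrightarrow> 0"
    proof (rule AE_I2)
      fix x
      have "(\<lambda>n. \<bar>bump (real (Suc n)) x * f0 x - f0 x\<bar>) \<longlonglongrightarrow> \<bar>1 * f0 x - f0 x\<bar>"
        by (intro tendsto_intros bump_tendsto_one)
      then show "(\<lambda>n. \<bar>bump (real (Suc n)) x * f0 x - f0 x\<bar>) \<longlonglongrightarrow> 0" by simp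
    qed
    show "AE x in lborel. norm \<bar>bump (real (Suc n)) x * f0 x - f0 x\<bar> \<le> f0 x" for n
    proof (rule AE_I2)
      fix x
      have "bump (real (Suc n)) x * f0 x \<le> 1 * f0 x" "0 \<le> bump (real (Suc n)) x * f0 x"
        using bump_range[of "real (Suc n)" x] r0[of x] by (intro mult_right_mono mult_nonneg_nonneg; simp)+
      then show "norm \<bar>bump (real (Suc n)) x * f0 x - f0 x\<bar> \<le> f0 x" by simp
    qed
  qed (use i0 in auto)
  then have ev1: "eventually (\<lambda>n. (\<integral>x. \<bar>bump (real (Suc n)) x * f0 x - f0 x\<bar> \<partial>lborel) < e / 2) sequentially"
    using e by (intro order_tendstoD(2)) auto
  \<comment> \<open>The error of the cut-off: the gradient bound \<open>6 / r\<close> times the mass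
    of \<open>w\<close>, which mollification has preserved.\<close>
  have "(\<lambda>n. 6 * (\<integral>x. w x \<partial>lborel) * (1 / real (Suc n))) \<longlonglongrightarrow> 6 * (\<integral>x. w x \<partial>lborel) * 0"
    by (intro tendsto_intros d0)
  then have ev2: "eventually (\<lambda>n. 6 * (\<integral>x. w x \<partial>lborel) * (1 / real (Suc n)) < e) sequentially"
    using e by (intro order_tendstoD(2)) auto
  obtain n where n: "(\<integral>x. \<bar>bump (real (Suc n)) x * f0 x - f0 x\<bar> \<partial>lborel) < e / 2"
     "6 * (\<integral>x. w x \<partial>lborel) * (1 / real (Suc n)) < e"
    using eventually_conj[OF ev1 ev2] by (auto simp: eventually_sequentially)
  define r where "r = real (Suc n)"
  have r: "r > 0" by (simp add: r_def)
  define f where "f x = f0 x * bump r x" for x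
  have D0: "(f0 has_derivative (\<lambda>h. conv w (\<lambda>z. frechet_derivative (moll d) (at z) h) x)) (at x)" for x
    unfolding f0_def by (rule conv_has_derivative[OF w moll_C1c[OF d]])
  have cD0: "continuous_on UNIV (\<lambda>x. conv w (\<lambda>z. frechet_derivative (moll d) (at z) i) x)" for i
    by (rule conv_continuous_partial[OF w moll_C1c[OF d]])
  have f1: "C1c f" unfolding f_def by (rule C1c_mult(1)[OF D0 cD0 bC[OF r]])
  have fd: "frechet_derivative f (at x) h = f0 x * frechet_derivative (bump r) (at x) h
     + conv w (\<lambda>z. frechet_derivative (moll d) (at z) h) x * bump r x" for x h
    unfolding f_def by (rule C1c_mult(2)[OF D0 cD0 bC[OF r]])
  have "C2c f" unfolding C2c_def
  proof (intro conjI ballI f1)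
    fix i :: 'a assume i: "i \<in> Basis"
    have mi: "C1c (\<lambda>z::'a. frechet_derivative (moll d) (at z) i)" using moll_C2c[OF d, where 'a='a] i by (simp add: C2c_def)
    have bi: "C1c (\<lambda>z::'a. frechet_derivative (bump r) (at z) i)" using bump_C2c[OF r, where 'a='a] i by (simp add: C2c_def)
    have 1: "C1c (\<lambda>x. f0 x * frechet_derivative (bump r) (at x) i)" by (rule C1c_mult(1)[OF D0 cD0 bi])
    have 2: "C1c (\<lambda>x. conv w (\<lambda>z. frechet_derivative (moll d) (at z) i) x * bump r x)"
      by (rule C1c_mult(1)[OF conv_has_derivative[OF w mi] conv_continuous_partial[OF w mi] bC[OF r]])
    obtain R1 where R1: "\<And>x. norm x \<ge> R1 \<Longrightarrow> f0 x * frechet_derivative (bump r) (at x) i = 0" using C1c_vanishes[OF 1] by metis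
    obtain R2 where R2: "\<And>x. norm x \<ge> R2 \<Longrightarrow> conv w (\<lambda>z. frechet_derivative (moll d) (at z) i) x * bump r x = 0" using C1c_vanishes[OF 2] by metis
    have z: "f0 x * frechet_derivative (bump r) (at x) i + conv w (\<lambda>z. frechet_derivative (moll d) (at z) i) x * bump r x = 0"
      if "norm x > max R1 R2" for x
      using R1[of x] R2[of x] that by auto
    show "C1c (\<lambda>x. frechet_derivative f (at x) i)" unfolding fd
      by (rule C1cI[OF has_derivative_add[OF C1c_has_derivative[OF 1] C1c_has_derivative[OF 2]], of "max R1 R2"])
         (use z in \<open>auto intro!: continuous_intros C1c_continuous_partial[OF 1] C1c_continuous_partial[OF 2]\<close>)
  qed
  moreover have "0 \<le> f x" "f x \<le> 1" for x
    using r0[of x] bump_range[of r x] by (auto simp: f_def intro: mult_le_one)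
  moreover have if1: "integrable lborel f"
    unfolding f_def
    by (rule Bochner_Integration.integrable_bound[OF i0])
       (use bump_range in \<open>auto simp: abs_mult abs_of_nonneg[OF bump_range(1)] intro!: AE_I2 mult_left_le\<close>)
  moreover have "(\<integral>x. \<bar>f x - w x\<bar> \<partial>lborel) \<le> e"
  proof -
    have "(\<integral>x. \<bar>f x - w x\<bar> \<partial>lborel) \<le> (\<integral>x. \<bar>f x - f0 x\<bar> + \<bar>f0 x - w x\<bar> \<partial>lborel)"
      using if1 i0 w by (intro integral_mono) auto
    also have "\<dots> = (\<integral>x. \<bar>f x - f0 x\<bar> \<partial>lborel) + (\<integral>x. \<bar>f0 x - w x\<bar> \<partial>lborel)"
      using if1 i0 w by simp
    also have "\<dots> \<le> e / 2 + e / 2"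
      using n(1) L0 by (intro add_mono) (auto simp: f_def r_def mult.commute)
    finally show ?thesis by simp
  qed
  moreover have "(\<integral>x. f x * div_field X x \<partial>lborel) \<le> P + e" if X: "C1c X" "\<And>x. norm (X x) \<le> 1" for X :: "'a \<Rightarrow> 'a"
  proof -
    define Y where "Y x = bump r x *\<^sub>R X x" for x
    have Y: "C1c Y" unfolding Y_def
      by (rule C1c_scaleR(1)[OF C1c_has_derivative[OF bC[OF r]] C1c_continuous_partial[OF bC[OF r]] X(1)])
    have Y1: "norm (Y x) \<le> 1" for x
      using bump_range[of r x] X(2)[of x] by (auto simp: Y_def intro: mult_le_one)
    have dY: "div_field Y x = bump r x * div_field X x + frechet_derivative (bump r) (at x) (X x)" for x
    proof -
      have "div_field Y x = (\<Sum>i\<in>Basis. bump r x * (frechet_derivative X (at x) i \<bullet> i) + frechet_derivative (bump r) (at x) i * (X x \<bullet> i))"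
        unfolding div_field_def Y_def
        by (subst C1c_scaleR(2)[OF C1c_has_derivative[OF bC[OF r]] C1c_continuous_partial[OF bC[OF r]] X(1)])
           (simp_all add: inner_add_left)
      then show ?thesis
        unfolding C1c_derivative_expand[OF bC[OF r], of x "X x"]
        by (simp add: sum.distrib div_field_def sum_distrib_left mult.commute)
    qed
    obtain BX where BX: "\<And>x. \<bar>div_field X x\<bar> \<le> BX" "integrable lborel (div_field X)"
      using div_field_bounded_integrable[OF X(1)] by metis
    obtain BY where BY: "\<And>x. \<bar>div_field Y x\<bar> \<le> BY" "integrable lborel (div_field Y)"
      using div_field_bounded_integrable[OF Y] by metis
    have iY: "integrable lborel (\<lambda>x. f0 x * div_field Y x)"
      by (rule Bochner_Integration.integrable_bound[OF integrable_mult_right[OF i0, of BY]])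
         (use borel_measurable_integrable[OF BY(2)] BY(1) order_trans[OF abs_ge_zero BY(1)] in
           \<open>auto simp: abs_mult mult.commute[of BY] intro!: AE_I2 mult_left_mono\<close>)
    have iX: "integrable lborel (\<lambda>x. f x * div_field X x)"
      by (rule Bochner_Integration.integrable_bound[OF integrable_mult_right[OF if1, of BX]])
         (use borel_measurable_integrable[OF BX(2)] BX(1) order_trans[OF abs_ge_zero BX(1)] borel_measurable_integrable[OF if1] in
           \<open>auto simp: abs_mult mult.commute[of BX] intro!: AE_I2 mult_left_mono\<close>)
    have "(\<integral>x. f x * div_field X x \<partial>lborel) \<le> (\<integral>x. f0 x * div_field Y x + 6 / r * f0 x \<partial>lborel)"
    proof (rule integral_mono[OF iX])
      show "integrable lborel (\<lambda>x. f0 x * div_field Y x + 6 / r * f0 x)" using iY i0 by simp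
      fix x
      have "\<bar>frechet_derivative (bump r) (at x) (X x)\<bar> \<le> 6 / r * norm (X x)" by (rule bump_derivative_bound[OF r])
      also have "\<dots> \<le> 6 / r * 1" using r by (intro mult_left_mono X(2)) auto
      finally have "- (6 / r) \<le> frechet_derivative (bump r) (at x) (X x)" by linarith
      then have "f0 x * - (6 / r) \<le> f0 x * frechet_derivative (bump r) (at x) (X x)" by (rule mult_left_mono) (rule r0)
      then show "f x * div_field X x \<le> f0 x * div_field Y x + 6 / r * f0 x"
        unfolding dY f_def by (simp add: distrib_left mult_ac)
    qed
    also have "\<dots> = (\<integral>x. f0 x * div_field Y x \<partial>lborel) + 6 / r * (\<integral>x. w x \<partial>lborel)"
      using iY i0 I0 by simp
    also have "\<dots> \<le> P + e"
      using perimeter_mollification[OF w d P Y Y1] n(2) unfolding f0_def r_def by (intro add_mono) auto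
    finally show ?thesis .
  qed
  ultimately show ?thesis using that by blast
qed

section \<open>The regularised gradient norm and the total variation of \<open>f\<close>\<close>

definition regnorm :: "('a::euclidean_space \<Rightarrow> 'a) \<Rightarrow> real \<Rightarrow> 'a \<Rightarrow> real" where
  "regnorm D \<eta> x = sqrt (D x \<bullet> D x + \<eta>\<^sup>2)"

lemma
  assumes \<eta>: "\<eta> > 0"
  shows regnorm_pos: "regnorm D \<eta> x > 0"
    and regnorm_square: "(regnorm D \<eta> x)\<^sup>2 = D x \<bullet> D x + \<eta>\<^sup>2"
    and regnorm_ge: "\<eta> \<le> regnorm D \<eta> x" "norm (D x) \<le> regnorm D \<eta> x"
    and regnorm_continuous: "C1c D \<Longrightarrow> continuous_on UNIV (regnorm D \<eta>)"
    and regnorm_has_derivative: "C1c D \<Longrightarrow>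
      (regnorm D \<eta> has_derivative (\<lambda>h. (D x \<bullet> frechet_derivative D (at x) h) / regnorm D \<eta> x)) (at x)"
proof -
  have pos: "D x \<bullet> D x + \<eta>\<^sup>2 > 0" using \<eta> by (simp add: add_nonneg_pos)
  then show "regnorm D \<eta> x > 0" by (simp add: regnorm_def)
  show "(regnorm D \<eta> x)\<^sup>2 = D x \<bullet> D x + \<eta>\<^sup>2" using pos by (simp add: regnorm_def)
  show "\<eta> \<le> regnorm D \<eta> x" using \<eta> by (auto simp: regnorm_def intro!: real_le_rsqrt)
  show "norm (D x) \<le> regnorm D \<eta> x"
    unfolding regnorm_def norm_eq_sqrt_inner by (intro real_sqrt_le_mono) simp
  assume D: "C1c D"
  show "continuous_on UNIV (regnorm D \<eta>)"
    unfolding regnorm_def[abs_def] by (intro continuous_intros C1c_continuous[OF D])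
  let ?D' = "frechet_derivative D (at x)"
  have 1: "((\<lambda>x. D x \<bullet> D x + \<eta>\<^sup>2) has_derivative (\<lambda>h. 2 * (D x \<bullet> ?D' h))) (at x)"
    by (rule derivative_eq_intros C1c_has_derivative[OF D] refl)+ (auto simp: inner_commute)
  have 2: "(sqrt has_real_derivative inverse (regnorm D \<eta> x) / 2) (at (D x \<bullet> D x + \<eta>\<^sup>2))"
    using DERIV_real_sqrt[OF pos] by (simp add: regnorm_def)
  from DERIV_compose_FDERIV[OF 2 1]
  show "(regnorm D \<eta> has_derivative (\<lambda>h. (D x \<bullet> ?D' h) / regnorm D \<eta> x)) (at x)"
    unfolding regnorm_def[abs_def] by (simp add: field_simps)
qed

text \<open>The field \<open>- D / a\<close> has norm at most 1. Tested with it, the hypothesis on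
  \<open>P\<close> becomes after integration by parts a bound for the integral of
  \<open>|D|\<^sup>2 / a\<close>, and this integrand equals
  \<open>a - \<eta>\<^sup>2 / a \<ge> a - \<eta>\<close>. The integral of \<open>a\<close> is taken
  over a ball because \<open>a = \<eta>\<close> outside it.\<close>

lemma gradient_mass_bound:
  fixes f :: "'a::euclidean_space \<Rightarrow> real" and D :: "'a \<Rightarrow> 'a"
  assumes f: "\<And>x. (f has_derivative (\<lambda>h. D x \<bullet> h)) (at x)" and D: "C1c D" and \<eta>: "\<eta> > 0"
    and fi: "integrable lborel f"
    and P: "\<And>X::'a \<Rightarrow> 'a. C1c X \<Longrightarrow> (\<And>x. norm (X x) \<le> 1) \<Longrightarrow> (\<integral>x. f x * div_field X x \<partial>lborel) \<le> P"
    and R: "\<And>x. norm x \<ge> R \<Longrightarrow> D x = 0"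
  shows "(\<integral>x. indicator (cball 0 R) x * regnorm D \<eta> x \<partial>lborel) \<le> P + \<eta> * measure lborel (cball (0::'a) R)"
    and "integrable lborel (\<lambda>x. indicator (cball 0 R) x * regnorm D \<eta> x)"
proof -
  define a where "a = regnorm D \<eta>"
  let ?D' = "\<lambda>x. frechet_derivative D (at x)"
  have a0: "a x > 0" and a2: "(a x)\<^sup>2 = D x \<bullet> D x + \<eta>\<^sup>2" and a\<eta>: "a x \<ge> \<eta>" and Dn: "norm (D x) \<le> a x"
    and da: "(a has_derivative (\<lambda>h. (D x \<bullet> ?D' x h) / a x)) (at x)" for x
    unfolding a_def using regnorm_pos[OF \<eta>] regnorm_square[OF \<eta>] regnorm_ge[OF \<eta>] regnorm_has_derivative[OF \<eta> D] by auto
  have ca: "continuous_on UNIV a" unfolding a_def by (rule regnorm_continuous[OF \<eta> D])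
  have cD: "continuous_on UNIV D" by (rule C1c_continuous[OF D])
  have dia: "((\<lambda>x. - inverse (a x)) has_derivative (\<lambda>h. inverse (a x) * ((D x \<bullet> ?D' x h) / a x) * inverse (a x))) (at x)" for x
    using has_derivative_minus[OF Deriv.has_derivative_inverse[OF less_imp_neq[OF a0, symmetric] da]] by simp
  have X: "C1c (\<lambda>x. - inverse (a x) *\<^sub>R D x)"
    by (rule C1c_scaleR(1)[OF dia _ D])
       (use less_imp_neq[OF a0, symmetric] in \<open>auto intro!: continuous_intros ca cD C1c_continuous_partial[OF D]\<close>)
  have X1: "norm (- inverse (a x) *\<^sub>R D x) \<le> 1" for x
    using Dn[of x] a0[of x] by (simp add: field_simps)
  have iA: "integrable lborel (\<lambda>x. indicator (cball 0 R) x * a x)"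
    using borel_integrable_compact[of "cball 0 R" a] continuous_on_subset[OF ca] by simp
  then show "integrable lborel (\<lambda>x. indicator (cball 0 R) x * regnorm D \<eta> x)" by (simp add: a_def)
  have DR: "norm x \<ge> R \<Longrightarrow> D x = 0" for x by (rule R)
  have iDi: "integrable lborel (\<lambda>x. (D x \<bullet> i) * ((- inverse (a x) *\<^sub>R D x) \<bullet> i))" for i
    by (rule continuous_vanishing_integrable[of _ R])
       (use less_imp_neq[OF a0, symmetric] DR in \<open>auto intro!: continuous_intros ca cD\<close>)
  have if1: "integrable lborel (\<lambda>x. f x * frechet_derivative (\<lambda>x. (- inverse (a x) *\<^sub>R D x) \<bullet> i) (at x) i)"
    and if2: "(\<integral>x. f x * frechet_derivative (\<lambda>x. (- inverse (a x) *\<^sub>R D x) \<bullet> i) (at x) i \<partial>lborel)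
       = - (\<integral>x. (D x \<bullet> i) * ((- inverse (a x) *\<^sub>R D x) \<bullet> i) \<partial>lborel)" if i: "i \<in> Basis" for i
  proof -
    have cDj: "continuous_on UNIV (\<lambda>x. D x \<bullet> j)" for j by (intro continuous_intros cD)
    show "integrable lborel (\<lambda>x. f x * frechet_derivative (\<lambda>x. (- inverse (a x) *\<^sub>R D x) \<bullet> i) (at x) i)"
      by (rule integration_by_parts_C1c(1)[OF f cDj C1c_inner(1)[OF X] i])
    show "(\<integral>x. f x * frechet_derivative (\<lambda>x. (- inverse (a x) *\<^sub>R D x) \<bullet> i) (at x) i \<partial>lborel)
       = - (\<integral>x. (D x \<bullet> i) * ((- inverse (a x) *\<^sub>R D x) \<bullet> i) \<partial>lborel)"
      by (rule integration_by_parts_C1c(3)[OF f cDj C1c_inner(1)[OF X] i])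
  qed
  have "(\<integral>x. indicator (cball 0 R) x * a x - \<eta> * indicator (cball 0 R) x \<partial>lborel) \<le> (\<integral>x. (D x \<bullet> D x) / a x \<partial>lborel)"
  proof (rule integral_mono)
    show "integrable lborel (\<lambda>x. indicator (cball 0 R) x * a x - \<eta> * indicator (cball 0 R) x)"
      using iA integrable_indicator_bounded[of "cball (0::'a) R"] by simp
    show "integrable lborel (\<lambda>x. (D x \<bullet> D x) / a x)"
      by (rule continuous_vanishing_integrable[of _ R])
         (use less_imp_neq[OF a0, symmetric] DR in \<open>auto intro!: continuous_intros ca cD\<close>)
    fix x
    have "\<eta> * \<eta> \<le> \<eta> * a x" using a\<eta>[of x] \<eta> by (intro mult_left_mono) auto
    then have "a x - \<eta> \<le> (D x \<bullet> D x) / a x"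
      using a2[of x] a0[of x] by (simp add: field_simps power2_eq_square)
    then show "indicator (cball 0 R) x * a x - \<eta> * indicator (cball 0 R) x \<le> (D x \<bullet> D x) / a x"
      using a0[of x] by (auto simp: indicator_def)
  qed
  also have "\<dots> = (\<integral>x. (\<Sum>i\<in>Basis. - ((D x \<bullet> i) * ((- inverse (a x) *\<^sub>R D x) \<bullet> i))) \<partial>lborel)"
    by (intro Bochner_Integration.integral_cong refl)
       (subst euclidean_inner, simp add: divide_inverse sum_distrib_left mult_ac)
  also have "\<dots> = (\<Sum>i\<in>Basis. - (\<integral>x. (D x \<bullet> i) * ((- inverse (a x) *\<^sub>R D x) \<bullet> i) \<partial>lborel))"
    using iDi by (subst Bochner_Integration.integral_sum) auto
  also have "\<dots> = (\<Sum>i\<in>Basis. \<integral>x. f x * frechet_derivative (\<lambda>x. (- inverse (a x) *\<^sub>R D x) \<bullet> i) (at x) i \<partial>lborel)"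
    using if2 by simp
  also have "\<dots> = (\<integral>x. (\<Sum>i\<in>Basis. f x * frechet_derivative (\<lambda>x. (- inverse (a x) *\<^sub>R D x) \<bullet> i) (at x) i) \<partial>lborel)"
    by (rule Bochner_Integration.integral_sum[symmetric]) (rule if1)
  also have "\<dots> = (\<integral>x. f x * div_field (\<lambda>x. - inverse (a x) *\<^sub>R D x) x \<partial>lborel)"
    unfolding div_field_def C1c_inner(2)[OF X] by (simp add: sum_distrib_left)
  also have "\<dots> \<le> P" by (rule P[OF X X1])
  finally show "(\<integral>x. indicator (cball 0 R) x * regnorm D \<eta> x \<partial>lborel) \<le> P + \<eta> * measure lborel (cball (0::'a) R)"
    using iA integrable_indicator_bounded[of "cball (0::'a) R"] by (simp add: a_def[symmetric])
qed

subsection \<open>The recovery sequence\<close>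

text \<open>If every level between \<open>\<tau>\<close> and \<open>1 - \<tau>\<close>, an interval
  of length \<open>1 - 2 * \<tau>\<close>, cost more than \<open>B\<close>, the total over all
  levels would be too large for \<open>less\<close>. Levels near 0 and 1 are excluded because there
  a small error of \<open>f\<close> could already switch the phase.\<close>

lemma averaging:
  fixes f a :: "'a::euclidean_space \<Rightarrow> real" and W :: "real \<Rightarrow> real"
  assumes [measurable]: "f \<in> borel_measurable borel" "a \<in> borel_measurable borel" "K \<in> sets borel"
    and a: "\<And>x. a x > 0" and iA: "integrable lborel (\<lambda>x. indicator K x * a x)"
    and W: "integrable lborel W" "\<And>s. 0 \<le> W s" and \<epsilon>: "\<epsilon> > 0" and \<tau>: "\<tau> < 1 / 2" and B: "B \<ge> 0"
    and less: "(\<integral>x. indicator K x * a x \<partial>lborel) * (\<integral>s. W s \<partial>lborel) < B * (1 - 2 * \<tau>)"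
  obtains t where "\<tau> \<le> t" "t \<le> 1 - \<tau>"
    "integrable lborel (\<lambda>x. indicator K x * (1 / \<epsilon> * W ((f x - t) / (\<epsilon> * a x))))"
    "(\<integral>x. indicator K x * (1 / \<epsilon> * W ((f x - t) / (\<epsilon> * a x))) \<partial>lborel) \<le> B"
proof -
  have [measurable]: "W \<in> borel_measurable borel" using W(1) by (auto dest: borel_measurable_integrable)
  \<comment> \<open>Extended nonnegative integrals allow the exchange of integrals before anything
    is known to be integrable; integrability at the good level follows from its finite
    bound.\<close>
  define F where "F t x = ennreal (indicator K x * (1 / \<epsilon> * W ((f x - t) / (\<epsilon> * a x))))" for t x
  have Fm: "case_prod F \<in> borel_measurable (lborel \<Otimes>\<^sub>M lborel)" unfolding F_def by measurable
  have inner: "(\<integral>\<^sup>+t. F t x \<partial>lborel) = ennreal (indicator K x * a x) * ennreal (\<integral>s. W s \<partial>lborel)" for x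
  proof -
    have c: "- (\<epsilon> * a x) \<noteq> 0" using \<epsilon> a[of x] by simp
    have e: "(f x - (f x + - (\<epsilon> * a x) * s)) / (\<epsilon> * a x) = s" for s using c by simp
    have [measurable]: "(\<lambda>t. F t x) \<in> borel_measurable borel" unfolding F_def by measurable
    \<comment> \<open>The Jacobian \<open>\<epsilon> * a x\<close> cancels the factor
      \<open>1 / \<epsilon>\<close> and leaves the weight \<open>a x\<close>.\<close>
    have "(\<integral>\<^sup>+t. F t x \<partial>lborel) = ennreal \<bar>- (\<epsilon> * a x)\<bar> * (\<integral>\<^sup>+s. F (f x + - (\<epsilon> * a x) * s) x \<partial>lborel)"
      by (rule nn_integral_real_affine[OF _ c]) measurable
    also have "(\<integral>\<^sup>+s. F (f x + - (\<epsilon> * a x) * s) x \<partial>lborel) = (\<integral>\<^sup>+s. ennreal (indicator K x * (1 / \<epsilon>)) * ennreal (W s) \<partial>lborel)"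
      unfolding F_def e using \<epsilon> W(2) by (intro nn_integral_cong) (simp add: ennreal_mult[symmetric] mult.assoc)
    also have "\<dots> = ennreal (indicator K x * (1 / \<epsilon>)) * ennreal (\<integral>s. W s \<partial>lborel)"
      using W by (subst nn_integral_cmult) (auto simp: nn_integral_eq_integral)
    also have "ennreal \<bar>- (\<epsilon> * a x)\<bar> * (ennreal (indicator K x * (1 / \<epsilon>)) * ennreal (\<integral>s. W s \<partial>lborel))
       = ennreal (indicator K x * a x) * ennreal (\<integral>s. W s \<partial>lborel)"
      using \<epsilon> a[of x] by (simp add: mult.assoc[symmetric] ennreal_mult[symmetric] abs_mult mult.commute[of "a x"])
    finally show ?thesis .
  qed
  have aK: "0 \<le> indicator K x * a x" for x using a[of x] by (auto simp: indicator_def)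
  have IW: "0 \<le> (\<integral>s. W s \<partial>lborel)" by (rule Bochner_Integration.integral_nonneg) (rule W(2))
  have "(\<integral>\<^sup>+t. \<integral>\<^sup>+x. F t x \<partial>lborel \<partial>lborel) = (\<integral>\<^sup>+x. \<integral>\<^sup>+t. F t x \<partial>lborel \<partial>lborel)"
    by (rule lborel_pair.Fubini'[OF Fm, symmetric])
  also have "\<dots> = (\<integral>\<^sup>+x. ennreal (indicator K x * a x) \<partial>lborel) * ennreal (\<integral>s. W s \<partial>lborel)"
    unfolding inner by (rule nn_integral_multc) measurable
  also have "\<dots> = ennreal ((\<integral>x. indicator K x * a x \<partial>lborel) * (\<integral>s. W s \<partial>lborel))"
    using iA aK IW by (subst nn_integral_eq_integral) (auto simp: ennreal_mult Bochner_Integration.integral_nonneg)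
  finally have tot: "(\<integral>\<^sup>+t. \<integral>\<^sup>+x. F t x \<partial>lborel \<partial>lborel) = ennreal ((\<integral>x. indicator K x * a x \<partial>lborel) * (\<integral>s. W s \<partial>lborel))" .
  have "\<exists>t\<in>{\<tau>..1 - \<tau>}. (\<integral>\<^sup>+x. F t x \<partial>lborel) \<le> ennreal B"
  proof (rule ccontr)
    assume "\<not> ?thesis"
    then have n: "ennreal B \<le> (\<integral>\<^sup>+x. F t x \<partial>lborel)" if "t \<in> {\<tau>..1 - \<tau>}" for t using that by force
    have "ennreal (B * (1 - 2 * \<tau>)) = (\<integral>\<^sup>+t. ennreal B * indicator {\<tau>..1 - \<tau>} t \<partial>lborel)"
      using \<tau> B by (subst nn_integral_cmult_indicator) (auto simp: ennreal_mult[symmetric])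
    also have "\<dots> \<le> (\<integral>\<^sup>+t. \<integral>\<^sup>+x. F t x \<partial>lborel \<partial>lborel)"
      using n by (intro nn_integral_mono) (auto simp: indicator_def)
    finally have "B * (1 - 2 * \<tau>) \<le> (\<integral>x. indicator K x * a x \<partial>lborel) * (\<integral>s. W s \<partial>lborel)"
      unfolding tot using aK IW by (subst (asm) ennreal_le_iff) (auto simp: Bochner_Integration.integral_nonneg)
    then show False using less by simp
  qed
  then obtain t where t: "t \<in> {\<tau>..1 - \<tau>}" "(\<integral>\<^sup>+x. F t x \<partial>lborel) \<le> ennreal B" by blast
  let ?g = "\<lambda>x. indicator K x * (1 / \<epsilon> * W ((f x - t) / (\<epsilon> * a x)))"
  have g0: "0 \<le> ?g x" for x using W(2) \<epsilon> by simp
  have i: "integrable lborel ?g"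
  proof (rule integrableI_bounded)
    have "(\<integral>\<^sup>+x. ennreal (norm (?g x)) \<partial>lborel) = (\<integral>\<^sup>+x. F t x \<partial>lborel)"
      unfolding F_def using g0 by (intro nn_integral_cong) (simp only: real_norm_def abs_of_nonneg)
    then show "(\<integral>\<^sup>+x. ennreal (norm (?g x)) \<partial>lborel) < \<infinity>"
      using t(2) by (simp add: order_le_less_trans[OF _ ennreal_less_top])
  qed measurable
  have "ennreal (\<integral>x. ?g x \<partial>lborel) \<le> ennreal B"
    using t(2) nn_integral_eq_integral[OF i] g0 unfolding F_def by simp
  then have "(\<integral>x. ?g x \<partial>lborel) \<le> B" using B by simp
  with that t i show ?thesis by auto
qed

text \<open>Evaluating \<open>l\<close> at the vector \<open>A\<close> that represents it gives
  \<open>norm A * norm A = l A\<close>, which is at most \<open>c * norm A\<close>.\<close>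

lemma norm_gradient_le:
  fixes l :: "'a::euclidean_space \<Rightarrow> real"
  assumes l: "linear l" and b: "\<And>k. \<bar>l k\<bar> \<le> c * norm k"
  shows "norm (\<Sum>i\<in>Basis. l i *\<^sub>R i) \<le> c"
proof -
  define A where "A = (\<Sum>i\<in>Basis. l i *\<^sub>R i)"
  have "l A = (\<Sum>i\<in>Basis. (A \<bullet> i) * l i)"
    by (subst euclidean_representation[of A, symmetric]) (simp only: linear_sum[OF l] linear_cmul[OF l] real_scaleR_def)
  also have "\<dots> = A \<bullet> A"
    by (subst (3) A_def) (simp add: inner_sum_right mult.commute)
  finally have "norm A * norm A \<le> c * norm A"
    using b[of A] by (simp add: power2_norm_eq_inner[symmetric] power2_eq_square)
  show ?thesis
  proof (cases "norm A = 0")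
    case True
    obtain i :: 'a where "i \<in> Basis" using nonempty_Basis by blast
    then have "0 \<le> c" using b[of i] by (simp add: order_trans[OF abs_ge_zero])
    then show ?thesis using True by (simp add: A_def)
  next
    case False
    then show ?thesis using \<open>norm A * norm A \<le> c * norm A\<close> by (simp add: A_def)
  qed
qed

text \<open>The effect of the mass-correcting constant in three regimes. A first-order bound
  suffices in the thin transition layer and a second-order one in the pure phases of a fixed ball.
  On the background the leading constant has to be exactly 1, since the cost there does not vanish
  in the limit.\<close>

lemma G_shift_bounds:
  assumes s: "\<bar>s\<bar> \<le> 1"
  shows "\<bar>v\<bar> \<le> 1 \<Longrightarrow> G (v + s) \<le> G v + 3 * \<bar>s\<bar>"
    and "v = 1 \<or> v = -1 \<Longrightarrow> G (v + s) \<le> 9 / 4 * s\<^sup>2"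
    and "G (-1 + s) \<le> s\<^sup>2 * (1 + \<bar>s\<bar>)\<^sup>2"
proof -
  assume v: "\<bar>v\<bar> \<le> 1"
  have "4 * G (v + s) - 4 * G v = (1 - (v + s)\<^sup>2)\<^sup>2 - (1 - v\<^sup>2)\<^sup>2" by (simp add: G_def)
  also have "\<dots> = (s * (2 * v + s)) * ((v + s)\<^sup>2 + v\<^sup>2 - 2)"
    by (simp add: power2_eq_square algebra_simps)
  finally have "4 * G (v + s) - 4 * G v = (s * (2 * v + s)) * ((v + s)\<^sup>2 + v\<^sup>2 - 2)" .
  then have "G (v + s) - G v = (s * (2 * v + s)) * ((v + s)\<^sup>2 + v\<^sup>2 - 2) / 4" by simp
  also have "\<dots> \<le> \<bar>s\<bar> * 3 * 4 / 4"
  proof -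
    have v2: "v\<^sup>2 \<le> 1" using v by (simp add: abs_square_le_1)
    have "\<bar>v + s\<bar> \<le> 2" using v s by linarith
    then have vs: "(v + s)\<^sup>2 \<le> 4" using power_mono[of "\<bar>v + s\<bar>" 2 2] by simp
    have "\<bar>(v + s)\<^sup>2 + v\<^sup>2 - 2\<bar> \<le> 4" using v2 vs zero_le_power2[of "v + s"] zero_le_power2[of v] by linarith
    moreover have "\<bar>2 * v + s\<bar> \<le> 3" using v s by linarith
    ultimately have "\<bar>s\<bar> * \<bar>2 * v + s\<bar> * \<bar>(v + s)\<^sup>2 + v\<^sup>2 - 2\<bar> \<le> \<bar>s\<bar> * 3 * 4" by (intro mult_mono) auto
    then have "\<bar>(s * (2 * v + s)) * ((v + s)\<^sup>2 + v\<^sup>2 - 2)\<bar> \<le> \<bar>s\<bar> * 3 * 4" by (simp only: abs_mult)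
    then show ?thesis by (intro divide_right_mono) linarith+
  qed
  finally show "G (v + s) \<le> G v + 3 * \<bar>s\<bar>" by simp
next
  assume v: "v = 1 \<or> v = -1"
  have "G (v + s) = s\<^sup>2 * (2 * v + s)\<^sup>2 / 4" using v by (auto simp: G_def power2_eq_square algebra_simps)
  also have "\<dots> \<le> s\<^sup>2 * 3\<^sup>2 / 4"
  proof -
    have "\<bar>2 * v + s\<bar> \<le> 3" using v s by auto
    then have "(2 * v + s)\<^sup>2 \<le> 3\<^sup>2" using power_mono[of "\<bar>2 * v + s\<bar>" 3 2] by simp
    then show ?thesis by (intro divide_right_mono mult_left_mono) auto
  qed
  finally show "G (v + s) \<le> 9 / 4 * s\<^sup>2" by simp
next
  have "G (-1 + s) = s\<^sup>2 * ((2 - s) / 2)\<^sup>2" by (simp add: G_def power2_eq_square field_simps)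
  also have "\<dots> \<le> s\<^sup>2 * (1 + \<bar>s\<bar>)\<^sup>2"
    using s by (intro mult_left_mono power_mono) auto
  finally show "G (-1 + s) \<le> s\<^sup>2 * (1 + \<bar>s\<bar>)\<^sup>2" .
qed

text \<open>\<open>w\<close> is a 0-1 version of the phase, \<open>f\<close> its smooth
  approximation with gradient \<open>D\<close>, and the profile \<open>q\<close> is constant beyond
  \<open>S\<close>. The locale itself does not relate \<open>f\<close> to \<open>w\<close>; their
  \<open>L\<^sup>1\<close> distance enters later as \<open>e\<close>.\<close>

locale smooth_phase =
  fixes f w :: "'a::euclidean_space \<Rightarrow> real" and D :: "'a \<Rightarrow> 'a" and R \<eta> S N :: real and q q' :: "real \<Rightarrow> real"
  assumes fd: "\<And>x. (f has_derivative (\<lambda>h. D x \<bullet> h)) (at x)" and D: "C1c D"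
    and R: "R > 0" "\<And>x. norm x \<ge> R \<Longrightarrow> f x = 0" "\<And>x. norm x \<ge> R \<Longrightarrow> D x = 0"
    and \<eta>: "\<eta> > 0" and S: "S > 0" and N: "N > 0" "\<And>x h. norm (frechet_derivative D (at x) h) \<le> N * norm h"
    and dq: "\<And>s. (q has_real_derivative q' s) (at s)" and cq': "continuous_on UNIV q'"
    and q1: "\<And>s. \<bar>q s\<bar> \<le> 1" and qS: "\<And>s. s \<ge> S \<Longrightarrow> q s = 1" "\<And>s. s \<le> - S \<Longrightarrow> q s = -1"
    and q'S: "\<And>s. \<bar>s\<bar> \<ge> S \<Longrightarrow> q' s = 0"
    and w: "integrable lborel w" "\<And>x. w x = 0 \<or> w x = 1" and fi: "integrable lborel f"
begin

abbreviation "a \<equiv> regnorm D \<eta>"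

text \<open>To first order, and where \<open>D\<close> is not small, this is the signed distance to
  the level set of \<open>f\<close> at \<open>t\<close>, measured in units of
  \<open>\<epsilon>\<close>. Dividing by \<open>a\<close> instead of \<open>norm D\<close> keeps it
  defined at critical points.\<close>

definition level where "level \<epsilon> t x = (f x - t) / (\<epsilon> * a x)"
definition level' where "level' \<epsilon> t x k = (D x \<bullet> k) / (\<epsilon> * a x) - level \<epsilon> t x * ((D x \<bullet> frechet_derivative D (at x) k) / a x) / a x"
definition v where "v \<epsilon> t x = q (level \<epsilon> t x)"
definition v' where "v' \<epsilon> t x k = level' \<epsilon> t x k * q' (level \<epsilon> t x)"
definition gv where "gv \<epsilon> t x = (\<Sum>i\<in>Basis. v' \<epsilon> t x i *\<^sub>R i)"

lemma a_pos: "a x > 0" by (rule regnorm_pos[OF \<eta>])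

lemma f_continuous: "continuous_on UNIV f"
  by (intro continuous_at_imp_continuous_on ballI has_derivative_continuous[OF fd])

lemma level_has_derivative:
  assumes "\<epsilon> > 0"
  shows "(level \<epsilon> t has_derivative level' \<epsilon> t x) (at x)"
proof -
  have n: "\<epsilon> * a x \<noteq> 0" using assms a_pos[of x] by simp
  have 1: "((\<lambda>x. f x - t) has_derivative (\<lambda>k. D x \<bullet> k)) (at x)"
    using has_derivative_diff[OF fd has_derivative_const[of t]] by simp
  have 2: "((\<lambda>x. \<epsilon> * a x) has_derivative (\<lambda>k. \<epsilon> * ((D x \<bullet> frechet_derivative D (at x) k) / a x))) (at x)"
    by (rule has_derivative_mult_right[OF regnorm_has_derivative[OF \<eta> D]])
  from has_derivative_divide[OF 1 2 n] show ?thesis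
    unfolding level_def[abs_def] level'_def
    by (rule has_derivative_eq_rhs) (use assms a_pos[of x] in \<open>auto simp: level_def field_simps power2_eq_square\<close>)
qed

lemma v_has_derivative: "\<epsilon> > 0 \<Longrightarrow> (v \<epsilon> t has_derivative v' \<epsilon> t x) (at x)"
  unfolding v_def[abs_def] v'_def by (rule DERIV_compose_FDERIV[OF dq level_has_derivative])

lemma level_continuous: "\<epsilon> > 0 \<Longrightarrow> continuous_on UNIV (level \<epsilon> t)"
  by (intro continuous_at_imp_continuous_on ballI has_derivative_continuous[OF level_has_derivative])

lemma v_continuous: "\<epsilon> > 0 \<Longrightarrow> continuous_on UNIV (v \<epsilon> t)"
  by (intro continuous_at_imp_continuous_on ballI has_derivative_continuous[OF v_has_derivative])

lemma v'_continuous: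
  assumes "\<epsilon> > 0" "i \<in> Basis"
  shows "continuous_on UNIV (\<lambda>x. v' \<epsilon> t x i)"
proof -
  have "a x \<noteq> 0" for x using a_pos[of x] by simp
  then show ?thesis
    unfolding v'_def level'_def using assms
    by (intro continuous_intros regnorm_continuous[OF \<eta> D] C1c_continuous[OF D] C1c_continuous_partial[OF D]
        level_continuous continuous_on_compose2[OF cq' level_continuous]) auto
qed

lemma gv_continuous: "\<epsilon> > 0 \<Longrightarrow> continuous_on UNIV (gv \<epsilon> t)"
  unfolding gv_def[abs_def] by (intro continuous_intros v'_continuous)

lemma gv_inner: "i \<in> Basis \<Longrightarrow> gv \<epsilon> t x \<bullet> i = v' \<epsilon> t x i"
  by (simp add: gv_def)

text \<open>Differentiating \<open>f\<close> contributes at most \<open>1 / \<epsilon>\<close>, as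
  \<open>norm D \<le> a\<close>. Differentiating \<open>a\<close> contributes a multiple of the
  level value, which is below \<open>S\<close> in modulus wherever \<open>q'\<close> does not
  vanish: a relative error of order \<open>\<epsilon>\<close>.\<close>

lemma gv_norm:
  assumes \<epsilon>: "\<epsilon> > 0"
  shows "norm (gv \<epsilon> t x) \<le> \<bar>q' (level \<epsilon> t x)\<bar> / \<epsilon> * (1 + \<epsilon> * S * N / \<eta>)"
  unfolding gv_def
proof (rule norm_gradient_le)
  show "linear (v' \<epsilon> t x)" using v_has_derivative[OF \<epsilon>] has_derivative_linear by blast
  fix k
  show "\<bar>v' \<epsilon> t x k\<bar> \<le> \<bar>q' (level \<epsilon> t x)\<bar> / \<epsilon> * (1 + \<epsilon> * S * N / \<eta>) * norm k"
  proof (cases "\<bar>level \<epsilon> t x\<bar> \<ge> S")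
    case True
    then show ?thesis using q'S by (simp add: v'_def)
  next
    case False
    let ?A = "a x"
    have A: "?A > 0" "?A \<ge> \<eta>" "norm (D x) \<le> ?A" using a_pos regnorm_ge[OF \<eta>] by auto
    have "\<bar>D x \<bullet> k\<bar> \<le> norm (D x) * norm k" by (rule Cauchy_Schwarz_ineq2)
    also have "\<dots> \<le> ?A * norm k" using A by (intro mult_right_mono) auto
    finally have 1: "\<bar>(D x \<bullet> k) / (\<epsilon> * ?A)\<bar> \<le> norm k / \<epsilon>" using \<epsilon> A by (simp add: abs_mult field_simps)
    let ?d = "frechet_derivative D (at x) k"
    have "\<bar>D x \<bullet> ?d\<bar> \<le> norm (D x) * norm ?d" by (rule Cauchy_Schwarz_ineq2)
    also have "\<dots> \<le> ?A * (N * norm k)" using A N by (intro mult_mono) auto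
    finally have "\<bar>(D x \<bullet> ?d) / ?A\<bar> \<le> N * norm k" using A by (simp add: field_simps)
    then have "\<bar>(D x \<bullet> ?d) / ?A / ?A\<bar> \<le> N * norm k / \<eta>"
      using A \<eta> N(1) unfolding abs_divide[of _ ?A] by (intro frac_le) auto
    then have "\<bar>level \<epsilon> t x\<bar> * \<bar>(D x \<bullet> ?d) / ?A / ?A\<bar> \<le> S * (N * norm k / \<eta>)"
      using False S by (intro mult_mono) auto
    then have 2: "\<bar>level \<epsilon> t x * ((D x \<bullet> ?d) / ?A) / ?A\<bar> \<le> S * (N * norm k / \<eta>)" by (simp add: abs_mult)
    have "\<bar>level' \<epsilon> t x k\<bar> \<le> norm k / \<epsilon> + S * (N * norm k / \<eta>)"
      unfolding level'_def using 1 2 by linarith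
    then have "\<bar>level' \<epsilon> t x k\<bar> * \<bar>q' (level \<epsilon> t x)\<bar> \<le> (norm k / \<epsilon> + S * (N * norm k / \<eta>)) * \<bar>q' (level \<epsilon> t x)\<bar>"
      by (rule mult_right_mono) simp
    also have "\<dots> = \<bar>q' (level \<epsilon> t x)\<bar> / \<epsilon> * (1 + \<epsilon> * S * N / \<eta>) * norm k"
      using \<epsilon> \<eta> by (simp add: field_simps)
    finally show ?thesis by (simp add: v'_def abs_mult)
  qed
qed

text \<open>Off the ball \<open>f\<close> and \<open>D\<close> vanish, so \<open>a = \<eta>\<close>
  and the level value is \<open>- t / (\<epsilon> * \<eta>)\<close>, already beyond the transition
  layer.\<close>

lemma outside:
  assumes \<epsilon>: "\<epsilon> > 0" "\<epsilon> * \<eta> * S \<le> \<tau>" and t: "\<tau> \<le> t" and x: "norm x \<ge> R"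
  shows "v \<epsilon> t x = -1" "gv \<epsilon> t x = 0"
proof -
  have a: "a x = \<eta>" using R(3)[OF x] \<eta> by (simp add: regnorm_def)
  have "S * (\<epsilon> * \<eta>) \<le> t" using \<epsilon>(2) t by (simp add: mult_ac)
  then have "level \<epsilon> t x \<le> - S"
    using R(2)[OF x] \<epsilon> \<eta> by (simp add: level_def a field_simps)
  then show "v \<epsilon> t x = -1" "gv \<epsilon> t x = 0"
    using qS(2) q'S[of "level \<epsilon> t x"] by (auto simp: v_def gv_def v'_def)
qed

text \<open>If \<open>f\<close> is within \<open>\<tau> / 2\<close> of \<open>w\<close>, it stays at
  least one layer width away from \<open>t\<close> on the correct side, and the profile is exact.
  Otherwise the error, never more than 2, is absorbed by \<open>4 / \<tau>\<close> times
  \<open>|f x - w x|\<close>.\<close>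

lemma phase_error:
  assumes \<epsilon>: "\<epsilon> > 0" "\<And>x. \<epsilon> * a x * S \<le> \<tau> / 2" and \<tau>: "\<tau> > 0" and t: "\<tau> \<le> t" "t \<le> 1 - \<tau>"
  shows "\<bar>v \<epsilon> t x + 1 - 2 * w x\<bar> \<le> 4 / \<tau> * \<bar>f x - w x\<bar>" "\<bar>v \<epsilon> t x + 1 - 2 * w x\<bar> \<le> 2"
proof -
  show 2: "\<bar>v \<epsilon> t x + 1 - 2 * w x\<bar> \<le> 2" using q1[of "level \<epsilon> t x"] w(2)[of x] by (auto simp: v_def)
  have ea: "\<epsilon> * a x > 0" using \<epsilon> a_pos[of x] by simp
  have S2: "S * (\<epsilon> * a x) \<le> \<tau> / 2" using \<epsilon>(2)[of x] by (simp add: mult_ac)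
  show "\<bar>v \<epsilon> t x + 1 - 2 * w x\<bar> \<le> 4 / \<tau> * \<bar>f x - w x\<bar>"
  proof (cases "\<bar>f x - w x\<bar> \<ge> \<tau> / 2")
    case True
    then have "2 \<le> 4 / \<tau> * \<bar>f x - w x\<bar>" using \<tau> by (simp add: field_simps)
    then show ?thesis using 2 by linarith
  next
    case False
    consider "w x = 0" | "w x = 1" using w(2) by blast
    then have "v \<epsilon> t x + 1 - 2 * w x = 0"
    proof cases
      case 1
      then have "f x - t \<le> - (S * (\<epsilon> * a x))" using False t S2 by (auto simp: abs_less_iff not_le)
      then have "level \<epsilon> t x \<le> - S" using ea by (simp add: level_def divide_le_eq)
      then show ?thesis using 1 qS(2) by (simp add: v_def)
    next
      case 2
      then have "f x > 1 - \<tau> / 2" using False by (simp add: abs_if split: if_splits)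
      then have "f x - t \<ge> S * (\<epsilon> * a x)" using t S2 by linarith
      then have "level \<epsilon> t x \<ge> S" using ea by (simp add: level_def le_divide_eq)
      then show ?thesis using 2 qS(1) by (simp add: v_def)
    qed
    then show ?thesis using \<tau> by simp
  qed
qed

text \<open>The constant \<open>s\<close> is present inside \<open>U\<close> only, so the competitor
  may jump across the boundary of the cube. The Sobolev condition looks at the interior alone, where
  \<open>u\<close> agrees with a \<open>C\<^sup>1\<close> function.\<close>

lemma competitor_H1:
  assumes \<epsilon>: "\<epsilon> > 0" and U: "open U" "bounded U" and u: "\<And>x. x \<in> U \<Longrightarrow> u x = v \<epsilon> t x + s"
  shows "H1_grad U u (gv \<epsilon> t)"
proof -
  have iU: "integrable lebesgue (indicator U :: 'a \<Rightarrow> real)" by (rule integrable_indicator_bounded_lebesgue[OF U])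
  have [measurable]: "U \<in> sets borel" using U by simp
  have [measurable]: "v \<epsilon> t \<in> borel_measurable borel" "gv \<epsilon> t \<in> borel_measurable borel"
    using v_continuous[OF \<epsilon>] gv_continuous[OF \<epsilon>] by (auto intro: borel_measurable_continuous_onI)
  have iu: "(\<lambda>x. indicator U x * (u x) ^ k) = (\<lambda>x. indicator U x * (v \<epsilon> t x + s) ^ k)" for k
    by (rule ext) (simp add: indicator_def u)
  obtain M where M: "\<And>x. x \<in> U \<Longrightarrow> norm (gv \<epsilon> t x) \<le> M"
  proof -
    have "compact (closure U)" using U(2) by simp
    then have "compact (gv \<epsilon> t ` closure U)"
      by (intro compact_continuous_image continuous_on_subset[OF gv_continuous[OF \<epsilon>]]) auto
    then obtain M where "\<And>y. y \<in> gv \<epsilon> t ` closure U \<Longrightarrow> norm y \<le> M" using compact_imp_bounded bounded_iff by metis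
    then show ?thesis using that closure_subset by (metis imageI subsetD)
  qed
  have vb: "\<bar>v \<epsilon> t x\<bar> \<le> 1" for x by (simp add: v_def q1)
  have "set_borel_measurable lebesgue U u"
    unfolding set_borel_measurable_def using iu[of 1] by (simp add: measurable_borel_lebesgue)
  moreover have "set_borel_measurable lebesgue U (gv \<epsilon> t)"
    unfolding set_borel_measurable_def by (simp add: measurable_completion)
  moreover have "set_integrable lebesgue U (\<lambda>x. (u x)\<^sup>2)"
    unfolding set_integrable_def real_scaleR_def iu
  proof (rule Bochner_Integration.integrable_bound[OF integrable_mult_right[OF iU, of "(1 + \<bar>s\<bar>)\<^sup>2"]])
    show "(\<lambda>x. indicator U x * (v \<epsilon> t x + s)\<^sup>2) \<in> borel_measurable lebesgue"
      by (rule measurable_borel_lebesgue) measurable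
    have "(v \<epsilon> t x + s)\<^sup>2 \<le> (1 + \<bar>s\<bar>)\<^sup>2" for x
      using vb[of x] by (intro abs_le_square_iff[THEN iffD1]) auto
    then show "AE x in lebesgue. norm (indicator U x * (v \<epsilon> t x + s)\<^sup>2) \<le> norm ((1 + \<bar>s\<bar>)\<^sup>2 * indicator U x)"
      by (intro AE_I2) (auto simp: indicator_def)
  qed
  moreover have "set_integrable lebesgue U (\<lambda>x. (norm (gv \<epsilon> t x))\<^sup>2)"
    unfolding set_integrable_def real_scaleR_def
  proof (rule Bochner_Integration.integrable_bound[OF integrable_mult_right[OF iU, of "M\<^sup>2"]])
    show "(\<lambda>x. indicator U x * (norm (gv \<epsilon> t x))\<^sup>2) \<in> borel_measurable lebesgue"
      by (rule measurable_borel_lebesgue) measurable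
    show "AE x in lebesgue. norm (indicator U x * (norm (gv \<epsilon> t x))\<^sup>2) \<le> norm (M\<^sup>2 * indicator U x)"
      using power_mono[OF M norm_ge_zero, of _ 2] by (intro AE_I2) (auto simp: indicator_def)
  qed
  moreover have "(LINT x:U|lebesgue. u x * frechet_derivative \<psi> (at x) i) = - (LINT x:U|lebesgue. (gv \<epsilon> t x \<bullet> i) * \<psi> x)"
    if i: "i \<in> Basis" and \<psi>: "C1c \<psi>" "supp \<psi> \<subseteq> U" for i and \<psi> :: "'a \<Rightarrow> real"
  proof -
    have dv: "((\<lambda>x. v \<epsilon> t x + s) has_derivative v' \<epsilon> t x) (at x)" for x
      using has_derivative_add[OF v_has_derivative[OF \<epsilon>] has_derivative_const[of s]] by simp
    have out: "\<psi> x = 0" "frechet_derivative \<psi> (at x) i = 0" if "x \<notin> U" for x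
    proof -
      have "x \<notin> supp \<psi>" using that \<psi>(2) by blast
      then show "\<psi> x = 0" "frechet_derivative \<psi> (at x) i = 0" by (simp_all add: not_in_supp)
    qed
    have [measurable]: "\<psi> \<in> borel_measurable borel" "(\<lambda>x. frechet_derivative \<psi> (at x) i) \<in> borel_measurable borel"
      using C1c_continuous[OF \<psi>(1)] C1c_continuous_partial[OF \<psi>(1) i] by (auto intro: borel_measurable_continuous_onI)
    have [measurable]: "(\<lambda>x. v' \<epsilon> t x i) \<in> borel_measurable borel"
      by (intro borel_measurable_continuous_onI v'_continuous \<epsilon> i)
    have "(LINT x:U|lebesgue. u x * frechet_derivative \<psi> (at x) i) = (LINT x|lebesgue. (v \<epsilon> t x + s) * frechet_derivative \<psi> (at x) i)"
      unfolding set_lebesgue_integral_def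
      by (intro Bochner_Integration.integral_cong refl) (auto simp: indicator_def u out)
    also have "\<dots> = (\<integral>x. (v \<epsilon> t x + s) * frechet_derivative \<psi> (at x) i \<partial>lborel)"
      by (rule integral_completion) measurable
    also have "\<dots> = - (\<integral>x. v' \<epsilon> t x i * \<psi> x \<partial>lborel)"
      by (rule integration_by_parts_C1c(3)[OF dv v'_continuous[OF \<epsilon>] \<psi>(1) i])
    also have "(\<integral>x. v' \<epsilon> t x i * \<psi> x \<partial>lborel) = (LINT x|lebesgue. v' \<epsilon> t x i * \<psi> x)"
      by (rule integral_completion[symmetric]) measurable
    also have "\<dots> = (LINT x:U|lebesgue. (gv \<epsilon> t x \<bullet> i) * \<psi> x)"
      unfolding set_lebesgue_integral_def
      by (intro Bochner_Integration.integral_cong refl) (auto simp: indicator_def gv_inner[OF i] out)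
    finally show ?thesis .
  qed
  ultimately show ?thesis unfolding H1_grad_def by blast
qed

end

section \<open>Mass, distance and energy of one competitor\<close>

context smooth_phase
begin

definition cost where "cost s = (q' s)\<^sup>2 / 2 + G (q s)"

lemma cost_props: "0 \<le> cost s" "integrable lborel cost"
proof -
  show "0 \<le> cost s" by (simp add: cost_def G_nonneg)
  have "continuous_on UNIV q" using dq DERIV_isCont by (intro continuous_at_imp_continuous_on) blast
  then have c: "continuous_on UNIV cost" unfolding cost_def[abs_def] G_def by (intro continuous_intros cq') auto
  have "cost s = 0" if "norm s \<ge> S" for s
  proof -
    have "s \<ge> S \<or> s \<le> - S" using that by auto
    then have "q s = 1 \<or> q s = -1" using qS by auto
    then show ?thesis using q'S[of s] that by (auto simp: cost_def G_def)
  qed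
  then show "integrable lborel cost" by (intro continuous_vanishing_integrable[OF c, of S])
qed

text \<open>A bound at one fixed scale with every error explicit, so that all limits can be taken
  afterwards. \<open>sb\<close> bounds the shift: the integral of \<open>v + 1\<close> lies between
  0 and twice the volume \<open>\<kappa>\<close> of the ball.\<close>

lemma recovery_step:
  fixes \<phi> L p \<tau> B e :: real and u0 :: "'a \<Rightarrow> real"
  defines "V \<equiv> (\<phi> * L) ^ DIM('a)" and "\<kappa> \<equiv> measure lborel (cball (0::'a) R)"
  defines "sb \<equiv> \<phi> + 2 * \<kappa> / V"
  assumes pos: "\<phi> > 0" "L > 0" and KU: "cball 0 R \<subseteq> interior (Omega \<phi> L :: 'a set)" and p: "p > 1"
    and \<tau>: "0 < \<tau>" "\<tau> < 1 / 2" and small: "\<And>x. \<phi> * a x * S \<le> \<tau> / 2" and sb1: "sb \<le> 1"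
    and u0: "u0 \<in> borel_measurable lebesgue" "AE x in lebesgue. u0 x = 2 * w x - 1"
    and B: "B \<ge> 0"
    and less: "(\<integral>x. indicator (cball 0 R) x * a x \<partial>lborel)
      * ((1 + \<phi> * S * N / \<eta>)\<^sup>2 * (\<integral>s. cost s \<partial>lborel) + 6 * S * sb) < B * (1 - 2 * \<tau>)"
    and e: "(\<integral>x. \<bar>f x - w x\<bar> \<partial>lborel) \<le> e"
  shows "\<exists>u. minus1_Lp p u
     \<and> (\<integral>\<^sup>+x. ennreal (\<bar>u x - u0 x\<bar> powr p) \<partial>lebesgue) \<le> ennreal (2 powr p * (2 powr p * (4 / \<tau> * e) + sb powr p * V))
     \<and> E_phiL \<phi> L u \<le> ereal (B + 9 / 4 * sb\<^sup>2 * \<kappa> / \<phi>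
         + (1 + sb)\<^sup>2 * (\<bar>\<phi> * V - 2 * (\<integral>x. w x \<partial>lborel)\<bar> + 4 / \<tau> * e)\<^sup>2 / (\<phi> * V) - V * G (-1 + \<phi>) / \<phi>)"
proof -
  let ?\<Omega> = "Omega \<phi> L :: 'a set"
  let ?K = "cball (0::'a) R"
  define U where "U = interior ?\<Omega>"
  have V: "V > 0" using pos by (simp add: V_def)
  have \<kappa>: "\<kappa> \<ge> 0" by (simp add: \<kappa>_def)
  have sb0: "sb \<ge> 0" using pos V \<kappa> by (simp add: sb_def)
  have oU: "open U" "bounded U" unfolding U_def using bounded_interior_Omega by auto
  have UO: "U \<subseteq> ?\<Omega>" "?K \<subseteq> U" unfolding U_def using interior_subset KU by auto
  have KO: "?K \<subseteq> ?\<Omega>" using UO by blast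
  have [measurable]: "?\<Omega> \<in> sets borel" "U \<in> sets borel" by (auto simp: Omega_def U_def)
  have bO: "bounded ?\<Omega>" by (simp add: Omega_def)
  have iO: "integrable lborel (indicator ?\<Omega> :: 'a \<Rightarrow> real)" by (rule integrable_indicator_bounded[OF bO]) simp
  have iK: "integrable lborel (indicator ?K :: 'a \<Rightarrow> real)" by (rule integrable_indicator_bounded) auto
  have iU: "integrable lborel (indicator U :: 'a \<Rightarrow> real)" by (rule integrable_indicator_bounded[OF oU(2)]) simp
  have VO: "measure lborel ?\<Omega> = V" using Omega_measure[OF pos, where 'a='a] by (simp add: V_def Omega_def)
  have VU: "measure lborel U = V" using interior_Omega_measure[OF pos, where 'a='a] by (simp add: V_def U_def)
  define c1 where "c1 = (1 + \<phi> * S * N / \<eta>)\<^sup>2"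
  have "1 + \<phi> * S * N / \<eta> \<ge> 1" using pos S N \<eta> by simp
  then have c1: "c1 \<ge> 1" unfolding c1_def by (rule one_le_power)
  \<comment> \<open>The gradient error and the first-order error of the shift are both built into
    the function to be averaged, so a single level controls them together; the second contributes
    \<open>3 * sb\<close> times the layer length \<open>2 * S\<close>.\<close>
  define W where "W s = c1 * cost s + 3 * sb * indicator {- S..S} s" for s
  have iI: "integrable lborel (indicator {- S..S} :: real \<Rightarrow> real)" by (rule integrable_indicator_bounded) auto
  have W0: "0 \<le> W s" for s using c1 cost_props(1)[of s] sb0 by (simp add: W_def)
  have iW: "integrable lborel W" unfolding W_def using cost_props(2) iI by simp
  have IW: "(\<integral>s. W s \<partial>lborel) = c1 * (\<integral>s. cost s \<partial>lborel) + 6 * S * sb"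
    unfolding W_def using cost_props(2) iI S by simp
  have fm[measurable]: "f \<in> borel_measurable borel" using f_continuous by (rule borel_measurable_continuous_onI)
  have am[measurable]: "a \<in> borel_measurable borel" using regnorm_continuous[OF \<eta> D] by (rule borel_measurable_continuous_onI)
  have iA: "integrable lborel (\<lambda>x. indicator ?K x * a x)"
    using borel_integrable_compact[of ?K a] continuous_on_subset[OF regnorm_continuous[OF \<eta> D]] by simp
  obtain t where t: "\<tau> \<le> t" "t \<le> 1 - \<tau>"
    and iJ: "integrable lborel (\<lambda>x. indicator ?K x * (1 / \<phi> * W ((f x - t) / (\<phi> * a x))))"
    and J: "(\<integral>x. indicator ?K x * (1 / \<phi> * W ((f x - t) / (\<phi> * a x))) \<partial>lborel) \<le> B"
    by (rule averaging[OF fm am _ a_pos iA iW W0 pos(1) \<tau>(2) B]) (use less in \<open>auto simp: IW c1_def\<close>)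
  have lev: "(f x - t) / (\<phi> * a x) = level \<phi> t x" for x by (simp add: level_def)
  let ?v = "v \<phi> t"
  have vb: "\<bar>?v x\<bar> \<le> 1" for x by (simp add: v_def q1)
  have v1: "0 \<le> ?v x + 1" for x using vb[of x] by linarith
  have "\<phi> * \<eta> * S \<le> \<phi> * a 0 * S" using regnorm_ge(1)[OF \<eta>, of D 0] pos S by (intro mult_right_mono mult_left_mono) auto
  then have small\<eta>: "\<phi> * \<eta> * S \<le> \<tau>" using small[of 0] \<tau> by linarith
  have out: "?v x = -1" "gv \<phi> t x = 0" if "x \<notin> ?K" for x
    using outside[OF pos(1) small\<eta> t(1), of x] that by auto
  have vm[measurable]: "?v \<in> borel_measurable borel" "gv \<phi> t \<in> borel_measurable borel"
    using v_continuous[OF pos(1)] gv_continuous[OF pos(1)] by (auto intro: borel_measurable_continuous_onI)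
  have iv: "integrable lborel (\<lambda>x. ?v x + 1)"
  proof (rule Bochner_Integration.integrable_bound[OF integrable_mult_right[OF iK, of 2]])
    show "AE x in lborel. norm (?v x + 1) \<le> norm (2 * indicator ?K x :: real)"
    proof (rule AE_I2)
      fix x
      have "\<bar>?v x + 1\<bar> \<le> 2" using vb[of x] by linarith
      then show "norm (?v x + 1) \<le> norm (2 * indicator ?K x :: real)" using out(1)[of x] by (cases "x \<in> ?K") auto
    qed
  qed measurable
  define \<mu> where "\<mu> = (\<integral>x. ?v x + 1 \<partial>lborel)"
  have \<mu>0: "0 \<le> \<mu>" unfolding \<mu>_def by (rule Bochner_Integration.integral_nonneg) (rule v1)
  have "\<mu> \<le> (\<integral>x. 2 * indicator ?K x \<partial>lborel)"
    unfolding \<mu>_def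
  proof (rule integral_mono[OF iv])
    fix x
    have "?v x \<le> 1" using vb[of x] by linarith
    then show "?v x + 1 \<le> 2 * indicator ?K x" using out(1)[of x] by (cases "x \<in> ?K") auto
  qed (use iK in simp)
  then have \<mu>2: "\<mu> \<le> 2 * \<kappa>" by (simp add: \<kappa>_def)
  have err: "\<bar>?v x + 1 - 2 * w x\<bar> \<le> 4 / \<tau> * \<bar>f x - w x\<bar>" "\<bar>?v x + 1 - 2 * w x\<bar> \<le> 2" for x
    using phase_error[OF pos(1) small \<tau>(1) t] by auto
  have ifw: "integrable lborel (\<lambda>x. \<bar>f x - w x\<bar>)" using fi w(1) by simp
  have "\<bar>\<mu> - 2 * (\<integral>x. w x \<partial>lborel)\<bar> = \<bar>\<integral>x. ?v x + 1 - 2 * w x \<partial>lborel\<bar>"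
    unfolding \<mu>_def using Bochner_Integration.integral_diff[OF iv integrable_mult_right[OF w(1), of 2]] by simp
  also have "\<dots> \<le> (\<integral>x. \<bar>?v x + 1 - 2 * w x\<bar> \<partial>lborel)" by (rule integral_abs_bound)
  also have "\<dots> \<le> (\<integral>x. 4 / \<tau> * \<bar>f x - w x\<bar> \<partial>lborel)"
    by (rule integral_mono) (use iv w(1) ifw err(1) in auto)
  also have "\<dots> \<le> 4 / \<tau> * e" using e \<tau> by (simp add: divide_right_mono)
  finally have \<mu>w: "\<bar>\<mu> - 2 * (\<integral>x. w x \<partial>lborel)\<bar> \<le> 4 / \<tau> * e" .
  \<comment> \<open>The excess \<open>\<mu>\<close> already present is deducted from the prescribed
    mass \<open>\<phi> * V\<close>, and the rest is spread over the cube.\<close>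
  define s where "s = \<phi> - \<mu> / V"
  have "\<mu> / V \<le> 2 * \<kappa> / V" using \<mu>2 V by (simp add: divide_right_mono)
  moreover have "0 \<le> \<mu> / V" using \<mu>0 V by simp
  moreover have "0 \<le> 2 * \<kappa> / V" using \<kappa> V by simp
  ultimately have s: "\<bar>s\<bar> \<le> sb" using pos(1) unfolding s_def sb_def by linarith
  then have s1: "\<bar>s\<bar> \<le> 1" using sb1 by simp
  have sV: "s * V = \<phi> * V - \<mu>" using V by (simp add: s_def field_simps)
  define u where "u x = (if x \<in> ?\<Omega> then ?v x + s else -1)" for x
  have um[measurable]: "u \<in> borel_measurable borel" unfolding u_def by measurable
  have uml: "u \<in> borel_measurable lebesgue" by (rule measurable_borel_lebesgue[OF um])
  have Lp: "minus1_Lp p u"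
    unfolding minus1_Lp_def
  proof (intro conjI uml)
    have "(\<integral>\<^sup>+x. ennreal (\<bar>u x + 1\<bar> powr p) \<partial>lebesgue) \<le> (\<integral>\<^sup>+x. ennreal (3 powr p) * indicator ?\<Omega> x \<partial>lebesgue)"
    proof (rule nn_integral_mono)
      fix x
      have "\<bar>?v x + s + 1\<bar> \<le> 3" using vb[of x] s1 by linarith
      then have "\<bar>?v x + s + 1\<bar> powr p \<le> 3 powr p" using p by (intro powr_mono2) auto
      then show "ennreal (\<bar>u x + 1\<bar> powr p) \<le> ennreal (3 powr p) * indicator ?\<Omega> x"
        by (auto simp: u_def indicator_def)
    qed
    also have "\<dots> = ennreal (3 powr p) * emeasure lborel ?\<Omega>"
      by (subst nn_integral_cmult_indicator) auto
    also have "\<dots> < \<infinity>" using emeasure_bounded_finite[OF bO] by (simp add: ennreal_mult_less_top)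
    finally show "(\<integral>\<^sup>+x. ennreal (\<bar>u x + 1\<bar> powr p) \<partial>lebesgue) < \<infinity>" .
  qed
  have dist: "(\<integral>\<^sup>+x. ennreal (\<bar>u x - u0 x\<bar> powr p) \<partial>lebesgue) \<le> ennreal (2 powr p * (2 powr p * (4 / \<tau> * e) + sb powr p * V))"
  proof -
    let ?h = "\<lambda>x. 2 powr p * (2 powr p * (4 / \<tau> * \<bar>f x - w x\<bar>) + sb powr p * indicator ?\<Omega> x)"
    have ih: "integrable lborel ?h" using ifw iO by simp
    have h0: "0 \<le> ?h x" for x using \<tau> by simp
    have "AE x in lebesgue. ennreal (\<bar>u x - u0 x\<bar> powr p) \<le> ennreal (?h x)"
      using u0(2)
    proof eventually_elim
      case (elim x)
      define z where "z = \<bar>?v x + 1 - 2 * w x\<bar>"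
      have z: "0 \<le> z" "z \<le> 2" "z \<le> 4 / \<tau> * \<bar>f x - w x\<bar>" using err[of x] by (auto simp: z_def)
      \<comment> \<open>As \<open>z \<le> 2\<close>, its \<open>p\<close>-th power is at most
        \<open>2 powr p * z\<close>, so the \<open>L\<^sup>1\<close> error controls the
        \<open>L\<^sup>p\<close> error.\<close>
      have zp: "z powr p \<le> 2 powr p * (4 / \<tau> * \<bar>f x - w x\<bar>)"
      proof (cases "z = 0")
        case True then show ?thesis using \<tau> by simp
      next
        case False
        then have "z powr p = z powr (p - 1) * z" using z by (simp add: powr_diff)
        also have "\<dots> \<le> 2 powr p * z"
        proof (rule mult_right_mono)
          have "z powr (p - 1) \<le> 2 powr (p - 1)" using z p by (intro powr_mono2) auto
          also have "\<dots> \<le> 2 powr p" by (intro powr_mono) auto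
          finally show "z powr (p - 1) \<le> 2 powr p" .
        qed (use z in auto)
        also have "\<dots> \<le> 2 powr p * (4 / \<tau> * \<bar>f x - w x\<bar>)" using z by (intro mult_left_mono) auto
        finally show ?thesis .
      qed
      have "\<bar>u x - u0 x\<bar> \<le> z + sb * indicator ?\<Omega> x"
      proof (cases "x \<in> ?\<Omega>")
        case True
        have "\<bar>?v x + s - u0 x\<bar> \<le> z + sb" unfolding z_def elim using s by linarith
        then show ?thesis using True by (simp add: u_def)
      next
        case False
        then have "?v x = -1" using out(1)[of x] KO by blast
        then show ?thesis using False by (simp add: u_def z_def elim)
      qed
      then have "\<bar>u x - u0 x\<bar> powr p \<le> (z + sb * indicator ?\<Omega> x) powr p" using p by (intro powr_mono2) auto
      also have "\<dots> \<le> 2 powr p * (z powr p + (sb * indicator ?\<Omega> x) powr p)" using z sb0 p by (intro powr_add_bound) auto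
      also have "(sb * indicator ?\<Omega> x) powr p = sb powr p * indicator ?\<Omega> x" by (simp add: indicator_def)
      also have "2 powr p * (z powr p + sb powr p * indicator ?\<Omega> x) \<le> ?h x" using zp by (intro mult_left_mono add_mono) auto
      finally show ?case by (rule ennreal_leI)
    qed
    then have "(\<integral>\<^sup>+x. ennreal (\<bar>u x - u0 x\<bar> powr p) \<partial>lebesgue) \<le> (\<integral>\<^sup>+x. ennreal (?h x) \<partial>lebesgue)"
      by (rule nn_integral_mono_AE)
    also have "\<dots> = (\<integral>\<^sup>+x. ennreal (?h x) \<partial>lborel)" by (rule nn_integral_completion)
    also have "\<dots> = ennreal (\<integral>x. ?h x \<partial>lborel)" by (rule nn_integral_eq_integral[OF ih]) (use h0 in auto)
    also have "(\<integral>x. ?h x \<partial>lborel) = 2 powr p * (2 powr p * (4 / \<tau> * (\<integral>x. \<bar>f x - w x\<bar> \<partial>lborel)) + sb powr p * V)"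
      using ifw iO VO by simp
    also have "ennreal \<dots> \<le> ennreal (2 powr p * (2 powr p * (4 / \<tau> * e) + sb powr p * V))"
      using e \<tau> by (intro ennreal_leI mult_left_mono add_right_mono) auto
    finally show ?thesis .
  qed
  have uU: "u x = ?v x + s" if "x \<in> U" for x using that UO by (auto simp: u_def)
  have H: "H1_grad U u (gv \<phi> t)" by (rule competitor_H1[OF pos(1) oU uU])
  have adm: "admissible \<phi> L u"
    unfolding admissible_def
  proof (intro conjI)
    show "\<exists>g. H1_grad (interior ?\<Omega>) u g" using H unfolding U_def by blast
    show "AE x in lebesgue. x \<notin> ?\<Omega> \<longrightarrow> u x = - 1" by (intro AE_I2) (simp add: u_def)
    have "integrable lborel (\<lambda>x. indicator ?\<Omega> x * (?v x + s) ^ 4)"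
    proof (rule Bochner_Integration.integrable_bound[OF integrable_mult_right[OF iO, of "2 ^ 4"]])
      have "\<bar>?v x + s\<bar> \<le> 2" for x using vb[of x] s1 by linarith
      then have "\<bar>?v x + s\<bar> ^ 4 \<le> 2 ^ 4" for x by (rule power_mono) simp
      then show "AE x in lborel. norm (indicator ?\<Omega> x * (?v x + s) ^ 4) \<le> norm (2 ^ 4 * indicator ?\<Omega> x :: real)"
        by (intro AE_I2) (auto simp: indicator_def power_abs)
    qed measurable
    then have "integrable lebesgue (\<lambda>x. indicator ?\<Omega> x * (?v x + s) ^ 4)"
      by (subst integrable_completion) measurable
    moreover have "indicator ?\<Omega> x * (?v x + s) ^ 4 = indicator ?\<Omega> x *\<^sub>R (u x) ^ 4" for x by (simp add: u_def indicator_def)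
    ultimately show "set_integrable lebesgue ?\<Omega> (\<lambda>x. (u x) ^ 4)" by (simp add: set_integrable_def)
    have "(LINT x:?\<Omega>|lebesgue. u x) = (LINT x|lebesgue. (?v x + 1) + (s - 1) * indicator ?\<Omega> x)"
      unfolding set_lebesgue_integral_def
    proof (intro Bochner_Integration.integral_cong refl)
      fix x
      show "indicator ?\<Omega> x *\<^sub>R u x = (?v x + 1) + (s - 1) * indicator ?\<Omega> x"
      proof (cases "x \<in> ?\<Omega>")
        case False
        then have "x \<notin> ?K" using KO by blast
        then show ?thesis using out(1) False by simp
      qed (simp add: u_def)
    qed
    also have "\<dots> = (\<integral>x. (?v x + 1) + (s - 1) * indicator ?\<Omega> x \<partial>lborel)"
      by (rule integral_completion) measurable
    also have "\<dots> = \<mu> + (s - 1) * V" using iv iO VO by (simp add: \<mu>_def)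
    also have "\<dots> = (-1 + \<phi>) * V" using sV by (simp add: algebra_simps)
    finally show "(LINT x:?\<Omega>|lebesgue. u x) / measure lebesgue ?\<Omega> = - 1 + \<phi>"
      unfolding Omega_measure[OF pos] V_def[symmetric] using V by simp
  qed
  obtain g where g: "H1_grad U u g" and i1: "integrable lebesgue (\<lambda>x. indicator U x * (norm (g x))\<^sup>2)"
    and i2: "integrable lebesgue (\<lambda>x. indicator U x * G (u x))"
    and Eq: "E_phiL \<phi> L u = ereal (\<phi> / 2 * (LINT x|lebesgue. indicator U x * (norm (g x))\<^sup>2)
       + 1 / \<phi> * (LINT x|lebesgue. indicator U x * G (u x)) - V * G (-1 + \<phi>) / \<phi>)"
    using energy_expand[OF adm uml pos] unfolding U_def V_def by blast
  \<comment> \<open>The gradient hidden in \<open>E_phiL\<close> is an unknown choice; uniqueness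
    identifies it with the explicit one.\<close>
  have gg: "AE x in lebesgue. x \<in> U \<longrightarrow> g x = gv \<phi> t x" by (rule weak_gradient_unique[OF g H oU])
  \<comment> \<open>Three contributions: the averaged layer cost, the second-order error of the pure
    phases in the ball, and the background.\<close>
  let ?r = "\<lambda>x. indicator ?K x * (1 / \<phi> * W (level \<phi> t x)) + 9 / 4 * sb\<^sup>2 / \<phi> * indicator ?K x + s\<^sup>2 * (1 + sb)\<^sup>2 / \<phi> * indicator U x"
  have ir: "integrable lborel ?r" using iJ[unfolded lev] iK iU by (intro Bochner_Integration.integrable_add integrable_mult_right)
  then have rm[measurable]: "?r \<in> borel_measurable borel" by (auto dest: borel_measurable_integrable)
  have irl: "integrable lebesgue ?r" using ir by (subst integrable_completion) auto
  have pt: "\<phi> / 2 * (norm (gv \<phi> t x))\<^sup>2 + 1 / \<phi> * G (u x) \<le> ?r x" if xU: "x \<in> U" for x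
  proof (cases "x \<in> ?K")
    case False
    have "G (u x) \<le> s\<^sup>2 * (1 + \<bar>s\<bar>)\<^sup>2"
      using G_shift_bounds(3)[OF s1] out(1)[OF False] uU[OF xU] by simp
    also have "\<dots> \<le> s\<^sup>2 * (1 + sb)\<^sup>2" using s by (intro mult_left_mono power_mono) auto
    finally have "1 / \<phi> * G (u x) \<le> 1 / \<phi> * (s\<^sup>2 * (1 + sb)\<^sup>2)" using pos(1) by (intro mult_left_mono) auto
    then show ?thesis using out(2)[OF False] False xU by simp
  next
    case True
    let ?l = "level \<phi> t x"
    have "(norm (gv \<phi> t x))\<^sup>2 \<le> (\<bar>q' ?l\<bar> / \<phi> * (1 + \<phi> * S * N / \<eta>))\<^sup>2"
      by (rule power_mono[OF gv_norm[OF pos(1)] norm_ge_zero])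
    also have "\<dots> = (q' ?l)\<^sup>2 / \<phi>\<^sup>2 * c1" by (simp add: c1_def power_mult_distrib power_divide)
    finally have "\<phi> / 2 * (norm (gv \<phi> t x))\<^sup>2 \<le> \<phi> / 2 * ((q' ?l)\<^sup>2 / \<phi>\<^sup>2 * c1)" using pos(1) by (intro mult_left_mono) auto
    also have "\<dots> = 1 / \<phi> * (c1 * ((q' ?l)\<^sup>2 / 2))" using pos(1) by (simp add: power2_eq_square field_simps)
    finally have A: "\<phi> / 2 * (norm (gv \<phi> t x))\<^sup>2 \<le> 1 / \<phi> * (c1 * ((q' ?l)\<^sup>2 / 2))" .
    have s2: "s\<^sup>2 \<le> sb\<^sup>2" using s sb0 by (metis abs_le_square_iff abs_of_nonneg)
    have Bd: "G (u x) \<le> c1 * G (q ?l) + 3 * sb * indicator {- S..S} ?l + 9 / 4 * sb\<^sup>2"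
    proof (cases "\<bar>?l\<bar> \<le> S")
      case True
      have "G (u x) \<le> G (q ?l) + 3 * \<bar>s\<bar>" using G_shift_bounds(1)[OF s1 vb[of x]] uU[OF xU] by (simp add: v_def)
      moreover have "1 * G (q ?l) \<le> c1 * G (q ?l)" using c1 by (intro mult_right_mono G_nonneg)
      moreover have "3 * sb * indicator {- S..S} ?l = 3 * sb" using True by (auto simp: abs_le_iff)
      moreover have "0 \<le> 9 / 4 * sb\<^sup>2" by simp
      ultimately show ?thesis using s by linarith
    next
      case False
      then have "?l \<ge> S \<or> ?l \<le> - S" by auto
      then have "v \<phi> t x = 1 \<or> v \<phi> t x = -1" using qS by (auto simp: v_def)
      from G_shift_bounds(2)[OF s1 this] have "G (u x) \<le> 9 / 4 * s\<^sup>2" using uU[OF xU] by simp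
      moreover have "0 \<le> c1 * G (q ?l)" using c1 G_nonneg[of "q ?l"] by simp
      moreover have "0 \<le> 3 * sb * indicator {- S..S} ?l" using sb0 by simp
      ultimately show ?thesis using s2 by linarith
    qed
    have "1 / \<phi> * G (u x) \<le> 1 / \<phi> * (c1 * G (q ?l) + 3 * sb * indicator {- S..S} ?l + 9 / 4 * sb\<^sup>2)"
      using pos(1) by (intro mult_left_mono Bd) auto
    with A have "\<phi> / 2 * (norm (gv \<phi> t x))\<^sup>2 + 1 / \<phi> * G (u x) \<le> 1 / \<phi> * W ?l + 9 / 4 * sb\<^sup>2 / \<phi>"
      by (simp add: W_def cost_def distrib_left add_divide_distrib)
    moreover have "0 \<le> s\<^sup>2 * (1 + sb)\<^sup>2 / \<phi>" using pos(1) by simp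
    ultimately show ?thesis using True xU by simp
  qed
  have "\<phi> / 2 * (LINT x|lebesgue. indicator U x * (norm (g x))\<^sup>2) + 1 / \<phi> * (LINT x|lebesgue. indicator U x * G (u x))
     = (LINT x|lebesgue. \<phi> / 2 * (indicator U x * (norm (g x))\<^sup>2) + 1 / \<phi> * (indicator U x * G (u x)))"
    using i1 i2 by simp
  also have "\<dots> \<le> (LINT x|lebesgue. ?r x)"
  proof (rule integral_mono_AE[OF _ irl])
    show "integrable lebesgue (\<lambda>x. \<phi> / 2 * (indicator U x * (norm (g x))\<^sup>2) + 1 / \<phi> * (indicator U x * G (u x)))"
      using i1 i2 by simp
    show "AE x in lebesgue. \<phi> / 2 * (indicator U x * (norm (g x))\<^sup>2) + 1 / \<phi> * (indicator U x * G (u x)) \<le> ?r x"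
      using gg
    proof eventually_elim
      case (elim x)
      show ?case
      proof (cases "x \<in> U")
        case True
        then show ?thesis using pt[OF True] elim by simp
      next
        case False
        then have "x \<notin> ?K" using UO by blast
        then show ?thesis using False by simp
      qed
    qed
  qed
  also have "\<dots> = (\<integral>x. ?r x \<partial>lborel)" by (rule integral_completion) measurable
  also have "\<dots> = (\<integral>x. indicator ?K x * (1 / \<phi> * W (level \<phi> t x)) \<partial>lborel) + 9 / 4 * sb\<^sup>2 / \<phi> * \<kappa> + s\<^sup>2 * (1 + sb)\<^sup>2 / \<phi> * V"
    using iJ[unfolded lev] iK iU VU by (simp add: \<kappa>_def)
  also have "\<dots> \<le> B + 9 / 4 * sb\<^sup>2 / \<phi> * \<kappa> + (1 + sb)\<^sup>2 * (\<bar>\<phi> * V - 2 * (\<integral>x. w x \<partial>lborel)\<bar> + 4 / \<tau> * e)\<^sup>2 / (\<phi> * V)"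
  proof -
    \<comment> \<open>\<open>s * V\<close> is the mass left to the background, and
      \<open>\<mu>\<close> is twice the integral of \<open>w\<close> up to
      \<open>4 / \<tau> * e\<close>; dividing its square by \<open>\<phi> * V\<close> produces the
      quadratic term of the limit.\<close>
    have "\<bar>s * V\<bar> \<le> \<bar>\<phi> * V - 2 * (\<integral>x. w x \<partial>lborel)\<bar> + 4 / \<tau> * e" using \<mu>w unfolding sV by linarith
    then have "(s * V)\<^sup>2 \<le> (\<bar>\<phi> * V - 2 * (\<integral>x. w x \<partial>lborel)\<bar> + 4 / \<tau> * e)\<^sup>2"
      using power_mono[of "\<bar>s * V\<bar>" _ 2] by simp
    then have "(1 + sb)\<^sup>2 * (s * V)\<^sup>2 / (\<phi> * V) \<le> (1 + sb)\<^sup>2 * (\<bar>\<phi> * V - 2 * (\<integral>x. w x \<partial>lborel)\<bar> + 4 / \<tau> * e)\<^sup>2 / (\<phi> * V)"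
      using pos V by (intro divide_right_mono mult_left_mono) auto
    moreover have "s\<^sup>2 * (1 + sb)\<^sup>2 / \<phi> * V = (1 + sb)\<^sup>2 * (s * V)\<^sup>2 / (\<phi> * V)"
      using pos V by (simp add: power_mult_distrib power2_eq_square)
    ultimately show ?thesis using J[unfolded lev] by simp
  qed
  finally have "E_phiL \<phi> L u \<le> ereal (B + 9 / 4 * sb\<^sup>2 * \<kappa> / \<phi>
         + (1 + sb)\<^sup>2 * (\<bar>\<phi> * V - 2 * (\<integral>x. w x \<partial>lborel)\<bar> + 4 / \<tau> * e)\<^sup>2 / (\<phi> * V) - V * G (-1 + \<phi>) / \<phi>)"
    unfolding Eq by simp
  with Lp dist show ?thesis by blast
qed

end

text \<open>The phase is only Lebesgue measurable. Thresholding a Borel version of its indicator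
  gives a Borel function with values exactly 0 and 1, and pairings with test fields are
  unchanged.\<close>

lemma borel_phase:
  fixes u0 :: "'a::euclidean_space \<Rightarrow> real"
  assumes p: "p > 1" and u0: "minus1_Lp p u0" and pm: "AE x in lebesgue. u0 x = 1 \<or> u0 x = -1"
  obtains w where "integrable lborel w" "\<And>x. w x = 0 \<or> w x = 1" "AE x in lebesgue. u0 x = 2 * w x - 1"
    "(\<integral>x. w x \<partial>lborel) = measure lebesgue {x. u0 x = 1}"
    "\<And>X::'a \<Rightarrow> 'a. C1c X \<Longrightarrow> (\<integral>x. w x * div_field X x \<partial>lborel) = (LINT x:{x. u0 x = 1}|lebesgue. div_field X x)"
proof -
  let ?C = "{x. u0 x = 1}"
  note C = minus1_Lp_finite_phase[OF p u0]
  have mC: "(indicator ?C :: 'a \<Rightarrow> real) \<in> borel_measurable lebesgue" using C(1) by (rule borel_measurable_integrable)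
  obtain w0 :: "'a \<Rightarrow> real" where w0: "w0 \<in> borel_measurable borel" "AE x in lebesgue. indicator ?C x = w0 x"
    using lborel_version[OF mC] by blast
  have [measurable]: "w0 \<in> borel_measurable borel" by (rule w0)
  define w :: "'a \<Rightarrow> real" where "w x = (if w0 x = 1 then 1 else 0)" for x
  have wm[measurable]: "w \<in> borel_measurable borel" unfolding w_def by measurable
  have e: "AE x in lebesgue. indicator ?C x = w x"
    using w0(2)
  proof eventually_elim
    case (elim x)
    then show ?case by (cases "u0 x = 1") (auto simp: w_def)
  qed
  have 1: "integrable lborel w" using lebesgue_integrable_version(1)[OF wm e mC] C(1) by simp
  have 2: "(\<integral>x. w x \<partial>lborel) = measure lebesgue ?C"
    using lebesgue_integrable_version(2)[OF wm e mC] by simp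
  have 3: "AE x in lebesgue. u0 x = 2 * w x - 1"
    using pm e by eventually_elim (auto simp: indicator_def split: if_splits)
  have 4: "(\<integral>x. w x * div_field X x \<partial>lborel) = (LINT x:?C|lebesgue. div_field X x)" if X: "C1c X" for X :: "'a \<Rightarrow> 'a"
  proof -
    have [measurable]: "div_field X \<in> borel_measurable borel"
      by (rule borel_measurable_continuous_onI[OF div_field_continuous[OF X]])
    have [measurable]: "div_field X \<in> borel_measurable lebesgue" by (rule measurable_borel_lebesgue) measurable
    have [measurable]: "?C \<in> sets lebesgue" by (rule C(2))
    have "(LINT x|lebesgue. indicator ?C x * div_field X x) = (\<integral>x. w x * div_field X x \<partial>lborel)"
    proof (rule lebesgue_integrable_version(2))
      show "AE x in lebesgue. indicator ?C x * div_field X x = w x * div_field X x" using e by eventually_elim simp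
    qed measurable
    then show ?thesis by (simp add: set_lebesgue_integral_def)
  qed
  show ?thesis by (rule that[OF 1 _ 3 2 4]) (auto simp: w_def)
qed

text \<open>A single parameter \<open>\<theta>\<close> controls the slack in the profile cost, the range of levels that is
  averaged over, the approximation of the phase, and the regularisation of \<open>|D|\<close>.\<close>
lemma recovery_parameter:
  fixes u0 :: "'a::euclidean_space \<Rightarrow> real" and \<phi> L :: "nat \<Rightarrow> real"
  assumes p: "1 < p" and pos: "\<And>n. \<phi> n > 0" "\<And>n. L n > 0" and \<phi>0: "\<phi> \<longlonglongrightarrow> 0"
    and big: "filterlim (\<lambda>n. \<phi> n * L n) at_top sequentially"
    and mass: "(\<lambda>n. \<phi> n * (\<phi> n * L n) ^ DIM('a)) \<longlonglongrightarrow> m" and m0: "m > 0"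
    and u0: "minus1_Lp p u0" and pm: "AE x in lebesgue. u0 x = 1 \<or> u0 x = -1"
    and Per: "Per {x. u0 x = 1} = ereal P"
    and \<theta>: "0 < \<theta>" "\<theta> < 1 / 4"
  defines "c \<equiv> measure lebesgue {x. u0 x = 1}"
  obtains Eb Lb where "Eb \<longlonglongrightarrow> (P + 2 * \<theta>) * (c0 + \<theta>) / (1 - 2 * \<theta>) + \<theta> + (\<bar>m - 2 * c\<bar> + \<theta>)\<^sup>2 / m - m"
    "Lb \<longlonglongrightarrow> 2 powr p * (2 powr p * \<theta>)"
    "eventually (\<lambda>n. \<exists>u. minus1_Lp p u \<and> (\<integral>\<^sup>+x. ennreal (\<bar>u x - u0 x\<bar> powr p) \<partial>lebesgue) \<le> ennreal (Lb n)
       \<and> E_phiL (\<phi> n) (L n) u \<le> ereal (Eb n)) sequentially"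
proof -
  obtain w where w: "integrable lborel w" "\<And>x. w x = 0 \<or> w x = 1" "AE x in lebesgue. u0 x = 2 * w x - 1"
    "(\<integral>x. w x \<partial>lborel) = c"
    "\<And>X::'a \<Rightarrow> 'a. C1c X \<Longrightarrow> (\<integral>x. w x * div_field X x \<partial>lborel) = (LINT x:{x. u0 x = 1}|lebesgue. div_field X x)"
    by (rule borel_phase[OF p u0 pm, folded c_def]) (rule that)
  have P0: "P \<ge> 0" using Per_nonneg[of "{x. u0 x = 1}"] Per by simp
  have wP: "(\<integral>x. w x * div_field X x \<partial>lborel) \<le> P" if X: "C1c X" "\<And>x. norm (X x) \<le> 1" for X :: "'a \<Rightarrow> 'a"
  proof -
    have "ereal (LINT x:{x. u0 x = 1}|lebesgue. div_field X x) \<le> Per {x. u0 x = 1}"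
      unfolding Per_def by (rule SUP_upper) (use X in simp)
    then show ?thesis using Per w(5)[OF X(1)] by simp
  qed
  have w01: "0 \<le> w x" "w x \<le> 1" for x using w(2)[of x] by auto
  \<comment> \<open>Makes the mass error \<open>4 / \<theta> * e\<close> equal to
    \<open>\<theta>\<close>, while still \<open>e \<le> \<theta>\<close>.\<close>
  define e where "e = \<theta>\<^sup>2 / 4"
  have e: "e > 0" using \<theta> by (simp add: e_def)
  have e4: "4 / \<theta> * e = \<theta>" using \<theta> by (simp add: e_def power2_eq_square)
  have "\<theta> * \<theta> \<le> \<theta> * 1" using \<theta> by (intro mult_left_mono) auto
  then have e\<theta>: "e \<le> \<theta>" using \<theta> by (simp add: e_def power2_eq_square)
  obtain f where f: "C2c f" "\<And>x. 0 \<le> f x" "\<And>x. f x \<le> 1" "integrable lborel f"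
    "(\<integral>x. \<bar>f x - w x\<bar> \<partial>lborel) \<le> e"
    "\<forall>X::'a \<Rightarrow> 'a. C1c X \<longrightarrow> (\<forall>x. norm (X x) \<le> 1) \<longrightarrow> (\<integral>x. f x * div_field X x \<partial>lborel) \<le> P + e"
    by (rule smooth_approximation[OF w(1) w01 wP e]) (assumption, simp, rule that)
  have fP: "(\<integral>x. f x * div_field X x \<partial>lborel) \<le> P + e" if "C1c X" "\<And>x. norm (X x) \<le> 1" for X :: "'a \<Rightarrow> 'a"
    using f(6) that by simp
  define D where "D x = (\<Sum>i\<in>Basis. frechet_derivative f (at x) i *\<^sub>R i)" for x
  have D: "C1c D" and fd: "\<And>x. (f has_derivative (\<lambda>h. D x \<bullet> h)) (at x)"
    using C2c_gradient[OF f(1)] unfolding D_def[abs_def] by auto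
  obtain R where R: "R > 0" "\<And>x. norm x \<ge> R \<Longrightarrow> f x = 0" "\<And>x. norm x \<ge> R \<Longrightarrow> frechet_derivative f (at x) = (\<lambda>_. 0)"
    using C1c_vanishes[of f] f(1) unfolding C2c_def by metis
  have RD: "D x = 0" if "norm x \<ge> R" for x using R(3)[OF that] by (simp add: D_def)
  define \<kappa> where "\<kappa> = measure lborel (cball (0::'a) R)"
  have \<kappa>: "\<kappa> \<ge> 0" by (simp add: \<kappa>_def)
  \<comment> \<open>The regularisation then adds at most
    \<open>\<eta> * \<kappa> \<le> \<theta>\<close> to the gradient mass; the summand 1 secures a
    positive denominator.\<close>
  define \<eta> where "\<eta> = \<theta> / (\<kappa> + 1)"
  have \<eta>: "\<eta> > 0" using \<theta> \<kappa> by (simp add: \<eta>_def)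
  have "\<eta> * \<kappa> \<le> \<eta> * (\<kappa> + 1)" using \<eta> by simp
  also have "\<dots> = \<theta>"
  proof -
    have "\<kappa> + 1 \<noteq> 0" using \<kappa> by linarith
    from nonzero_divide_eq_eq[OF this, of \<theta> "\<theta> / (\<kappa> + 1)"] show ?thesis unfolding \<eta>_def by metis
  qed
  finally have \<eta>\<kappa>: "\<eta> * \<kappa> \<le> \<theta>" .
  obtain N where N: "N > 0" "\<And>x h. norm (frechet_derivative D (at x) h) \<le> N * norm h"
    using C1c_derivative_bounded[OF D] by metis
  obtain q q' S where S: "S > 0" and q: "\<And>s. (q has_real_derivative q' s) (at s)" "continuous_on UNIV q'"
    "\<And>s. \<bar>q s\<bar> \<le> 1" "\<And>s. s \<ge> S \<Longrightarrow> q s = 1" "\<And>s. s \<le> - S \<Longrightarrow> q s = -1" "\<And>s. \<bar>s\<bar> \<ge> S \<Longrightarrow> q' s = 0"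
    "(\<integral>s. (q' s)\<^sup>2 / 2 + G (q s) \<partial>lborel) \<le> c0 + \<theta>"
    by (rule profile_exists[OF \<theta>(1)]) (rule that)
  interpret sp: smooth_phase f w D R \<eta> S N q q'
    by unfold_locales (fact fd D R(1,2) RD \<eta> S N q(1-6) w(1,2) f(4))+
  have Ia: "(\<integral>x. indicator (cball 0 R) x * regnorm D \<eta> x \<partial>lborel) \<le> P + 2 * \<theta>"
  proof -
    have "(\<integral>x. indicator (cball 0 R) x * regnorm D \<eta> x \<partial>lborel) \<le> P + e + \<eta> * measure lborel (cball (0::'a) R)"
      by (rule gradient_mass_bound(1)[OF fd D \<eta> f(4)]) (use fP RD in auto)
    then show ?thesis using \<eta>\<kappa> e\<theta> by (simp add: \<kappa>_def)
  qed
  have Ia0: "0 \<le> (\<integral>x. indicator (cball 0 R) x * regnorm D \<eta> x \<partial>lborel)"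
  proof (rule Bochner_Integration.integral_nonneg)
    fix x show "0 \<le> indicator (cball 0 R) x * regnorm D \<eta> x"
      using regnorm_pos[OF \<eta>, of D x] by (simp add: indicator_def)
  qed
  have Ic: "(\<integral>s. sp.cost s \<partial>lborel) \<le> c0 + \<theta>" using q(7) by (simp add: sp.cost_def[abs_def])
  have Ic0: "0 \<le> (\<integral>s. sp.cost s \<partial>lborel)" by (intro Bochner_Integration.integral_nonneg sp.cost_props)
  obtain MD where MD: "\<And>x. norm (D x) \<le> MD"
    by (rule continuous_vanishing_bounded[OF C1c_continuous[OF D], of R]) (use RD that in auto)
  have aM: "regnorm D \<eta> x \<le> MD + \<eta>" for x
  proof -
    have "D x \<bullet> D x + \<eta>\<^sup>2 \<le> (norm (D x) + \<eta>)\<^sup>2" using \<eta> by (simp add: power2_norm_eq_inner[symmetric] power2_sum)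
    then have "regnorm D \<eta> x \<le> norm (D x) + \<eta>" unfolding regnorm_def using \<eta> by (intro real_le_lsqrt) auto
    then show ?thesis using MD[of x] by simp
  qed
  define V where "V n = (\<phi> n * L n) ^ DIM('a)" for n
  have V: "V n > 0" for n using pos by (simp add: V_def)
  have mV: "(\<lambda>n. \<phi> n * V n) \<longlonglongrightarrow> m" using mass by (simp add: V_def)
  define sb where "sb n = \<phi> n + 2 * \<kappa> / V n" for n
  \<comment> \<open>Since \<open>\<phi> n * V n\<close> tends to \<open>m > 0\<close>, this exhibits
    \<open>sb\<close> as a bounded multiple of \<open>\<phi>\<close>, so that even
    \<open>(sb n)\<^sup>2 / \<phi> n\<close> tends to 0.\<close>
  have sb_eq: "sb n = \<phi> n * (1 + 2 * \<kappa> / (\<phi> n * V n))" for n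
    using pos(1)[of n] V[of n] by (simp add: sb_def field_simps)
  have "(\<lambda>n. \<phi> n * (1 + 2 * \<kappa> / (\<phi> n * V n))) \<longlonglongrightarrow> 0 * (1 + 2 * \<kappa> / m)"
    by (intro tendsto_intros \<phi>0 mV) (use m0 in auto)
  then have sb0: "sb \<longlonglongrightarrow> 0" unfolding sb_eq[abs_def] by simp
  have sbp: "sb n > 0" for n using pos(1)[of n] V[of n] \<kappa> by (simp add: sb_def add_pos_nonneg)
  \<comment> \<open>The last summand \<open>\<theta>\<close> makes the inequality demanded by the
    averaging argument strict.\<close>
  define B where "B n = (P + 2 * \<theta>) * ((1 + \<phi> n * S * N / \<eta>)\<^sup>2 * (c0 + \<theta>) + 6 * S * sb n) / (1 - 2 * \<theta>) + \<theta>" for n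
  define Eb where "Eb n = B n + 9 / 4 * (sb n)\<^sup>2 * \<kappa> / \<phi> n
     + (1 + sb n)\<^sup>2 * (\<bar>\<phi> n * V n - 2 * c\<bar> + 4 / \<theta> * e)\<^sup>2 / (\<phi> n * V n) - V n * G (-1 + \<phi> n) / \<phi> n" for n
  define Lb where "Lb n = 2 powr p * (2 powr p * (4 / \<theta> * e) + sb n powr p * V n)" for n
  have B_lim: "B \<longlonglongrightarrow> (P + 2 * \<theta>) * ((1 + 0 * S * N / \<eta>)\<^sup>2 * (c0 + \<theta>) + 6 * S * 0) / (1 - 2 * \<theta>) + \<theta>"
    unfolding B_def[abs_def] by (intro tendsto_intros \<phi>0 sb0) (use \<theta> \<eta> in auto)
  have sq_lim: "(\<lambda>n. 9 / 4 * (sb n)\<^sup>2 * \<kappa> / \<phi> n) \<longlonglongrightarrow> 0"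
  proof -
    have "(\<lambda>n. 9 / 4 * (\<phi> n * (1 + 2 * \<kappa> / (\<phi> n * V n))\<^sup>2) * \<kappa>) \<longlonglongrightarrow> 9 / 4 * (0 * (1 + 2 * \<kappa> / m)\<^sup>2) * \<kappa>"
      by (intro tendsto_intros \<phi>0 mV) (use m0 in auto)
    then have "(\<lambda>n. 9 / 4 * (\<phi> n * (1 + 2 * \<kappa> / (\<phi> n * V n))\<^sup>2) * \<kappa>) \<longlonglongrightarrow> 0" by simp
    moreover have "9 / 4 * (\<phi> n * (1 + 2 * \<kappa> / (\<phi> n * V n))\<^sup>2) * \<kappa> = 9 / 4 * (sb n)\<^sup>2 * \<kappa> / \<phi> n" for n
      unfolding sb_eq power_mult_distrib using pos(1)[of n] by (simp add: power2_eq_square)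
    ultimately show ?thesis by (simp only:)
  qed
  have G_lim: "(\<lambda>n. V n * G (-1 + \<phi> n) / \<phi> n) \<longlonglongrightarrow> m"
  proof -
    have "(\<lambda>n. \<phi> n * V n * ((2 - \<phi> n)\<^sup>2 / 4)) \<longlonglongrightarrow> m * ((2 - 0)\<^sup>2 / 4)"
      by (intro tendsto_intros mV \<phi>0) auto
    moreover have "V n * G (-1 + \<phi> n) / \<phi> n = \<phi> n * V n * ((2 - \<phi> n)\<^sup>2 / 4)" for n
      using pos(1)[of n] by (simp add: G_def power2_eq_square field_simps)
    ultimately show ?thesis by (simp only:) simp
  qed
  have "Eb \<longlonglongrightarrow> ((P + 2 * \<theta>) * ((1 + 0 * S * N / \<eta>)\<^sup>2 * (c0 + \<theta>) + 6 * S * 0) / (1 - 2 * \<theta>) + \<theta>) + 0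
     + (1 + 0)\<^sup>2 * (\<bar>m - 2 * c\<bar> + 4 / \<theta> * e)\<^sup>2 / m - m"
    unfolding Eb_def[abs_def] by (intro tendsto_intros B_lim sq_lim sb0 mV G_lim) (use m0 in auto)
  then have Eb_lim: "Eb \<longlonglongrightarrow> (P + 2 * \<theta>) * (c0 + \<theta>) / (1 - 2 * \<theta>) + \<theta> + (\<bar>m - 2 * c\<bar> + \<theta>)\<^sup>2 / m - m"
    unfolding e4 by simp
  \<comment> \<open>\<open>sb n * V n\<close> stays bounded although the volume diverges, and the
    remaining factor \<open>sb n powr (p - 1)\<close> tends to 0 because
    \<open>p > 1\<close>.\<close>
  have pw: "(\<lambda>n. sb n powr p * V n) \<longlonglongrightarrow> 0"
  proof -
    have "(\<lambda>n. sb n powr (p - 1)) \<longlonglongrightarrow> 0 powr (p - 1)"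
      by (rule tendsto_powr'[OF sb0 tendsto_const]) (use p sbp in \<open>auto intro: always_eventually less_imp_le\<close>)
    then have "(\<lambda>n. sb n powr (p - 1) * (\<phi> n * V n + 2 * \<kappa>)) \<longlonglongrightarrow> 0 * (m + 2 * \<kappa>)"
      by (intro tendsto_intros mV) simp
    moreover have "sb n powr (p - 1) * (\<phi> n * V n + 2 * \<kappa>) = sb n powr p * V n" for n
    proof -
      have "\<phi> n * V n + 2 * \<kappa> = sb n * V n" using V[of n] by (simp add: sb_def field_simps)
      then show ?thesis using sbp[of n] by (simp add: powr_diff)
    qed
    ultimately show ?thesis by simp
  qed
  have "Lb \<longlonglongrightarrow> 2 powr p * (2 powr p * (4 / \<theta> * e) + 0)"
    unfolding Lb_def[abs_def] by (intro tendsto_intros pw)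
  then have Lb_lim: "Lb \<longlonglongrightarrow> 2 powr p * (2 powr p * \<theta>)" unfolding e4 by simp
  have "(\<lambda>n. \<phi> n * ((MD + \<eta>) * S)) \<longlonglongrightarrow> 0 * ((MD + \<eta>) * S)" by (intro tendsto_intros \<phi>0)
  then have ev1: "eventually (\<lambda>n. \<phi> n * ((MD + \<eta>) * S) < \<theta> / 2) sequentially"
    by (rule order_tendstoD) (use \<theta> in simp)
  have ev2: "eventually (\<lambda>n. sb n < 1) sequentially" using sb0 by (rule order_tendstoD) simp
  have ev3: "eventually (\<lambda>n. 2 * R < \<phi> n * L n) sequentially" using big by (simp add: filterlim_at_top_dense)
  have "eventually (\<lambda>n. \<exists>u. minus1_Lp p u \<and> (\<integral>\<^sup>+x. ennreal (\<bar>u x - u0 x\<bar> powr p) \<partial>lebesgue) \<le> ennreal (Lb n)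
       \<and> E_phiL (\<phi> n) (L n) u \<le> ereal (Eb n)) sequentially"
    using ev1 ev2 ev3
  proof eventually_elim
    case (elim n)
    have KU: "cball 0 R \<subseteq> interior (Omega (\<phi> n) (L n) :: 'a set)" by (rule ball_subset_Omega) (use elim(3) in simp)
    have small: "\<phi> n * regnorm D \<eta> x * S \<le> \<theta> / 2" for x
    proof -
      have "\<phi> n * regnorm D \<eta> x * S \<le> \<phi> n * (MD + \<eta>) * S"
        using aM pos(1)[of n] S by (intro mult_right_mono mult_left_mono) auto
      then show ?thesis using elim(1) by (simp add: mult.assoc)
    qed
    let ?X = "(1 + \<phi> n * S * N / \<eta>)\<^sup>2 * (c0 + \<theta>) + 6 * S * sb n"
    have c00: "c0 > 0" by (simp add: c0_def)
    have X0: "?X \<ge> 0" using c00 \<theta> S sbp[of n] by simp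
    have le: "(\<integral>x. indicator (cball 0 R) x * regnorm D \<eta> x \<partial>lborel) * ((1 + \<phi> n * S * N / \<eta>)\<^sup>2 * (\<integral>s. sp.cost s \<partial>lborel) + 6 * S * sb n)
       \<le> (P + 2 * \<theta>) * ?X"
      using Ia Ia0 Ic Ic0 P0 \<theta> S sbp[of n] by (intro mult_mono add_mono mult_left_mono) auto
    have "(P + 2 * \<theta>) * ?X / (1 - 2 * \<theta>) * (1 - 2 * \<theta>) = (P + 2 * \<theta>) * ?X" using \<theta> by simp
    then have "B n * (1 - 2 * \<theta>) = (P + 2 * \<theta>) * ?X + \<theta> * (1 - 2 * \<theta>)" by (simp only: B_def distrib_right)
    moreover have "\<theta> * (1 - 2 * \<theta>) > 0" using \<theta> by simp
    ultimately have less: "(\<integral>x. indicator (cball 0 R) x * regnorm D \<eta> x \<partial>lborel) * ((1 + \<phi> n * S * N / \<eta>)\<^sup>2 * (\<integral>s. sp.cost s \<partial>lborel) + 6 * S * sb n)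
       < B n * (1 - 2 * \<theta>)" using le by linarith
    have B0: "B n \<ge> 0" unfolding B_def using mult_nonneg_nonneg[OF _ X0, of "P + 2 * \<theta>"] P0 \<theta> by simp
    have u0m: "u0 \<in> borel_measurable lebesgue" using u0 by (simp add: minus1_Lp_def)
    from sp.recovery_step[OF pos(1)[of n] pos(2)[of n] KU p \<theta>(1) _ small _ u0m w(3) B0 _ f(5)] \<theta> elim(2) less
    show ?case unfolding Lb_def Eb_def w(4) sb_def V_def \<kappa>_def by simp
  qed
  then show ?thesis by (rule that[OF Eb_lim Lb_lim])
qed

text \<open>All excess terms of the parametrised bound vanish with \<open>\<theta>\<close>, so a
  sufficiently small fixed \<open>\<theta>\<close> serves the given \<open>\<epsilon>\<close> for
  all large \<open>n\<close>.\<close>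

lemma recovery_approximation:
  fixes u0 :: "'a::euclidean_space \<Rightarrow> real" and \<phi> L :: "nat \<Rightarrow> real"
  assumes p: "1 < p" and pos: "\<And>n. \<phi> n > 0" "\<And>n. L n > 0" and \<phi>0: "\<phi> \<longlonglongrightarrow> 0"
    and big: "filterlim (\<lambda>n. \<phi> n * L n) at_top sequentially"
    and mass: "(\<lambda>n. \<phi> n * (\<phi> n * L n) ^ DIM('a)) \<longlonglongrightarrow> m" and m0: "m > 0"
    and u0: "minus1_Lp p u0" and pm: "AE x in lebesgue. u0 x = 1 \<or> u0 x = -1"
    and Per: "Per {x. u0 x = 1} = ereal P" and \<epsilon>: "\<epsilon> > 0"
  defines "c \<equiv> measure lebesgue {x. u0 x = 1}"
  shows "eventually (\<lambda>n. \<exists>u. minus1_Lp p u \<and> (\<integral>\<^sup>+x. ennreal (\<bar>u x - u0 x\<bar> powr p) \<partial>lebesgue) \<le> ennreal \<epsilon>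
       \<and> E_phiL (\<phi> n) (L n) u \<le> ereal (c0 * P + (m - 2 * c)\<^sup>2 / m - m + \<epsilon>)) sequentially"
proof -
  \<comment> \<open>\<open>r 0\<close> equals \<open>1 / 4\<close>, so the strict bound on the
    parameter is required only eventually, in \<open>e3\<close>.\<close>
  define r where "r k = 1 / real (Suc (Suc (Suc (Suc k))))" for k
  have r0: "r \<longlonglongrightarrow> 0" unfolding r_def by (rule LIMSEQ_Suc[OF LIMSEQ_Suc[OF LIMSEQ_Suc[OF LIMSEQ_Suc[OF lim_1_over_n]]]])
  have r: "0 < r k" "r k < 1 / 4 \<or> k = 0" for k by (auto simp: r_def field_simps)
  have "(\<lambda>k. (P + 2 * r k) * (c0 + r k) / (1 - 2 * r k) + r k + (\<bar>m - 2 * c\<bar> + r k)\<^sup>2 / m - m)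
     \<longlonglongrightarrow> (P + 2 * 0) * (c0 + 0) / (1 - 2 * 0) + 0 + (\<bar>m - 2 * c\<bar> + 0)\<^sup>2 / m - m"
    by (intro tendsto_intros r0) (use m0 in auto)
  then have lim: "(\<lambda>k. (P + 2 * r k) * (c0 + r k) / (1 - 2 * r k) + r k + (\<bar>m - 2 * c\<bar> + r k)\<^sup>2 / m - m)
     \<longlonglongrightarrow> c0 * P + (m - 2 * c)\<^sup>2 / m - m" by (simp add: mult.commute)
  have e1: "eventually (\<lambda>k. (P + 2 * r k) * (c0 + r k) / (1 - 2 * r k) + r k + (\<bar>m - 2 * c\<bar> + r k)\<^sup>2 / m - m
     < c0 * P + (m - 2 * c)\<^sup>2 / m - m + \<epsilon>) sequentially"
    using lim by (rule order_tendstoD) (use \<epsilon> in simp)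
  have "(\<lambda>k. 2 powr p * (2 powr p * r k)) \<longlonglongrightarrow> 2 powr p * (2 powr p * 0)" by (intro tendsto_intros r0)
  then have e2: "eventually (\<lambda>k. 2 powr p * (2 powr p * r k) < \<epsilon>) sequentially"
    by (rule order_tendstoD) (use \<epsilon> in simp)
  have e3: "eventually (\<lambda>k. r k < 1 / 4) sequentially" using r0 by (rule order_tendstoD) simp
  obtain k where k: "(P + 2 * r k) * (c0 + r k) / (1 - 2 * r k) + r k + (\<bar>m - 2 * c\<bar> + r k)\<^sup>2 / m - m
     < c0 * P + (m - 2 * c)\<^sup>2 / m - m + \<epsilon>" "2 powr p * (2 powr p * r k) < \<epsilon>" "r k < 1 / 4"
    using eventually_happens'[OF sequentially_bot eventually_conj[OF e1 eventually_conj[OF e2 e3]]] by blast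
  obtain Eb Lb where lims: "Eb \<longlonglongrightarrow> (P + 2 * r k) * (c0 + r k) / (1 - 2 * r k) + r k + (\<bar>m - 2 * c\<bar> + r k)\<^sup>2 / m - m"
    "Lb \<longlonglongrightarrow> 2 powr p * (2 powr p * r k)"
    and ev: "eventually (\<lambda>n. \<exists>u. minus1_Lp p u \<and> (\<integral>\<^sup>+x. ennreal (\<bar>u x - u0 x\<bar> powr p) \<partial>lebesgue) \<le> ennreal (Lb n)
       \<and> E_phiL (\<phi> n) (L n) u \<le> ereal (Eb n)) sequentially"
    by (rule recovery_parameter[OF p pos \<phi>0 big mass m0 u0 pm Per r(1) k(3), folded c_def]) (rule that)
  have "eventually (\<lambda>n. Eb n < c0 * P + (m - 2 * c)\<^sup>2 / m - m + \<epsilon>) sequentially"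
    using lims(1) k(1) by (rule order_tendstoD)
  moreover have "eventually (\<lambda>n. Lb n < \<epsilon>) sequentially" using lims(2) k(2) by (rule order_tendstoD)
  ultimately show ?thesis using ev
  proof eventually_elim
    case (elim n)
    then obtain u where u: "minus1_Lp p u" "(\<integral>\<^sup>+x. ennreal (\<bar>u x - u0 x\<bar> powr p) \<partial>lebesgue) \<le> ennreal (Lb n)"
      "E_phiL (\<phi> n) (L n) u \<le> ereal (Eb n)" by blast
    have A: "ennreal (Lb n) \<le> ennreal \<epsilon>" using elim by (intro ennreal_leI) simp
    have B: "ereal (Eb n) \<le> ereal (c0 * P + (m - 2 * c)\<^sup>2 / m - m + \<epsilon>)" using elim by simp
    show ?case by (intro exI[of _ u] conjI u(1) order_trans[OF u(2) A] order_trans[OF u(3) B])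
  qed
qed

subsection \<open>Gamma-convergence\<close>

text \<open>At index \<open>n\<close> the best solvable accuracy \<open>k \<le> n\<close> is chosen.
  The cap by \<open>n\<close> makes the maximum exist, and monotonicity hands the choice down to
  every coarser accuracy; \<open>d\<close> fills the indices at which none is solvable.\<close>

lemma diagonal_selection:
  fixes Q :: "nat \<Rightarrow> nat \<Rightarrow> 'b \<Rightarrow> bool"
  assumes ev: "\<And>k. eventually (\<lambda>n. \<exists>u. Q k n u) sequentially"
    and mono: "\<And>k l n u. k \<le> l \<Longrightarrow> Q l n u \<Longrightarrow> Q k n u"
  obtains u where "\<And>n. u n = d \<or> (\<exists>k. Q k n (u n))" "\<And>k. eventually (\<lambda>n. Q k n (u n)) sequentially"
proof -
  define A where "A n = {k. k \<le> n \<and> (\<exists>u. Q k n u)}" for n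
  define u where "u n = (if A n = {} then d else SOME u. Q (Max (A n)) n u)" for n
  have fin: "finite (A n)" for n unfolding A_def by simp
  have sel: "Q (Max (A n)) n (u n)" if "A n \<noteq> {}" for n
  proof -
    have "Max (A n) \<in> A n" using fin that by (rule Max_in)
    then have "\<exists>u. Q (Max (A n)) n u" by (simp add: A_def)
    from someI_ex[OF this] show ?thesis using that by (simp add: u_def)
  qed
  show ?thesis
  proof (rule that)
    show "u n = d \<or> (\<exists>k. Q k n (u n))" for n using sel[of n] by (cases "A n = {}") (auto simp: u_def)
    fix k
    show "eventually (\<lambda>n. Q k n (u n)) sequentially"
      using ev[of k] eventually_ge_at_top[of k]
    proof eventually_elim
      case (elim n)
      then have k: "k \<in> A n" by (simp add: A_def)
      then have "k \<le> Max (A n)" using fin by simp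
      with sel[of n] k mono show ?case by blast
    qed
  qed
qed

text \<open>The power \<open>d + 1\<close> of the rescaled quantity is \<open>\<phi>\<close> times
  the volume of the cube, which explains the exponent \<open>d / (d + 1)\<close>. Multiplied by
  \<open>L powr (1 / (d + 1))\<close> the same quantity gives the side length, which therefore
  diverges.\<close>

lemma domain_scaling:
  fixes \<phi> L :: "nat \<Rightarrow> real" and d :: nat
  assumes pos: "\<And>n. \<phi> n > 0" "\<And>n. L n > 0" and L: "filterlim L at_top sequentially"
    and lim: "(\<lambda>n. \<phi> n * L n powr (real d / (real d + 1))) \<longlonglongrightarrow> \<xi>" and xi: "\<xi> > 0"
  shows "(\<lambda>n. \<phi> n * (\<phi> n * L n) ^ d) \<longlonglongrightarrow> \<xi> ^ (d + 1)"
    and "filterlim (\<lambda>n. \<phi> n * L n) at_top sequentially"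
proof -
  let ?x = "\<lambda>n. \<phi> n * L n powr (real d / (real d + 1))"
  have "(?x n) ^ (d + 1) = \<phi> n * (\<phi> n * L n) ^ d" for n
  proof -
    have "(L n powr (real d / (real d + 1))) ^ (d + 1) = L n powr (real d / (real d + 1) * real (d + 1))"
      by (subst powr_power) (use pos(2)[of n] in \<open>auto simp: mult.commute\<close>)
    also have "real d / (real d + 1) * real (d + 1) = real d" by (simp add: field_simps)
    finally have "(L n powr (real d / (real d + 1))) ^ (d + 1) = L n ^ d" using pos(2)[of n] by (simp add: powr_realpow)
    then show ?thesis by (simp add: power_mult_distrib)
  qed
  with tendsto_power[OF lim, of "d + 1"] show "(\<lambda>n. \<phi> n * (\<phi> n * L n) ^ d) \<longlonglongrightarrow> \<xi> ^ (d + 1)" by (simp only:)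
  have "\<phi> n * L n = ?x n * L n powr (1 / (real d + 1))" for n
  proof -
    have "L n powr (real d / (real d + 1)) * L n powr (1 / (real d + 1)) = L n powr 1"
      by (subst powr_add[symmetric]) (simp add: field_simps)
    then show ?thesis using pos(2)[of n] by simp
  qed
  moreover have "filterlim (\<lambda>n. L n powr (1 / (real d + 1))) at_top sequentially"
  proof -
    have "L n powr (1 / (real d + 1)) = exp (1 / (real d + 1) * ln (L n))" for n
      using pos(2)[of n] by (simp add: powr_def)
    moreover have "filterlim (\<lambda>n. exp (1 / (real d + 1) * ln (L n))) at_top sequentially"
      by (intro filterlim_compose[OF exp_at_top] filterlim_tendsto_pos_mult_at_top[OF tendsto_const]
          filterlim_compose[OF ln_at_top L]) simp
    ultimately show ?thesis by (simp only:)
  qed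
  then have "filterlim (\<lambda>n. ?x n * L n powr (1 / (real d + 1))) at_top sequentially"
    by (rule filterlim_tendsto_pos_mult_at_top[OF lim xi])
  ultimately show "filterlim (\<lambda>n. \<phi> n * L n) at_top sequentially" by (simp only:)
qed

theorem theorem1p9:
  fixes p \<xi> :: real
  assumes dim: "DIM('a::euclidean_space) \<ge> 2"
    and p: "1 < p"
    and xi: "0 < \<xi>"
  shows "\<forall>(\<phi>n :: nat \<Rightarrow> real) (Ln :: nat \<Rightarrow> real).
           (\<forall>n. 0 < \<phi>n n \<and> 0 < Ln n) \<and> \<phi>n \<longlonglongrightarrow> 0 \<and> filterlim Ln at_top sequentially \<and>
           (\<lambda>n. \<phi>n n * Ln n powr (real DIM('a) / (real DIM('a) + 1))) \<longlonglongrightarrow> \<xi>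
         \<longrightarrow>
           (\<forall>(un :: nat \<Rightarrow> 'a \<Rightarrow> real) u0.
              (\<forall>n. minus1_Lp p (un n)) \<and> minus1_Lp p u0 \<and> Lp_conv p un u0 \<longrightarrow>
              liminf (\<lambda>n. E_phiL (\<phi>n n) (Ln n) (un n)) \<ge> E0 \<xi> u0) \<and>
           (\<forall>u0 :: 'a \<Rightarrow> real. minus1_Lp p u0 \<longrightarrow>
              (\<exists>un. (\<forall>n. minus1_Lp p (un n)) \<and> Lp_conv p un u0 \<and>
                    limsup (\<lambda>n. E_phiL (\<phi>n n) (Ln n) (un n)) \<le> E0 \<xi> u0))"
proof (intro allI impI conjI)
  fix \<phi>n Ln :: "nat \<Rightarrow> real" and un :: "nat \<Rightarrow> 'a \<Rightarrow> real" and u0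
  assume A: "(\<forall>n. 0 < \<phi>n n \<and> 0 < Ln n) \<and> \<phi>n \<longlonglongrightarrow> 0 \<and> filterlim Ln at_top sequentially \<and>
           (\<lambda>n. \<phi>n n * Ln n powr (real DIM('a) / (real DIM('a) + 1))) \<longlonglongrightarrow> \<xi>"
    and U: "(\<forall>n. minus1_Lp p (un n)) \<and> minus1_Lp p u0 \<and> Lp_conv p un u0"
  have pos: "\<phi>n n > 0" "Ln n > 0" for n using A by auto
  have mass: "(\<lambda>n. \<phi>n n * (\<phi>n n * Ln n) ^ DIM('a)) \<longlonglongrightarrow> \<xi> ^ (DIM('a) + 1)"
    and big: "filterlim (\<lambda>n. \<phi>n n * Ln n) at_top sequentially"
    using domain_scaling[of \<phi>n Ln "DIM('a)" \<xi>] A xi by auto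
  show "E0 \<xi> u0 \<le> liminf (\<lambda>n. E_phiL (\<phi>n n) (Ln n) (un n))"
  proof (rule ccontr)
    assume "\<not> ?thesis"
    then have "liminf (\<lambda>n. E_phiL (\<phi>n n) (Ln n) (un n)) < E0 \<xi> u0" by simp
    \<comment> \<open>A number strictly in between gives infinitely many indices with energy at most
      \<open>M\<close>, that is, a subsequence of uniformly bounded energy.\<close>
    then obtain M where M: "liminf (\<lambda>n. E_phiL (\<phi>n n) (Ln n) (un n)) < ereal M" "ereal M < E0 \<xi> u0"
      using ereal_dense2 by blast
    have "\<not> eventually (\<lambda>n. ereal M < E_phiL (\<phi>n n) (Ln n) (un n)) sequentially"
    proof
      assume "eventually (\<lambda>n. ereal M < E_phiL (\<phi>n n) (Ln n) (un n)) sequentially"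
      then have "ereal M \<le> liminf (\<lambda>n. E_phiL (\<phi>n n) (Ln n) (un n))"
        by (intro Liminf_bounded) (auto elim: eventually_mono)
      then show False using M(1) by simp
    qed
    then have "\<exists>\<^sub>F n in sequentially. E_phiL (\<phi>n n) (Ln n) (un n) \<le> ereal M"
      by (simp add: frequently_def not_le)
    then have inf: "infinite {n. E_phiL (\<phi>n n) (Ln n) (un n) \<le> ereal M}"
      by (simp add: frequently_cofinite[symmetric] cofinite_eq_sequentially)
    define r where "r = enumerate {n. E_phiL (\<phi>n n) (Ln n) (un n) \<le> ereal M}"
    have r: "strict_mono r" unfolding r_def by (rule strict_mono_enumerate[OF inf])
    have rE: "E_phiL (\<phi>n (r n)) (Ln (r n)) (un (r n)) \<le> ereal M" for n
      using enumerate_in_set[OF inf, of n] by (simp add: r_def)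
    have sub: "(\<lambda>n. x (r n)) \<longlonglongrightarrow> l" if "x \<longlonglongrightarrow> l" for x :: "nat \<Rightarrow> 'c::topological_space" and l
      using LIMSEQ_subseq_LIMSEQ[OF that r] by (simp add: o_def)
    have "E0 \<xi> u0 \<le> ereal M"
    proof (rule liminf_core[where \<phi> = "\<lambda>n. \<phi>n (r n)" and L = "\<lambda>n. Ln (r n)" and un = "\<lambda>n. un (r n)", OF p _ _ _ _ _ xi _ _ _ rE])
      show "(\<lambda>n. \<phi>n (r n)) \<longlonglongrightarrow> 0" using A by (intro sub) auto
      show "filterlim (\<lambda>n. \<phi>n (r n) * Ln (r n)) at_top sequentially"
        by (rule filterlim_compose[OF big filterlim_subseq[OF r]])
      show "(\<lambda>n. \<phi>n (r n) * (\<phi>n (r n) * Ln (r n)) ^ DIM('a)) \<longlonglongrightarrow> \<xi> ^ (DIM('a) + 1)" by (rule sub[OF mass])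
      show "Lp_conv p (\<lambda>n. un (r n)) u0" using U sub unfolding Lp_conv_def by blast
    qed (use U pos in auto)
    then show False using M(2) by simp
  qed
next
  fix \<phi>n Ln :: "nat \<Rightarrow> real" and u0 :: "'a \<Rightarrow> real"
  assume A: "(\<forall>n. 0 < \<phi>n n \<and> 0 < Ln n) \<and> \<phi>n \<longlonglongrightarrow> 0 \<and> filterlim Ln at_top sequentially \<and>
           (\<lambda>n. \<phi>n n * Ln n powr (real DIM('a) / (real DIM('a) + 1))) \<longlonglongrightarrow> \<xi>"
    and u0: "minus1_Lp p u0"
  have pos: "\<phi>n n > 0" "Ln n > 0" for n using A by auto
  have \<phi>0: "\<phi>n \<longlonglongrightarrow> 0" using A by simp
  have mass: "(\<lambda>n. \<phi>n n * (\<phi>n n * Ln n) ^ DIM('a)) \<longlonglongrightarrow> \<xi> ^ (DIM('a) + 1)"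
    and big: "filterlim (\<lambda>n. \<phi>n n * Ln n) at_top sequentially"
    using domain_scaling[of \<phi>n Ln "DIM('a)" \<xi>] A xi by auto
  define m where "m = \<xi> ^ (DIM('a) + 1)"
  have m0: "m > 0" using xi by (simp add: m_def)
  let ?C = "{x. u0 x = 1}"
  show "\<exists>un. (\<forall>n. minus1_Lp p (un n)) \<and> Lp_conv p un u0 \<and> limsup (\<lambda>n. E_phiL (\<phi>n n) (Ln n) (un n)) \<le> E0 \<xi> u0"
  proof (cases "(AE x in lebesgue. u0 x = 1 \<or> u0 x = -1) \<and> Per ?C < \<infinity>")
    \<comment> \<open>The limit energy is infinite, so the constant sequence is good enough.\<close>
    case False
    then have "E0 \<xi> u0 = \<infinity>" by (simp add: E0_def Let_def)
    moreover have "Lp_conv p (\<lambda>_. u0) u0" using p by (simp add: Lp_conv_def)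
    ultimately show ?thesis using u0 by (intro exI[of _ "\<lambda>_. u0"]) simp
  next
    case True
    then have pm: "AE x in lebesgue. u0 x = 1 \<or> u0 x = -1" by simp
    obtain P where P: "Per ?C = ereal P" using True Per_nonneg[of ?C] by (cases "Per ?C") auto
    define T where "T = c0 * P + (m - 2 * measure lebesgue ?C)\<^sup>2 / m - m"
    have "(m - 2 * measure lebesgue ?C)\<^sup>2 / m - m = - 4 * measure lebesgue ?C + 4 * inverse m * (measure lebesgue ?C)\<^sup>2"
      using m0 by (simp add: power2_eq_square field_simps)
    then have E0: "E0 \<xi> u0 = ereal T"
      using True unfolding E0_def Let_def m_def[symmetric] T_def by (simp add: P)
    \<comment> \<open>One accuracy \<open>1 / Suc k\<close> governs both distance and energy, which
      makes \<open>Q\<close> monotone in \<open>k\<close> as the diagonal choice requires.\<close>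
    define Q where "Q k n u \<longleftrightarrow> minus1_Lp p u
       \<and> (\<integral>\<^sup>+x. ennreal (\<bar>u x - u0 x\<bar> powr p) \<partial>lebesgue) \<le> ennreal (1 / real (Suc k))
       \<and> E_phiL (\<phi>n n) (Ln n) u \<le> ereal (T + 1 / real (Suc k))" for k n u
    have "eventually (\<lambda>n. \<exists>u. Q k n u) sequentially" for k
      using recovery_approximation[OF p pos \<phi>0 big mass[folded m_def] m0 u0 pm P, of "1 / real (Suc k)"]
      unfolding Q_def T_def by simp
    moreover have "Q k n u" if "k \<le> l" "Q l n u" for k l n u
    proof -
      have "1 / real (Suc l) \<le> 1 / real (Suc k)" using that(1) by (intro divide_left_mono) auto
      then have AB: "ennreal (1 / real (Suc l)) \<le> ennreal (1 / real (Suc k))" "ereal (T + 1 / real (Suc l)) \<le> ereal (T + 1 / real (Suc k))"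
        by (auto intro: ennreal_leI)
      have u: "minus1_Lp p u" "(\<integral>\<^sup>+x. ennreal (\<bar>u x - u0 x\<bar> powr p) \<partial>lebesgue) \<le> ennreal (1 / real (Suc l))"
        "E_phiL (\<phi>n n) (Ln n) u \<le> ereal (T + 1 / real (Suc l))"
        using that(2) unfolding Q_def by auto
      show ?thesis unfolding Q_def
        by (intro conjI u(1) order_trans[OF u(2) AB(1)] order_trans[OF u(3) AB(2)])
    qed
    ultimately obtain un where un: "\<And>n. un n = u0 \<or> (\<exists>k. Q k n (un n))" "\<And>k. eventually (\<lambda>n. Q k n (un n)) sequentially"
      using diagonal_selection[of Q u0] by blast
    have "minus1_Lp p (un n)" for n using un(1)[of n] u0 unfolding Q_def by metis
    moreover have "Lp_conv p un u0"
      unfolding Lp_conv_def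
    proof (rule order_tendstoI)
      fix y :: ennreal assume y: "0 < y"
      have "(\<lambda>k. ennreal (1 / real (Suc k))) \<longlonglongrightarrow> ennreal 0"
        using LIMSEQ_Suc[OF lim_1_over_n[where 'a=real]] by (intro tendsto_ennrealI) simp
      then have "eventually (\<lambda>k. ennreal (1 / real (Suc k)) < y) sequentially" using y by (intro order_tendstoD(2)) auto
      then obtain k where k: "ennreal (1 / real (Suc k)) < y" by (auto simp: eventually_sequentially)
      show "eventually (\<lambda>n. (\<integral>\<^sup>+x. ennreal (\<bar>un n x - u0 x\<bar> powr p) \<partial>lebesgue) < y) sequentially"
        using un(2)[of k] by eventually_elim (auto simp: Q_def intro: order_le_less_trans[OF _ k])
    qed simp
    moreover have "limsup (\<lambda>n. E_phiL (\<phi>n n) (Ln n) (un n)) \<le> ereal T"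
    proof (rule ereal_le_epsilon2)
      fix \<epsilon> :: real assume "\<epsilon> > 0"
      then obtain k where k: "1 / real (Suc k) < \<epsilon>" using nat_approx_posE by blast
      have "limsup (\<lambda>n. E_phiL (\<phi>n n) (Ln n) (un n)) \<le> ereal (T + 1 / real (Suc k))"
        by (rule Limsup_bounded) (use un(2)[of k] in \<open>auto simp: Q_def elim: eventually_mono\<close>)
      also have "\<dots> \<le> ereal T + ereal \<epsilon>" using k by simp
      finally show "limsup (\<lambda>n. E_phiL (\<phi>n n) (Ln n) (un n)) \<le> ereal T + ereal \<epsilon>" .
    qed
    ultimately show ?thesis unfolding E0 by blast
  qed
qed

end
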